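(* Let $\mathcal{M}=\mathcal{M}(\Sigma,I)$ be an irreducible trace monoid. 1. Assume that $\mathbb{P}$ is a Bernoulli measure on $(\partial\mathcal{M},\mathfrak{F})$, and let $f_{\mathbb{P}}(u)=\mathbb{P}(\uparrow u)$, $u\in\mathcal{M}$, be the induced valuation, with Möbius transform $h:\mathscr{C}\to\mathbb{R}$. Then, under $\mathbb{P}$, the sequence $(C_k)_{k\geq1}$ of Cartier–Foata cliques is an irreducible and aperiodic Markov chain with values in $\mathfrak{C}$. The law of $C_1$ is the restriction of $h$ to $\mathfrak{C}$, and $h>0$ on $\mathfrak{C}$. The transition matrix of the chain is $P=(P_{c,c'})_{(c,c')\in\mathfrak{C}\times\mathfrak{C}}$ given by $$P_{c,c'}=\begin{cases}h(c')/g(c),&\text{if }c\to c',\\0,&\text{otherwise},\end{cases}\qquad\text{with } g(c)=\sum_{c'\in\mathfrak{C}\,:\,c\to c'}h(c').\qquad(\ast)$$ Furthermore, for any integer $n\geq1$ and any non-empty cliques $c_1,\ldots,c_n$ such that $c_1\to\ldots\to c_n$, $$\mathbb{P}(C_1=c_1,\ldots,C_n=c_n)=f_{\mathbb{P}}(c_1)\cdots f_{\mathbb{P}}(c_{n-1})\,h(c_n).$$ 2. Conversely, let $f:\mathcal{M}\to\mathbb{R}_+^*$ be a Möbius valuation and let $h:\mathscr{C}\to\mathbb{R}$ be its Möbius transform. Then the restriction $h|_{\mathfrak{C}}$ is a probability distribution on $\mathfrak{C}$. The Markov chain on $\mathfrak{C}$ with initial law $h|_{\mathfrak{C}}$ and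 with transition matrix $P$ defined from $h$ by formula $(\ast)$ induces a Bernoulli measure $\mathbb{P}$ on $\partial\mathcal{M}$ which satisfies $\mathbb{P}(\uparrow u)=f(u)$ for all $u\in\mathcal{M}$.
   Context: Trace monoids. An independence pair $(\Sigma,I)$ consists of a finite non-empty set $\Sigma$ (letters) and an irreflexive symmetric relation $I\subseteq\Sigma\times\Sigma$. The trace monoid is $\mathcal{M}=\mathcal{M}(\Sigma,I)=\langle\Sigma\mid\alpha\cdot\beta=\beta\cdot\alpha\text{ for }(\alpha,\beta)\in I\rangle$; its elements are called traces, its unit is denoted $0$, and $|u|$ is the length of any word representing $u$. Put $D=(\Sigma\times\Sigma)\setminus I$. $\mathcal{M}$ is irreducible if the undirected graph $(\Sigma,D)$ is connected. Left divisibility: $u\leq v$ iff $v=u\cdot w$ for some $w\in\mathcal{M}$; this is a partial order. Cliques. A clique is a trace $\alpha_1\cdot\ldots\cdot\alpha_n$, $n\geq0$, with $(\alpha_i,\alpha_j)\in I$ for all $i\neq j$; it is identified with the set of its letters. $\mathscr{C}$ is the (finite) set of cliques and $\mathfrak{C}=\mathscr{C}\setminus\{0\}$. For cliques $c,c'$, write $c\to c'$ if for every $\beta\in c'$ there is $\alpha\in c$ with $(\alpha,\beta)\in D$. Boundary. Consider non-decreasing sequences $(u_k)_{k\geq0}$ in $(\mathcal{M},\leq)$, pre-ordered by $(u_k)\preccurlyeq(u'_k)$ iff for every $k$ there is $k'$ with $u_k\leq u'_{k'}$. Let $(\mathcal{W},\leq)$ be the partial order obtained by quotienting by the associated equivalence.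 $\mathcal{M}$ embeds in $\mathcal{W}$ through constant sequences. The boundary is $\partial\mathcal{M}=\mathcal{W}\setminus\mathcal{M}$. For $u\in\mathcal{M}$, $\uparrow u=\{\xi\in\partial\mathcal{M}: u\leq\xi\}$, and $\mathfrak{F}$ is the $\sigma$-algebra on $\partial\mathcal{M}$ generated by all sets $\uparrow u$, $u\in\mathcal{M}$. Cartier–Foata cliques. For each $\xi\in\partial\mathcal{M}$ there is a unique sequence $(C_k(\xi))_{k\geq1}$ of non-empty cliques such that $C_k(\xi)\to C_{k+1}(\xi)$ for all $k\geq1$ and $\bigvee_{k\geq1}(C_1(\xi)\cdot\ldots\cdot C_k(\xi))=\xi$ (least upper bound in $\mathcal{W}$). The map $\Psi:\xi\mapsto(C_k(\xi))_{k\geq1}$ is a bi-measurable bijection from $(\partial\mathcal{M},\mathfrak{F})$ onto $(\Omega,\mathfrak{G})$, where $\Omega$ is the set of right-infinite paths $c_1\to c_2\to\cdots$ in the graph $(\mathfrak{C},\to)$ with the $\sigma$-algebra $\mathfrak{G}$ induced by the product $\sigma$-algebra. The measure on $\partial\mathcal{M}$ induced by a Markov chain with paths in $\Omega$ is the image of its law under $\Psi^{-1}$. Bernoulli measures. A probability measure $\mathbb{P}$ on $(\partial\mathcal{M},\mathfrak{F})$ is Bernoulli if $\mathbb{P}(\uparrow u)>0$ for all $u\in\mathcal{M}$ and $\mathbb{P}(\uparrow(u\cdot v))=\mathbb{P}(\uparrow u)\,\mathbb{P}(\uparrow v)$ for all $u,v\in\mathcal{M}$. Möbius valuations. $\mathbb{R}_+^*$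 is the set of positive reals. A valuation is a function $f:\mathcal{M}\to\mathbb{R}_+^*$ with $f(u\cdot v)=f(u)f(v)$ for all $u,v$. Its Möbius transform is $h:\mathscr{C}\to\mathbb{R}$, $h(c)=\sum_{c'\in\mathscr{C},\,c\leq c'}(-1)^{|c'|-|c|}f(c')$. The valuation $f$ is a Möbius valuation if $h(0)=0$ and $h(c)>0$ for all $c\in\mathfrak{C}$. *)

theory Defs
  imports "HOL-Probability.Probability" "HOL-Algebra.Divisibility"
begin

section \<open>Trace monoids\<close>

definition independence_pair :: "'a set \<Rightarrow> ('a \<times> 'a) set \<Rightarrow> bool" where
  "independence_pair S I \<longleftrightarrow> finite S \<and> S \<noteq> {} \<and> I \<subseteq> S \<times> S \<and> irrefl I \<and> sym I"

definition commutation_step :: "('a \<times> 'a) set \<Rightarrow> ('a list \<times> 'a list) set" where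
  "commutation_step I = {(x @ [a, b] @ y, x @ [b, a] @ y) | x y a b. (a, b) \<in> I}"

definition trace_congruence :: "'a set \<Rightarrow> ('a \<times> 'a) set \<Rightarrow> ('a list \<times> 'a list) set" where
  "trace_congruence S I =
     (commutation_step I \<union> (commutation_step I)\<inverse>)\<^sup>* \<inter> lists S \<times> lists S"

text \<open>A trace is a congruence class of words over the alphabet \<open>S\<close>.\<close>

type_synonym 'a trace = "'a list set"

definition trace_monoid :: "'a set \<Rightarrow> ('a \<times> 'a) set \<Rightarrow> 'a trace monoid" where
  "trace_monoid S I =
     \<lparr>carrier = lists S // trace_congruence S I,
      mult = (\<lambda>u v. trace_congruence S I `` {x @ y | x y. x \<in> u \<and> y \<in> v}),
      one = trace_congruence S I `` {[]}\<rparr>"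

lemma equiv_trace_congruence: "equiv (lists S) (trace_congruence S I)"
proof (rule equivI)
  let ?R = "commutation_step I \<union> (commutation_step I)\<inverse>"
  show "trace_congruence S I \<subseteq> lists S \<times> lists S"
    by (auto simp: trace_congruence_def)
  show "refl_on (lists S) (trace_congruence S I)"
    by (auto simp: refl_on_def trace_congruence_def)
  have "sym (?R\<^sup>*)"
    by (intro sym_rtrancl sym_Un_converse)
  then show "sym (trace_congruence S I)"
    by (auto simp: sym_def trace_congruence_def)
  show "trans (trace_congruence S I)"
    by (auto simp: trans_def trace_congruence_def)
qed

lemma trace_congruence_append:
  assumes "(x, x') \<in> trace_congruence S I" "(y, y') \<in> trace_congruence S I"
  shows "(x @ y, x' @ y') \<in> trace_congruence S I"
proof -
  let ?R = "commutation_step I \<union> (commutation_step I)\<inverse>"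
  have step_left: "(w @ v, w' @ v) \<in> commutation_step I"
    if "(w, w') \<in> commutation_step I" for w w' v
  proof -
    from that obtain p q a b where "w = p @ [a, b] @ q" "w' = p @ [b, a] @ q" "(a, b) \<in> I"
      by (auto simp: commutation_step_def)
    then have "w @ v = p @ [a, b] @ (q @ v)" "w' @ v = p @ [b, a] @ (q @ v)" "(a, b) \<in> I"
      by auto
    then show ?thesis unfolding commutation_step_def by blast
  qed
  have step_right: "(v @ w, v @ w') \<in> commutation_step I"
    if "(w, w') \<in> commutation_step I" for w w' v
  proof -
    from that obtain p q a b where "w = p @ [a, b] @ q" "w' = p @ [b, a] @ q" "(a, b) \<in> I"
      by (auto simp: commutation_step_def)
    then have "v @ w = (v @ p) @ [a, b] @ q" "v @ w' = (v @ p) @ [b, a] @ q" "(a, b) \<in> I"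
      by auto
    then show ?thesis unfolding commutation_step_def by blast
  qed
  have left: "(w @ v, w' @ v) \<in> ?R\<^sup>*" if "(w, w') \<in> ?R\<^sup>*" for w w' v
    using that by induction (blast intro: step_left rtrancl_into_rtrancl)+
  have right: "(v @ w, v @ w') \<in> ?R\<^sup>*" if "(w, w') \<in> ?R\<^sup>*" for w w' v
    using that by induction (blast intro: step_right rtrancl_into_rtrancl)+
  have "(x @ y, x' @ y') \<in> ?R\<^sup>*"
    using assms by (intro rtrancl_trans[OF left right]) (simp_all add: trace_congruence_def)
  then show ?thesis
    using assms by (auto simp: trace_congruence_def)
qed

lemma trace_mult_class:
  assumes "x \<in> lists S" "y \<in> lists S"
  shows "trace_congruence S I `` {x} \<otimes>\<^bsub>trace_monoid S I\<^esub> trace_congruence S I `` {y}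
           = trace_congruence S I `` {x @ y}"
proof -
  let ?T = "trace_congruence S I"
  have r: "(w, w) \<in> ?T" if "w \<in> lists S" for w
    using that by (simp add: trace_congruence_def)
  have t: "trans ?T"
    using equiv_trace_congruence[of S I] by (simp add: equiv_def)
  have "?T `` {p @ q | p q. p \<in> ?T `` {x} \<and> q \<in> ?T `` {y}} = ?T `` {x @ y}"
  proof
    show "?T `` {p @ q | p q. p \<in> ?T `` {x} \<and> q \<in> ?T `` {y}} \<subseteq> ?T `` {x @ y}"
    proof
      fix z assume "z \<in> ?T `` {p @ q | p q. p \<in> ?T `` {x} \<and> q \<in> ?T `` {y}}"
      then obtain p q where "(x, p) \<in> ?T" "(y, q) \<in> ?T" and z: "(p @ q, z) \<in> ?T"
        by blast
      then have "(x @ y, p @ q) \<in> ?T"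
        by (simp add: trace_congruence_append)
      then show "z \<in> ?T `` {x @ y}"
        using transD[OF t _ z] by simp
    qed
    show "?T `` {x @ y} \<subseteq> ?T `` {p @ q | p q. p \<in> ?T `` {x} \<and> q \<in> ?T `` {y}}"
      using r[OF assms(1)] r[OF assms(2)] by blast
  qed
  then show ?thesis by (simp add: trace_monoid_def)
qed

lemma monoid_trace_monoid: "monoid (trace_monoid S I)"
proof -
  let ?M = "trace_monoid S I" and ?T = "trace_congruence S I"
  have car: "u \<in> carrier ?M \<longleftrightarrow> (\<exists>x\<in>lists S. u = ?T `` {x})" for u
    by (auto simp: trace_monoid_def quotient_def)
  have one: "\<one>\<^bsub>?M\<^esub> = ?T `` {[]}"
    by (simp add: trace_monoid_def)
  have app: "x @ y \<in> lists S" if "x \<in> lists S" "y \<in> lists S" for x y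
    using that by auto
  show ?thesis
  proof
    show "u \<otimes>\<^bsub>?M\<^esub> v \<in> carrier ?M" if "u \<in> carrier ?M" "v \<in> carrier ?M" for u v
      using that app by (metis car trace_mult_class)
    show "u \<otimes>\<^bsub>?M\<^esub> v \<otimes>\<^bsub>?M\<^esub> w = u \<otimes>\<^bsub>?M\<^esub> (v \<otimes>\<^bsub>?M\<^esub> w)"
      if uvw: "u \<in> carrier ?M" "v \<in> carrier ?M" "w \<in> carrier ?M" for u v w
    proof -
      obtain x y z where x: "x \<in> lists S" "u = ?T `` {x}" and y: "y \<in> lists S" "v = ?T `` {y}"
        and z: "z \<in> lists S" "w = ?T `` {z}"
        using uvw by (auto simp: car)
      show ?thesis
        unfolding x(2) y(2) z(2)
        by (simp only: trace_mult_class x(1) y(1) z(1) app append_assoc)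
    qed
    show "\<one>\<^bsub>?M\<^esub> \<in> carrier ?M"
      by (auto simp: car one)
    show "\<one>\<^bsub>?M\<^esub> \<otimes>\<^bsub>?M\<^esub> u = u" if "u \<in> carrier ?M" for u
      using that by (metis append_Nil car lists.Nil one trace_mult_class)
    show "u \<otimes>\<^bsub>?M\<^esub> \<one>\<^bsub>?M\<^esub> = u" if "u \<in> carrier ?M" for u
      using that by (metis append_Nil2 car lists.Nil one trace_mult_class)
  qed
qed

text \<open>All words of a trace have the same length and the same letters.\<close>

definition trace_length :: "'a trace \<Rightarrow> nat" where
  "trace_length u = (THE n. \<exists>w\<in>u. length w = n)"

definition trace_letters :: "'a trace \<Rightarrow> 'a set" where
  "trace_letters u = (\<Union>w\<in>u. set w)"

definition dependence :: "'a set \<Rightarrow> ('a \<times> 'a) set \<Rightarrow> ('a \<times> 'a) set" where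
  "dependence S I = S \<times> S - I"

definition irreducible_trace_monoid :: "'a set \<Rightarrow> ('a \<times> 'a) set \<Rightarrow> bool" where
  "irreducible_trace_monoid S I \<longleftrightarrow> (\<forall>a\<in>S. \<forall>b\<in>S. (a, b) \<in> (dependence S I)\<^sup>*)"


section \<open>Cliques\<close>

definition cliques :: "'a set \<Rightarrow> ('a \<times> 'a) set \<Rightarrow> 'a trace set" where
  "cliques S I = {trace_congruence S I `` {w} | w. w \<in> lists S \<and>
     (\<forall>i<length w. \<forall>j<length w. i \<noteq> j \<longrightarrow> (w ! i, w ! j) \<in> I)}"

definition nonempty_cliques :: "'a set \<Rightarrow> ('a \<times> 'a) set \<Rightarrow> 'a trace set" where
  "nonempty_cliques S I = cliques S I - {\<one>\<^bsub>trace_monoid S I\<^esub>}"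

definition clique_arrow :: "'a set \<Rightarrow> ('a \<times> 'a) set \<Rightarrow> 'a trace \<Rightarrow> 'a trace \<Rightarrow> bool" where
  "clique_arrow S I c c' \<longleftrightarrow>
     (\<forall>b\<in>trace_letters c'. \<exists>a\<in>trace_letters c. (a, b) \<in> dependence S I)"


section \<open>The boundary\<close>

definition nondecreasing_seqs :: "'a set \<Rightarrow> ('a \<times> 'a) set \<Rightarrow> (nat \<Rightarrow> 'a trace) set" where
  "nondecreasing_seqs S I =
     {u. \<forall>k. u k \<in> carrier (trace_monoid S I) \<and> u k divides\<^bsub>trace_monoid S I\<^esub> u (Suc k)}"

definition seq_le :: "'a set \<Rightarrow> ('a \<times> 'a) set \<Rightarrow> (nat \<Rightarrow> 'a trace) \<Rightarrow> (nat \<Rightarrow> 'a trace) \<Rightarrow> bool" where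
  "seq_le S I u u' \<longleftrightarrow> (\<forall>k. \<exists>k'. u k divides\<^bsub>trace_monoid S I\<^esub> u' k')"

definition seq_equiv ::
    "'a set \<Rightarrow> ('a \<times> 'a) set \<Rightarrow> ((nat \<Rightarrow> 'a trace) \<times> (nat \<Rightarrow> 'a trace)) set" where
  "seq_equiv S I = {(u, u'). u \<in> nondecreasing_seqs S I \<and> u' \<in> nondecreasing_seqs S I \<and>
     seq_le S I u u' \<and> seq_le S I u' u}"

text \<open>Generalized traces: the points of the quotient \<open>\<W>\<close>.\<close>

type_synonym 'a gtrace = "(nat \<Rightarrow> 'a trace) set"

definition gtraces :: "'a set \<Rightarrow> ('a \<times> 'a) set \<Rightarrow> 'a gtrace set" where
  "gtraces S I = nondecreasing_seqs S I // seq_equiv S I"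

definition gtrace_le :: "'a set \<Rightarrow> ('a \<times> 'a) set \<Rightarrow> 'a gtrace \<Rightarrow> 'a gtrace \<Rightarrow> bool" where
  "gtrace_le S I X Y \<longleftrightarrow> (\<exists>u\<in>X. \<exists>v\<in>Y. seq_le S I u v)"

definition gtrace_of :: "'a set \<Rightarrow> ('a \<times> 'a) set \<Rightarrow> 'a trace \<Rightarrow> 'a gtrace" where
  "gtrace_of S I u = seq_equiv S I `` {\<lambda>_. u}"

definition gtrace_is_lub :: "'a set \<Rightarrow> ('a \<times> 'a) set \<Rightarrow> 'a gtrace set \<Rightarrow> 'a gtrace \<Rightarrow> bool" where
  "gtrace_is_lub S I A X \<longleftrightarrow> X \<in> gtraces S I \<and> (\<forall>Y\<in>A. gtrace_le S I Y X) \<and>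
     (\<forall>Z\<in>gtraces S I. (\<forall>Y\<in>A. gtrace_le S I Y Z) \<longrightarrow> gtrace_le S I X Z)"

definition boundary :: "'a set \<Rightarrow> ('a \<times> 'a) set \<Rightarrow> 'a gtrace set" where
  "boundary S I = gtraces S I - gtrace_of S I ` carrier (trace_monoid S I)"

definition up :: "'a set \<Rightarrow> ('a \<times> 'a) set \<Rightarrow> 'a trace \<Rightarrow> 'a gtrace set" where
  "up S I u = {\<xi> \<in> boundary S I. gtrace_le S I (gtrace_of S I u) \<xi>}"

definition boundary_algebra :: "'a set \<Rightarrow> ('a \<times> 'a) set \<Rightarrow> 'a gtrace measure" where
  "boundary_algebra S I = sigma (boundary S I) (up S I ` carrier (trace_monoid S I))"


section \<open>Cartier--Foata cliques\<close>

text \<open>Sequences of cliques are indexed from \<open>0\<close>: entry \<open>k\<close> is the clique \<open>C\<^sub>k\<^sub>+\<^sub>1\<close>.\<close>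

definition clique_paths :: "'a set \<Rightarrow> ('a \<times> 'a) set \<Rightarrow> (nat \<Rightarrow> 'a trace) set" where
  "clique_paths S I =
     {c. \<forall>k. c k \<in> nonempty_cliques S I \<and> clique_arrow S I (c k) (c (Suc k))}"

definition clique_path_algebra :: "'a set \<Rightarrow> ('a \<times> 'a) set \<Rightarrow> (nat \<Rightarrow> 'a trace) measure" where
  "clique_path_algebra S I =
     restrict_space (\<Pi>\<^sub>M k\<in>UNIV. count_space (nonempty_cliques S I)) (clique_paths S I)"

primrec trace_prefix :: "'a set \<Rightarrow> ('a \<times> 'a) set \<Rightarrow> (nat \<Rightarrow> 'a trace) \<Rightarrow> nat \<Rightarrow> 'a trace" where
  "trace_prefix S I c 0 = \<one>\<^bsub>trace_monoid S I\<^esub>"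
| "trace_prefix S I c (Suc k) = trace_prefix S I c k \<otimes>\<^bsub>trace_monoid S I\<^esub> c k"

definition cartier_foata :: "'a set \<Rightarrow> ('a \<times> 'a) set \<Rightarrow> 'a gtrace \<Rightarrow> nat \<Rightarrow> 'a trace" where
  "cartier_foata S I \<xi> = (THE c. c \<in> clique_paths S I \<and>
     gtrace_is_lub S I (range (\<lambda>k. gtrace_of S I (trace_prefix S I c (Suc k)))) \<xi>)"

text \<open>The image under \<open>\<Psi>\<^sup>-\<^sup>1\<close> of a measure on the space of clique paths.\<close>

definition induced_boundary_measure ::
    "'a set \<Rightarrow> ('a \<times> 'a) set \<Rightarrow> (nat \<Rightarrow> 'a trace) measure \<Rightarrow> 'a gtrace measure" where
  "induced_boundary_measure S I Q =
     distr Q (boundary_algebra S I) (the_inv_into (boundary S I) (cartier_foata S I))"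


section \<open>Bernoulli measures and Moebius valuations\<close>

definition bernoulli_measure :: "'a set \<Rightarrow> ('a \<times> 'a) set \<Rightarrow> 'a gtrace measure \<Rightarrow> bool" where
  "bernoulli_measure S I P \<longleftrightarrow>
     prob_space P \<and> space P = boundary S I \<and> sets P = sets (boundary_algebra S I) \<and>
     (\<forall>u\<in>carrier (trace_monoid S I). measure P (up S I u) > 0) \<and>
     (\<forall>u\<in>carrier (trace_monoid S I). \<forall>v\<in>carrier (trace_monoid S I).
        measure P (up S I (u \<otimes>\<^bsub>trace_monoid S I\<^esub> v)) = measure P (up S I u) * measure P (up S I v))"

definition valuation :: "'a set \<Rightarrow> ('a \<times> 'a) set \<Rightarrow> ('a trace \<Rightarrow> real) \<Rightarrow> bool" where
  "valuation S I f \<longleftrightarrow>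
     (\<forall>u\<in>carrier (trace_monoid S I). f u > 0) \<and>
     (\<forall>u\<in>carrier (trace_monoid S I). \<forall>v\<in>carrier (trace_monoid S I).
        f (u \<otimes>\<^bsub>trace_monoid S I\<^esub> v) = f u * f v)"

definition moebius_transform ::
    "'a set \<Rightarrow> ('a \<times> 'a) set \<Rightarrow> ('a trace \<Rightarrow> real) \<Rightarrow> 'a trace \<Rightarrow> real" where
  "moebius_transform S I f c =
     (\<Sum>c' | c' \<in> cliques S I \<and> c divides\<^bsub>trace_monoid S I\<^esub> c'.
        (- 1) ^ (trace_length c' - trace_length c) * f c')"

definition moebius_valuation :: "'a set \<Rightarrow> ('a \<times> 'a) set \<Rightarrow> ('a trace \<Rightarrow> real) \<Rightarrow> bool" where
  "moebius_valuation S I f \<longleftrightarrow> valuation S I f \<and>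
     moebius_transform S I f \<one>\<^bsub>trace_monoid S I\<^esub> = 0 \<and>
     (\<forall>c\<in>nonempty_cliques S I. moebius_transform S I f c > 0)"

definition clique_transition ::
    "'a set \<Rightarrow> ('a \<times> 'a) set \<Rightarrow> ('a trace \<Rightarrow> real) \<Rightarrow> 'a trace \<Rightarrow> 'a trace \<Rightarrow> real" where
  "clique_transition S I h c c' =
     (if clique_arrow S I c c'
      then h c' / (\<Sum>d | d \<in> nonempty_cliques S I \<and> clique_arrow S I c d. h d)
      else 0)"


section \<open>Markov chains on a finite state space\<close>

definition prob_distribution_on :: "'s set \<Rightarrow> ('s \<Rightarrow> real) \<Rightarrow> bool" where
  "prob_distribution_on E p \<longleftrightarrow> (\<forall>x\<in>E. p x \<ge> 0) \<and> (\<Sum>x\<in>E. p x) = 1"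

definition stochastic_matrix :: "'s set \<Rightarrow> ('s \<Rightarrow> 's \<Rightarrow> real) \<Rightarrow> bool" where
  "stochastic_matrix E T \<longleftrightarrow> (\<forall>x\<in>E. prob_distribution_on E (T x))"

primrec matrix_power :: "'s set \<Rightarrow> ('s \<Rightarrow> 's \<Rightarrow> real) \<Rightarrow> nat \<Rightarrow> 's \<Rightarrow> 's \<Rightarrow> real" where
  "matrix_power E T 0 x y = (if x = y then 1 else 0)"
| "matrix_power E T (Suc n) x y = (\<Sum>z\<in>E. T x z * matrix_power E T n z y)"

definition irreducible_matrix :: "'s set \<Rightarrow> ('s \<Rightarrow> 's \<Rightarrow> real) \<Rightarrow> bool" where
  "irreducible_matrix E T \<longleftrightarrow> (\<forall>x\<in>E. \<forall>y\<in>E. \<exists>n. matrix_power E T n x y > 0)"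

definition aperiodic_matrix :: "'s set \<Rightarrow> ('s \<Rightarrow> 's \<Rightarrow> real) \<Rightarrow> bool" where
  "aperiodic_matrix E T \<longleftrightarrow> (\<forall>x\<in>E. Gcd {n. n \<ge> 1 \<and> matrix_power E T n x x > 0} = 1)"

text \<open>
  \<open>X\<close> is, under \<open>M\<close>, a homogeneous Markov chain with values in the finite set \<open>E\<close>,
  initial law \<open>p\<close> and transition matrix \<open>T\<close>.
\<close>

definition markov_chain ::
    "'w measure \<Rightarrow> 's set \<Rightarrow> (nat \<Rightarrow> 'w \<Rightarrow> 's) \<Rightarrow> ('s \<Rightarrow> real) \<Rightarrow> ('s \<Rightarrow> 's \<Rightarrow> real) \<Rightarrow> bool" where
  "markov_chain M E X p T \<longleftrightarrow>
     prob_space M \<and> finite E \<and> prob_distribution_on E p \<and> stochastic_matrix E T \<and>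
     (\<forall>n. X n \<in> measurable M (count_space E)) \<and>
     (\<forall>x\<in>E. \<P>(\<omega> in M. X 0 \<omega> = x) = p x) \<and>
     (\<forall>n x. (\<forall>k\<le>Suc n. x k \<in> E) \<longrightarrow> \<P>(\<omega> in M. \<forall>k\<le>n. X k \<omega> = x k) > 0 \<longrightarrow>
        \<P>(\<omega> in M. X (Suc n) \<omega> = x (Suc n) \<bar> \<forall>k\<le>n. X k \<omega> = x k) = T (x n) (x (Suc n)))"

text \<open>
  \<open>Q\<close> is the law, on the space of clique paths, of the Markov chain on the non-empty cliques
  with initial law \<open>p\<close> and transition matrix \<open>T\<close>.
\<close>

definition clique_chain_law ::
    "'a set \<Rightarrow> ('a \<times> 'a) set \<Rightarrow> ('a trace \<Rightarrow> real) \<Rightarrow> ('a trace \<Rightarrow> 'a trace \<Rightarrow> real)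
     \<Rightarrow> (nat \<Rightarrow> 'a trace) measure \<Rightarrow> bool" where
  "clique_chain_law S I p T Q \<longleftrightarrow>
     space Q = clique_paths S I \<and> sets Q = sets (clique_path_algebra S I) \<and>
     markov_chain Q (nonempty_cliques S I) (\<lambda>k \<omega>. \<omega> k) p T"

end

theory Submission
  imports Defs "HOL-Library.Sublist"
begin

text \<open>
  For a trace \<open>u\<close> and a boundary point \<open>\<xi>\<close> above it, the letters \<open>a\<close> with \<open>u \<cdot> a \<le> \<xi>\<close> form a clique
  \<open>R\<^sub>u(\<xi>)\<close>, and \<open>u \<cdot> c \<le> \<xi>\<close> holds for a clique \<open>c\<close> if and only if \<open>c \<subseteq> R\<^sub>u(\<xi>)\<close>. Hence Moebius inversion
  expresses \<open>\<P>(R\<^sub>u = c)\<close> through the measures of the sets \<open>\<up>(u \<cdot> c')\<close>; for a Bernoulli measure the result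
  is \<open>f(u) h(c)\<close>. If \<open>c\<^sub>1 \<rightarrow> \<dots> \<rightarrow> c\<^sub>n\<close> and \<open>u = c\<^sub>1 \<cdots> c\<^sub>n\<^sub>-\<^sub>1\<close>, the event \<open>C\<^sub>1 = c\<^sub>1, \<dots>, C\<^sub>n = c\<^sub>n\<close> is \<open>R\<^sub>u = c\<^sub>n\<close>,
  which gives the law of the chain; the transition matrix follows from \<open>h(c) = f(c) \<Sum>\<^sub>c\<^sub>\<rightarrow>\<^sub>d h(d)\<close>.
  The same identity propagates positivity of \<open>h\<close> backwards along arrows, starting at a maximal
  clique \<open>m\<close>, where \<open>h(m) = f(m)\<close>; irreducibility makes maximal cliques reachable from every clique.

  Conversely, the chain built from a Moebius valuation has the same cylinder probabilities, and
  \<open>\<P>(\<up>u) = f(u)\<close> follows by descending induction on \<open>|u|\<close> among the traces with a given number of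
  Cartier--Foata layers, since \<open>u \<cdot> c'\<close> above has as many layers as \<open>u \<cdot> c\<close> when \<open>c \<subseteq> c'\<close>.
\<close>

section \<open>Words up to commutation\<close>

text \<open>The delicate point is that \<open>R_u = c_n\<close> alone determines the whole cylinder.
  A root of \<xi> missing from \<open>c_1\<close> would commute with all letters of \<open>u\<close>
  and of \<open>c_n\<close>, so it could be read directly after \<open>u\<close>; it would then lie
  in \<open>c_n\<close> and commute with itself, against irreflexivity. Dependence being reflexive
  also yields c \<rightarrow> c, whence aperiodicity.

  For a Bernoulli measure and the unit as \<open>u\<close>, h(c) is the probability that the roots
  of the boundary point are exactly c. Hence h is nonnegative, and h(0) = 0 because a boundary point
  is infinite and has a root. Nonnegativity is what lets one positive summand of the arrow sum force
  positivity. In the converse, h(0) = 0 makes h sum to f(0) = 1 over the non-empty cliques, and the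
  normalising sum at c is h(c)/f(c), so that path probabilities telescope.

  Traces are handled through words, and generalized traces through ideals of words, which turns
  divisibility, least upper bounds and residuals into statements about sets of words.\<close>

locale independence =
  fixes I :: "('a \<times> 'a) set"
  assumes irrefl: "(a, a) \<notin> I" and sym: "(a, b) \<in> I \<Longrightarrow> (b, a) \<in> I"
begin

text \<open>The trace congruence and left divisibility are described by the projections of words to pairs
  of dependent letters; this makes cancellation immediate.\<close>

definition proj :: "'a \<Rightarrow> 'a \<Rightarrow> 'a list \<Rightarrow> 'a list" where
  "proj a b w = filter (\<lambda>x. x = a \<or> x = b) w"

definition eqv :: "'a list \<Rightarrow> 'a list \<Rightarrow> bool" (infix "\<simeq>" 50) where
  "u \<simeq> v \<longleftrightarrow> (\<forall>a b. (a, b) \<notin> I \<longrightarrow> proj a b u = proj a b v)"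

definition le :: "'a list \<Rightarrow> 'a list \<Rightarrow> bool" (infix "\<preceq>" 50) where
  "u \<preceq> v \<longleftrightarrow> (\<forall>a b. (a, b) \<notin> I \<longrightarrow> prefix (proj a b u) (proj a b v))"

definition commuting :: "'a set \<Rightarrow> 'a set \<Rightarrow> bool" where
  "commuting A B \<longleftrightarrow> A \<times> B \<subseteq> I"

lemma proj_simps [simp]:
  "proj a b [] = []"
  "proj a b (x # w) = (if x = a \<or> x = b then x # proj a b w else proj a b w)"
  "proj a b (u @ v) = proj a b u @ proj a b v"
  by (simp_all add: proj_def)

lemma set_proj [simp]: "set (proj a b w) = set w \<inter> {a, b}"
  by (auto simp: proj_def)

lemma proj_eq_Nil_iff [simp]: "proj a b w = [] \<longleftrightarrow> a \<notin> set w \<and> b \<notin> set w"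
  by (auto simp: proj_def filter_empty_conv)

lemma eqv_refl [simp, intro]: "u \<simeq> u"
  by (simp add: eqv_def)

lemma eqv_sym: "u \<simeq> v \<Longrightarrow> v \<simeq> u"
  by (simp add: eqv_def)

lemma eqv_trans [trans]: "u \<simeq> v \<Longrightarrow> v \<simeq> w \<Longrightarrow> u \<simeq> w"
  by (simp add: eqv_def)

lemma eqv_append: "u \<simeq> u' \<Longrightarrow> v \<simeq> v' \<Longrightarrow> u @ v \<simeq> u' @ v'"
  by (simp add: eqv_def)

lemma eqv_cancel [simp]: "w @ u \<simeq> w @ v \<longleftrightarrow> u \<simeq> v"
  by (simp add: eqv_def)

lemma le_refl [simp, intro]: "u \<preceq> u"
  by (simp add: le_def)

lemma le_trans [trans]: "u \<preceq> v \<Longrightarrow> v \<preceq> w \<Longrightarrow> u \<preceq> w"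
  unfolding le_def using prefix_order.trans by blast

lemma eqv_imp_le: "u \<simeq> v \<Longrightarrow> u \<preceq> v"
  by (simp add: eqv_def le_def)

lemma eqv_le_trans [trans]: "u \<simeq> v \<Longrightarrow> v \<preceq> w \<Longrightarrow> u \<preceq> w"
  by (simp add: eqv_def le_def)

lemma le_eqv_trans [trans]: "u \<preceq> v \<Longrightarrow> v \<simeq> w \<Longrightarrow> u \<preceq> w"
  by (simp add: eqv_def le_def)

lemma le_cancel [simp]: "w @ u \<preceq> w @ v \<longleftrightarrow> u \<preceq> v"
  by (simp add: le_def)

lemma le_append [simp, intro]: "u \<preceq> u @ v"
  by (simp add: le_def)

lemma Nil_le [simp, intro]: "[] \<preceq> v"
  by (simp add: le_def)

lemma single_le_imp_prefix: "[a] \<preceq> v \<Longrightarrow> (a, b) \<notin> I \<Longrightarrow> prefix [a] (proj a b v)"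
  unfolding le_def by (drule spec[of _ a], drule spec[of _ b]) simp

text \<open>A letter is dependent on itself, so the pair \<open>(a, a)\<close> is among those
  projected to, and this projection records the multiplicity of \<open>a\<close>.\<close>

lemma eqv_imp_mset: "u \<simeq> v \<Longrightarrow> mset u = mset v"
proof (rule multiset_eqI)
  fix a assume "u \<simeq> v"
  then have "proj a a u = proj a a v"
    using irrefl by (simp add: eqv_def)
  moreover have "filter ((=) a) w = proj a a w" for w
    unfolding proj_def by (rule filter_cong) auto
  ultimately have "filter ((=) a) u = filter ((=) a) v"
    by simp
  then show "count (mset u) a = count (mset v) a"
    by (simp add: count_mset count_list_eq_length_filter)
qed

lemma eqv_imp_set: "u \<simeq> v \<Longrightarrow> set u = set v"
  by (metis eqv_imp_mset set_mset_mset)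

lemma eqv_imp_length: "u \<simeq> v \<Longrightarrow> length u = length v"
  by (metis eqv_imp_mset size_mset)

text \<open>For each \<open>b\<close> dependent on \<open>a\<close>, the projection to
  \<open>a\<close> and \<open>b\<close> has to begin with \<open>a\<close>. So nothing dependent on
  \<open>a\<close> precedes its first occurrence, which can therefore be moved to the front.\<close>

lemma single_le_iff: "[a] \<preceq> v \<longleftrightarrow> (\<exists>p q. v = p @ a # q \<and> commuting {a} (set p))"
proof
  assume le: "[a] \<preceq> v"
  then have "prefix [a] (proj a a v)"
    using irrefl by (rule single_le_imp_prefix)
  then have "a \<in> set (proj a a v)"
    using set_mono_prefix by fastforce
  then have "a \<in> set v"
    by simp
  then obtain p q where v: "v = p @ a # q" "a \<notin> set p"
    by (meson split_list_first)
  have "(a, b) \<in> I" if "b \<in> set p" for b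
  proof (rule ccontr)
    assume "(a, b) \<notin> I"
    then have "prefix [a] (proj a b p @ proj a b (a # q))"
      using single_le_imp_prefix[OF le] by (simp add: v)
    moreover have "proj a b p \<noteq> []"
      using that by simp
    ultimately have "a \<in> set (proj a b p)"
      by (cases "proj a b p") auto
    then show False
      using v by simp
  qed
  then show "\<exists>p q. v = p @ a # q \<and> commuting {a} (set p)"
    using v by (auto simp: commuting_def)
next
  assume "\<exists>p q. v = p @ a # q \<and> commuting {a} (set p)"
  then obtain p q where v: "v = p @ a # q" and p: "\<And>b. b \<in> set p \<Longrightarrow> (a, b) \<in> I"
    by (auto simp: commuting_def)
  show "[a] \<preceq> v"
    unfolding le_def
  proof (intro allI impI)
    fix x y assume xy: "(x, y) \<notin> I"
    have "proj x y p = []" if "a = x \<or> a = y"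
      using that p xy irrefl sym by auto
    then show "prefix (proj x y [a]) (proj x y v)"
      by (auto simp: v simp del: proj_eq_Nil_iff)
  qed
qed

lemma eqv_commute:
  assumes "commuting (set u) (set v)"
  shows "u @ v \<simeq> v @ u"
  unfolding eqv_def
proof (intro allI impI)
  fix x y assume xy: "(x, y) \<notin> I"
  have "proj x y u = [] \<or> proj x y v = []"
    using assms xy irrefl sym unfolding proj_eq_Nil_iff commuting_def by fast
  then show "proj x y (u @ v) = proj x y (v @ u)"
    by (elim disjE) (simp_all only: proj_simps append_Nil append_Nil2)
qed

text \<open>The quotient is built letter by letter: the first letter of \<open>u\<close> can be
  pulled to the front of \<open>v\<close> and cancelled.\<close>

lemma le_iff_ex: "u \<preceq> v \<longleftrightarrow> (\<exists>x. u @ x \<simeq> v)"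
proof
  show "u \<preceq> v \<Longrightarrow> \<exists>x. u @ x \<simeq> v"
  proof (induction u arbitrary: v)
    case Nil
    then show ?case by auto
  next
    case (Cons a u)
    have "[a] \<preceq> a # u"
      using le_append[of "[a]" u] by simp
    then have "[a] \<preceq> v"
      using Cons.prems le_trans by blast
    then obtain p q where v: "v = p @ a # q" "commuting {a} (set p)"
      by (auto simp: single_le_iff)
    have vv: "[a] @ p @ q \<simeq> v"
      using eqv_append[OF eqv_commute[of "[a]" p] eqv_refl[of q]] v by simp
    then have "[a] @ u \<preceq> [a] @ p @ q"
      using Cons.prems le_eqv_trans eqv_sym by fastforce
    then have "u \<preceq> p @ q"
      by (simp only: le_cancel)
    then obtain x where "u @ x \<simeq> p @ q"
      using Cons.IH by blast
    then have "[a] @ u @ x \<simeq> v"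
      using vv eqv_trans by (metis eqv_cancel)
    then show ?case
      by auto
  qed
  show "\<exists>x. u @ x \<simeq> v \<Longrightarrow> u \<preceq> v"
    using le_eqv_trans by blast
qed

lemma le_imp_set: "u \<preceq> v \<Longrightarrow> set u \<subseteq> set v"
  unfolding le_iff_ex using eqv_imp_set by fastforce

lemma le_imp_length: "u \<preceq> v \<Longrightarrow> length u \<le> length v"
  unfolding le_iff_ex using eqv_imp_length by fastforce

lemma le_Nil_iff [simp]: "u \<preceq> [] \<longleftrightarrow> u = []"
  using le_imp_set[of u "[]"] by auto

text \<open>Both \<open>u\<close> and \<open>[a]\<close> give prefixes of the same projections of
  \<open>w\<close>. If some \<open>b\<close> dependent on \<open>a\<close> occurs in
  \<open>u\<close>, the non-empty projection of \<open>u\<close> to \<open>a\<close> and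
  \<open>b\<close> starts with \<open>a\<close>; so \<open>a\<close> occurs in \<open>u\<close> with
  nothing dependent on it in front. Otherwise \<open>a\<close> commutes with all of \<open>u\<close>
  and can be appended.\<close>

lemma single_le_cases:
  assumes "[a] \<preceq> w" "u \<preceq> w"
  shows "[a] \<preceq> u \<or> commuting {a} (set u) \<and> u @ [a] \<preceq> w"
proof (cases "commuting {a} (set u)")
  case True
  have "prefix (proj x y (u @ [a])) (proj x y w)" if xy: "(x, y) \<notin> I" for x y
  proof (cases "a = x \<or> a = y")
    case a: True
    then have "proj x y u = []"
      using True xy irrefl sym by (auto simp: commuting_def)
    then have "proj x y (u @ [a]) = proj x y [a]"
      by simp
    then show ?thesis
      using assms(1) xy unfolding le_def by metis
  next
    case False
    then show ?thesis
      using assms(2) xy by (auto simp: le_def)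
  qed
  then show ?thesis
    using True by (auto simp: le_def)
next
  case False
  have first: "hd (proj a b u) = a" if "(a, b) \<notin> I" "b \<in> set u" for b
  proof -
    have "prefix [a] (proj a b w)" "prefix (proj a b u) (proj a b w)"
      using assms that single_le_imp_prefix by (simp_all add: le_def)
    moreover have "proj a b u \<noteq> []"
      using that by simp
    ultimately show ?thesis
      by (cases "proj a b u"; cases "proj a b w") auto
  qed
  obtain b where b: "(a, b) \<notin> I" "b \<in> set u"
    using False by (auto simp: commuting_def)
  moreover have "proj a b u \<noteq> []"
    using b by simp
  ultimately have "a \<in> set (proj a b u)"
    using first by (metis list.set_sel(1))
  then have "a \<in> set u"
    by simp
  then obtain p q where u: "u = p @ a # q" "a \<notin> set p"
    by (meson split_list_first)
  have "(a, c) \<in> I" if "c \<in> set p" for c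
  proof (rule ccontr)
    assume ac: "(a, c) \<notin> I"
    have "proj a c p \<noteq> []"
      using that by simp
    moreover have "hd (proj a c p @ proj a c (a # q)) = a"
      using first[OF ac] that u by auto
    ultimately have "a \<in> set (proj a c p)"
      by (metis hd_append2 list.set_sel(1))
    then show False
      using u by simp
  qed
  then show ?thesis
    using u by (auto simp: single_le_iff commuting_def)
qed

lemma single_le_append:
  assumes "[a] \<preceq> u @ v" "\<not> [a] \<preceq> u"
  shows "commuting {a} (set u)" "[a] \<preceq> v"
proof -
  have *: "commuting {a} (set u) \<and> u @ [a] \<preceq> u @ v"
    using single_le_cases[OF assms(1) le_append] assms(2) by blast
  then show "commuting {a} (set u)" "[a] \<preceq> v"
    by simp_all
qed

section \<open>Projections against the generated congruence\<close>

lemma rtrancl_commutation_append: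
  fixes R defines "R \<equiv> (commutation_step I \<union> (commutation_step I)\<inverse>)\<^sup>*"
  assumes "(x, x') \<in> R" "(y, y') \<in> R"
  shows "(x @ y, x' @ y') \<in> R"
  \<comment> \<open>With the whole type as alphabet, \<open>trace_congruence\<close> is the bare
    reflexive transitive closure.\<close>
  using trace_congruence_append[of x x' UNIV I y y'] assms(2,3)
  by (simp add: trace_congruence_def R_def)

text \<open>The first letter of \<open>u\<close> is moved to the front of \<open>v\<close> by
  adjacent swaps, which \<open>single_le_iff\<close> permits; the induction handles what remains
  after cancelling it.\<close>

lemma eqv_iff_rtrancl:
  "u \<simeq> v \<longleftrightarrow> (u, v) \<in> (commutation_step I \<union> (commutation_step I)\<inverse>)\<^sup>*" (is "_ \<longleftrightarrow> _ \<in> ?R\<^sup>*")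
proof
  have move: "([a] @ p, p @ [a]) \<in> ?R\<^sup>*" if "commuting {a} (set p)" for a p
    using that
  proof (induction p)
    case (Cons b p)
    have "(a, b) \<in> I"
      using Cons.prems by (auto simp: commuting_def)
    then have "([] @ [a, b] @ p, [] @ [b, a] @ p) \<in> commutation_step I"
      unfolding commutation_step_def by blast
    then have "(a # b # p, b # a # p) \<in> ?R\<^sup>*"
      by auto
    moreover have "([b] @ [a] @ p, [b] @ p @ [a]) \<in> ?R\<^sup>*"
      using Cons.IH Cons.prems
      by (intro rtrancl_commutation_append[of "[b]" "[b]" "[a] @ p"]) (auto simp: commuting_def)
    ultimately show ?case
      by auto
  qed simp
  show "u \<simeq> v \<Longrightarrow> (u, v) \<in> ?R\<^sup>*"
  proof (induction u arbitrary: v)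
    case Nil
    then have "v = []"
      using eqv_imp_length by force
    then show ?case by simp
  next
    case (Cons a u)
    have "[a] \<preceq> v"
      using Cons.prems le_eqv_trans[OF le_append[of "[a]" u]] by simp
    then obtain p q where v: "v = p @ a # q" "commuting {a} (set p)"
      by (auto simp: single_le_iff)
    have "[a] @ p @ q \<simeq> v"
      using eqv_append[OF eqv_commute[of "[a]" p] eqv_refl[of q]] v by simp
    then have "[a] @ u \<simeq> [a] @ p @ q"
      using Cons.prems eqv_trans eqv_sym by (metis append_Cons append_Nil)
    then have "u \<simeq> p @ q"
      by (simp only: eqv_cancel)
    then have "([a] @ u, [a] @ p @ q) \<in> ?R\<^sup>*"
      by (intro rtrancl_commutation_append Cons.IH) auto
    moreover have "(([a] @ p) @ q, (p @ [a]) @ q) \<in> ?R\<^sup>*"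
      using v by (intro rtrancl_commutation_append move) auto
    ultimately show ?case
      using rtrancl_trans by (fastforce simp: v)
  qed
  have swap: "x \<simeq> y" if step: "(x, y) \<in> commutation_step I" for x y
  proof -
    obtain p q a b where "x = p @ [a, b] @ q" "y = p @ [b, a] @ q" "(a, b) \<in> I"
      using step unfolding commutation_step_def by blast
    moreover from this have "[a] @ [b] \<simeq> [b] @ [a]"
      by (intro eqv_commute) (simp add: commuting_def)
    ultimately show ?thesis
      using eqv_append[of "[a, b]" "[b, a]" q q] by simp
  qed
  show "(u, v) \<in> ?R\<^sup>* \<Longrightarrow> u \<simeq> v"
  proof (induction rule: rtrancl_induct)
    case (step y z)
    then have "y \<simeq> z"
      using swap eqv_sym by blast
    with step.IH show ?case
      by (rule eqv_trans)
  qed simp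
qed

section \<open>Cliques as sets of letters\<close>

definition clique :: "'a set \<Rightarrow> bool" where
  "clique A \<longleftrightarrow> (\<forall>a\<in>A. \<forall>b\<in>A. a \<noteq> b \<longrightarrow> (a, b) \<in> I)"

definition arrow :: "'a set \<Rightarrow> 'a set \<Rightarrow> bool" where
  "arrow A B \<longleftrightarrow> (\<forall>b\<in>B. \<exists>a\<in>A. (a, b) \<notin> I)"

text \<open>The chosen order is immaterial for a clique: by \<open>clique_words_eqv\<close> all its
  repetition-free enumerations are equivalent.\<close>

definition set_word :: "'a set \<Rightarrow> 'a list" where
  "set_word A = (SOME w. set w = A \<and> distinct w)"

lemma set_word:
  assumes "finite A"
  shows "distinct (set_word A)" "set (set_word A) = A" "length (set_word A) = card A"
proof -
  have "set (set_word A) = A \<and> distinct (set_word A)"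
    unfolding set_word_def by (rule someI_ex[OF finite_distinct_list[OF assms]])
  then show "distinct (set_word A)" "set (set_word A) = A" "length (set_word A) = card A"
    by (auto simp: distinct_card[symmetric])
qed

lemma set_word_empty [simp]: "set_word {} = []"
  using set_word[of "{}"] by simp

lemma clique_subset: "clique A \<Longrightarrow> B \<subseteq> A \<Longrightarrow> clique B"
  by (auto simp: clique_def)

text \<open>A dependent pair meets a clique in at most one letter, so each relevant projection has
  length at most one and is determined by its set.\<close>

lemma clique_words_eqv:
  assumes "distinct u" "distinct v" "set u = set v" "clique (set u)"
  shows "u \<simeq> v"
  unfolding eqv_def
proof (intro allI impI)
  fix x y assume xy: "(x, y) \<notin> I"
  have "set (proj x y u) = set (proj x y v)"
    by (simp add: assms(3))
  moreover have "distinct (proj x y u)" "distinct (proj x y v)"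
    using assms by (simp_all add: proj_def)
  moreover have "\<exists>z. set (proj x y u) \<subseteq> {z}"
    using assms(4) xy unfolding clique_def set_proj by blast
  moreover have "s = t" if "distinct s" "distinct t" "set s = set t" "set s \<subseteq> {z}" for s t :: "'a list" and z
  proof -
    have "\<exists>k. r = replicate k z" if "set r \<subseteq> {z}" for r
      using that by (metis replicate_eqI singletonD subset_iff)
    then obtain k l where "s = replicate k z" "t = replicate l z"
      using \<open>set s \<subseteq> {z}\<close> \<open>set s = set t\<close> by metis
    moreover have "length s = length t"
      using that by (metis distinct_card)
    ultimately show ?thesis
      by simp
  qed
  ultimately show "proj x y u = proj x y v"
    by blast
qed

lemma eqv_set_word:
  "distinct u \<Longrightarrow> clique (set u) \<Longrightarrow> u \<simeq> set_word (set u)"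
  by (rule clique_words_eqv) (simp_all add: set_word)

lemma set_word_Un:
  assumes "finite A" "finite B" "A \<inter> B = {}" "clique (A \<union> B)"
  shows "set_word A @ set_word B \<simeq> set_word (A \<union> B)"
  using assms by (intro clique_words_eqv) (simp_all add: set_word)

lemma set_word_single [simp]: "set_word {a} = [a]"
  using set_word[of "{a}"] by (auto simp: length_Suc_conv)

lemma single_le_set_word: "finite A \<Longrightarrow> clique A \<Longrightarrow> [a] \<preceq> set_word A \<longleftrightarrow> a \<in> A"
proof
  assume A: "finite A" "clique A"
  show "[a] \<preceq> set_word A \<Longrightarrow> a \<in> A"
    using le_imp_set[of "[a]" "set_word A"] set_word[OF A(1)] by auto
  assume "a \<in> A"
  then have "set_word {a} @ set_word (A - {a}) \<simeq> set_word A"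
    using set_word_Un[of "{a}" "A - {a}"] A by (simp add: insert_absorb)
  then show "[a] \<preceq> set_word A"
    by (auto simp: le_iff_ex)
qed

end

section \<open>Ideals of words and their Cartier--Foata decomposition\<close>

locale trace_alphabet = independence I for I :: "('a \<times> 'a) set" +
  fixes S :: "'a set"
  assumes finite_S: "finite S"
begin

definition set_clique :: "'a set \<Rightarrow> bool" where
  "set_clique A \<longleftrightarrow> A \<subseteq> S \<and> clique A"

lemma set_clique_finite: "set_clique A \<Longrightarrow> finite A"
  using finite_S finite_subset by (auto simp: set_clique_def)

lemma set_clique_word:
  assumes "set_clique A"
  shows "distinct (set_word A)" "set (set_word A) = A" "length (set_word A) = card A"
    "set_word A \<in> lists S"
  using set_word[OF set_clique_finite[OF assms]] assms by (auto simp: set_clique_def)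

lemma finite_set_cliques: "finite {A. set_clique A}"
  by (rule finite_subset[of _ "Pow S"]) (auto simp: set_clique_def finite_S)

text \<open>Downward closed directed sets of traces, kept as sets of words: closure under
  \<open>\<preceq>\<close> makes them saturated for \<open>\<simeq>\<close>. Directedness is what
  forces distinct roots to commute.\<close>

definition ideal :: "'a list set \<Rightarrow> bool" where
  "ideal L \<longleftrightarrow> [] \<in> L \<and> L \<subseteq> lists S \<and> (\<forall>u v. v \<in> L \<longrightarrow> u \<preceq> v \<longrightarrow> u \<in> L) \<and>
     (\<forall>u\<in>L. \<forall>v\<in>L. \<exists>w\<in>L. u \<preceq> w \<and> v \<preceq> w)"

definition unbounded :: "'a list set \<Rightarrow> bool" where
  "unbounded L \<longleftrightarrow> (\<forall>n. \<exists>u\<in>L. n \<le> length u)"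

definition roots :: "'a list set \<Rightarrow> 'a set" where
  "roots L = {a. [a] \<in> L}"

text \<open>For the ideal \<open>L\<close> of a boundary point above \<open>u\<close>, the clique
  \<open>R_u\<close> of the overview is \<open>roots (residual L u)\<close>.\<close>

definition residual :: "'a list set \<Rightarrow> 'a list \<Rightarrow> 'a list set" where
  "residual L w = {u. w @ u \<in> L}"

lemma idealD:
  assumes "ideal L"
  shows "[] \<in> L" "u \<in> L \<Longrightarrow> u \<in> lists S" "v \<in> L \<Longrightarrow> u \<preceq> v \<Longrightarrow> u \<in> L"
    "u \<in> L \<Longrightarrow> v \<in> L \<Longrightarrow> \<exists>w\<in>L. u \<preceq> w \<and> v \<preceq> w"
  using assms unfolding ideal_def by blast+

lemma ideal_eqv: "ideal L \<Longrightarrow> u \<simeq> v \<Longrightarrow> u \<in> L \<longleftrightarrow> v \<in> L"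
  using idealD(3) eqv_imp_le eqv_sym by blast

lemma residual_append: "residual (residual L u) v = residual L (u @ v)"
  by (simp add: residual_def)

lemma residual_Nil [simp]: "residual L [] = L"
  by (simp add: residual_def)

lemma ideal_residual:
  assumes "ideal L" "w \<in> L"
  shows "ideal (residual L w)"
  unfolding ideal_def residual_def
proof (intro conjI allI impI subsetI ballI)
  show "[] \<in> {u. w @ u \<in> L}"
    using assms by simp
  show "u \<in> lists S" if "u \<in> {u. w @ u \<in> L}" for u
    using idealD(2)[OF assms(1)] that by force
  show "u \<in> {u. w @ u \<in> L}" if "v \<in> {u. w @ u \<in> L}" "u \<preceq> v" for u v
    using idealD(3)[OF assms(1), of "w @ v" "w @ u"] that by simp
  show "\<exists>x\<in>{u. w @ u \<in> L}. u \<preceq> x \<and> v \<preceq> x"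
    if uv: "u \<in> {u. w @ u \<in> L}" "v \<in> {u. w @ u \<in> L}" for u v
  proof -
    obtain z where z: "z \<in> L" "w @ u \<preceq> z" "w @ v \<preceq> z"
      using idealD(4)[OF assms(1), of "w @ u" "w @ v"] uv by blast
    \<comment> \<open>The common bound is a multiple of \<open>w @ u\<close>; cancelling
      \<open>w\<close> yields a bound inside the residual.\<close>
    obtain x where x: "w @ u @ x \<simeq> z"
      using z(2) by (auto simp: le_iff_ex)
    then have "w @ v \<preceq> w @ u @ x"
      using z(3) le_eqv_trans eqv_sym by blast
    then have "v \<preceq> u @ x"
      by (simp only: le_cancel)
    moreover have "w @ u @ x \<in> L"
      using x z(1) ideal_eqv[OF assms(1)] by blast
    ultimately show ?thesis
      by blast
  qed
qed

lemma unbounded_residual: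
  assumes "ideal L" "unbounded L" "w \<in> L"
  shows "unbounded (residual L w)"
  unfolding unbounded_def
proof
  fix n
  obtain u where u: "u \<in> L" "length w + n \<le> length u"
    using assms(2) by (auto simp: unbounded_def)
  obtain z where z: "z \<in> L" "w \<preceq> z" "u \<preceq> z"
    using idealD(4)[OF assms(1,3) u(1)] by blast
  obtain x where x: "w @ x \<simeq> z"
    using z(2) by (auto simp: le_iff_ex)
  then have "w @ x \<in> L"
    using z(1) ideal_eqv[OF assms(1)] by blast
  moreover have "n \<le> length x"
    using eqv_imp_length[OF x] le_imp_length[OF z(3)] u(2) by simp
  ultimately show "\<exists>x\<in>residual L w. n \<le> length x"
    by (auto simp: residual_def)
qed

lemma roots_subset: "ideal L \<Longrightarrow> roots L \<subseteq> S"
  using idealD(2) by (fastforce simp: roots_def)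

text \<open>The word grows by one root \<open>b\<close> at a time: the ideal contains a common bound
  of \<open>b\<close> and the word so far, \<open>b\<close> is not below that word, and
  \<open>single_le_cases\<close> makes \<open>b\<close> commute with all of it and append to it. For
  \<open>u = []\<close> this shows that the roots form a clique.\<close>

lemma ideal_join:
  assumes L: "ideal L" "u \<in> L" and B: "B \<subseteq> roots L" "\<And>b. b \<in> B \<Longrightarrow> \<not> [b] \<preceq> u"
  shows "commuting B (set u)" "clique B" "u @ set_word B \<in> L"
proof -
  have "finite B"
    using B(1) roots_subset[OF L(1)] finite_S by (meson finite_subset)
  then have "commuting B (set u) \<and> clique B \<and> u @ set_word B \<in> L"
    using B
  proof (induction B)
    case empty
    then show ?case
      using L(2) by (simp add: commuting_def clique_def)
  next
    case (insert b B)
    then have IH: "commuting B (set u)" "clique B" "u @ set_word B \<in> L"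
      by auto
    have "[b] \<in> L"
      using insert.prems by (auto simp: roots_def)
    then obtain w where w: "w \<in> L" "[b] \<preceq> w" "u @ set_word B \<preceq> w"
      using idealD(4)[OF L(1) _ IH(3)] by blast
    have "\<not> [b] \<preceq> u @ set_word B"
      using insert.hyps insert.prems(2) single_le_append(2) single_le_set_word IH(2) by blast
    then have b: "commuting {b} (set (u @ set_word B))" "(u @ set_word B) @ [b] \<preceq> w"
      using single_le_cases[OF w(2,3)] by auto
    have comm: "(b, x) \<in> I" if "x \<in> set u \<or> x \<in> B" for x
      using b(1) that set_word(2)[OF insert.hyps(1)] by (auto simp: commuting_def)
    have cl: "clique (insert b B)"
      using comm IH(2) sym by (auto simp: clique_def)
    then have "set_word B @ set_word {b} \<simeq> set_word (insert b B)"
      using set_word_Un[of B "{b}"] insert.hyps by simp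
    then have "u @ set_word (insert b B) \<preceq> (u @ set_word B) @ [b]"
      by (simp add: eqv_sym eqv_imp_le)
    then have "u @ set_word (insert b B) \<in> L"
      using b(2) w(1) idealD(3)[OF L(1)] le_trans by blast
    then show ?case
      using cl comm IH(1) by (auto simp: commuting_def)
  qed
  then show "commuting B (set u)" "clique B" "u @ set_word B \<in> L"
    by auto
qed

lemma roots_clique: "ideal L \<Longrightarrow> set_clique (roots L)"
  using ideal_join(2)[of L "[]" "roots L"] roots_subset idealD(1)
  by (auto simp: set_clique_def)

lemma subset_roots_iff:
  assumes "ideal L" "set_clique B"
  shows "set_word B \<in> L \<longleftrightarrow> B \<subseteq> roots L"
proof
  show "B \<subseteq> roots L \<Longrightarrow> set_word B \<in> L"
    using ideal_join(3)[of L "[]" B] idealD(1) assms(1) by auto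
  show "set_word B \<in> L \<Longrightarrow> B \<subseteq> roots L"
    using single_le_set_word[of B] assms idealD(3) set_clique_finite
    unfolding roots_def set_clique_def by blast
qed

lemma set_word_roots: "ideal L \<Longrightarrow> set_word (roots L) \<in> L"
  using subset_roots_iff roots_clique by blast

lemma roots_nonempty:
  assumes "ideal L" "unbounded L"
  shows "roots L \<noteq> {}"
proof -
  obtain u where "u \<in> L" "1 \<le> length u"
    using assms(2) by (auto simp: unbounded_def)
  then obtain a v where "[a] @ v \<in> L"
    by (cases u) auto
  then have "[a] \<in> L"
    using idealD(3)[OF assms(1) _ le_append] by blast
  then show ?thesis
    by (auto simp: roots_def)
qed

text \<open>Adjoining the missing roots of \<open>L\<close> to \<open>v\<close> gives \<open>set_word (roots L) @ v'\<close>, where \<open>v'\<close> is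
  \<open>v\<close> stripped of its own first layer.\<close>

lemma strip_roots:
  assumes "ideal L" "set_word A @ v \<in> L" "set_clique A" "\<And>a. [a] \<preceq> set_word A @ v \<longleftrightarrow> a \<in> A"
  shows "v \<in> residual L (set_word (roots L))" "set_word A @ v \<preceq> set_word (roots L) @ v"
proof -
  let ?B = "roots L - A"
  have B: "commuting ?B (set (set_word A @ v))" "(set_word A @ v) @ set_word ?B \<in> L"
    using ideal_join[OF assms(1,2), of ?B] assms(4) by auto
  have A: "A \<subseteq> roots L"
    using idealD(3)[OF assms(1,2)] assms(4) by (auto simp: roots_def)
  have fin: "finite (roots L)" "finite A"
    using roots_clique[OF assms(1)] set_clique_finite assms(3) by auto
  \<comment> \<open>The missing roots commute with the whole word, so they move to the front and
    complete \<open>A\<close> to the full root clique.\<close>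
  have "(set_word A @ v) @ set_word ?B \<simeq> set_word ?B @ (set_word A @ v)"
    using B(1) fin set_word(2)[of ?B] by (intro eqv_sym[OF eqv_commute]) simp
  also have "\<dots> = (set_word ?B @ set_word A) @ v"
    by simp
  also have "\<dots> \<simeq> set_word (roots L) @ v"
  proof (rule eqv_append)
    have "?B \<union> A = roots L"
      using A by auto
    then show "set_word ?B @ set_word A \<simeq> set_word (roots L)"
      using set_word_Un[of ?B A] fin roots_clique[OF assms(1)] by (auto simp: set_clique_def)
  qed simp
  finally have eqv: "(set_word A @ v) @ set_word ?B \<simeq> set_word (roots L) @ v" .
  then show "v \<in> residual L (set_word (roots L))"
    using B(2) ideal_eqv[OF assms(1)] by (simp add: residual_def)
  show "set_word A @ v \<preceq> set_word (roots L) @ v"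
    using eqv le_append le_eqv_trans by blast
qed

section \<open>Layers of an ideal and paths of cliques\<close>

primrec layer :: "'a list set \<Rightarrow> nat \<Rightarrow> 'a list set" where
  "layer L 0 = L"
| "layer L (Suc n) = residual (layer L n) (set_word (roots (layer L n)))"

definition foata :: "'a list set \<Rightarrow> nat \<Rightarrow> 'a set" where
  "foata L n = roots (layer L n)"

primrec path_word :: "(nat \<Rightarrow> 'a set) \<Rightarrow> nat \<Rightarrow> 'a list" where
  "path_word A 0 = []"
| "path_word A (Suc n) = path_word A n @ set_word (A n)"

text \<open>Only the first \<open>n\<close> entries are constrained, so one predicate serves finite
  chains and, when demanded for all \<open>n\<close>, infinite paths.\<close>

definition clique_chain :: "nat \<Rightarrow> (nat \<Rightarrow> 'a set) \<Rightarrow> bool" where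
  "clique_chain n A \<longleftrightarrow> (\<forall>i<n. A i \<noteq> {} \<and> set_clique (A i)) \<and> (\<forall>i. Suc i < n \<longrightarrow> arrow (A i) (A (Suc i)))"

text \<open>Paths grow on the right by definition, whereas layers are peeled off from the left; this
  equation lets the inductions over layers pass to the shifted path.\<close>

lemma path_word_shift: "path_word A (Suc n) = set_word (A 0) @ path_word (\<lambda>i. A (Suc i)) n"
  by (induction n) auto

lemma path_word_cong: "(\<And>i. i < n \<Longrightarrow> A i = B i) \<Longrightarrow> path_word A n = path_word B n"
  by (induction n) auto

lemma clique_chain_shift: "clique_chain (Suc n) A \<Longrightarrow> clique_chain n (\<lambda>i. A (Suc i))"
  by (auto simp: clique_chain_def)

lemma clique_chain_mono: "clique_chain n A \<Longrightarrow> m \<le> n \<Longrightarrow> clique_chain m A"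
  by (auto simp: clique_chain_def)

lemma path_word_lists: "clique_chain n A \<Longrightarrow> path_word A n \<in> lists S"
proof (induction n)
  case (Suc n)
  then have "clique_chain n A" "set_clique (A n)"
    by (auto simp: clique_chain_def)
  then show ?case
    using Suc.IH set_clique_word(4) by (simp del: in_lists_conv_set)
qed simp

lemma path_word_mono: "m \<le> n \<Longrightarrow> path_word A m \<preceq> path_word A n"
  by (induction n) (auto simp: le_Suc_eq intro: le_trans)

lemma length_path_word: "clique_chain n A \<Longrightarrow> n \<le> length (path_word A n)"
proof (induction n)
  case (Suc n)
  then have "clique_chain n A" "set_clique (A n)" "A n \<noteq> {}"
    by (auto simp: clique_chain_def)
  then have "card (A n) > 0"
    using set_clique_finite by (simp add: card_gt_0_iff)
  then show ?case
    using Suc.IH \<open>clique_chain n A\<close> \<open>set_clique (A n)\<close> by (simp add: set_clique_word)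
qed simp

text \<open>A first letter outside \<open>A 0\<close> would commute with \<open>A 0\<close> and be a
  first letter of the tail, hence by induction lie in \<open>A 1\<close>; but the arrow gives every
  letter of \<open>A 1\<close> a dependent partner in \<open>A 0\<close>.\<close>

lemma path_root_iff:
  assumes "clique_chain n A" "n > 0"
  shows "[a] \<preceq> path_word A n \<longleftrightarrow> a \<in> A 0"
  using assms
proof (induction n arbitrary: A a)
  case (Suc n)
  have c: "set_clique (A 0)"
    using Suc.prems by (auto simp: clique_chain_def)
  then have iff: "[b] \<preceq> set_word (A 0) \<longleftrightarrow> b \<in> A 0" for b
    using single_le_set_word set_clique_finite by (auto simp: set_clique_def)
  have "a \<in> A 0" if le: "[a] \<preceq> path_word A (Suc n)"
  proof (rule ccontr)
    assume "a \<notin> A 0"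
    then have a: "commuting {a} (A 0)" "[a] \<preceq> path_word (\<lambda>i. A (Suc i)) n"
      using single_le_append[of a "set_word (A 0)"] le iff set_clique_word(2)[OF c]
      unfolding path_word_shift by auto
    then have "n > 0"
      by (cases n) auto
    then have "a \<in> A (Suc 0)"
      using Suc.IH[OF clique_chain_shift[OF Suc.prems(1)]] a(2) by simp
    moreover have "arrow (A 0) (A (Suc 0))"
      using Suc.prems(1) \<open>n > 0\<close> by (simp add: clique_chain_def)
    ultimately obtain b where "b \<in> A 0" "(b, a) \<notin> I"
      by (auto simp: arrow_def)
    then show False
      using a(1) sym by (auto simp: commuting_def)
  qed
  moreover have "[a] \<preceq> path_word A (Suc n)" if "a \<in> A 0"
    unfolding path_word_shift using that iff le_append le_trans by blast
  ultimately show ?case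
    by blast
qed simp

lemma layer_Suc: "layer L (Suc n) = layer (layer L (Suc 0)) n"
  by (induction n) auto

lemma foata_Suc: "foata L (Suc n) = foata (residual L (set_word (roots L))) n"
  unfolding foata_def using layer_Suc[of L n] by simp

lemma foata_0: "foata L 0 = roots L"
  by (simp add: foata_def)

lemma layer_residual: "layer L n = residual L (path_word (foata L) n)"
  by (induction n) (auto simp: foata_def residual_append)

lemma ideal_layer: "ideal L \<Longrightarrow> ideal (layer L n)"
  by (induction n) (auto intro: ideal_residual set_word_roots)

lemma foata_word_mem: "ideal L \<Longrightarrow> path_word (foata L) n \<in> L"
  using idealD(1)[OF ideal_layer, of L n] by (simp add: layer_residual residual_def)

lemma unbounded_layer: "ideal L \<Longrightarrow> unbounded L \<Longrightarrow> unbounded (layer L n)"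
  by (simp add: layer_residual unbounded_residual foata_word_mem)

text \<open>A letter of the next layer that commutes with all roots slides in front of them, so it
  is a root itself and would commute with itself. This yields the arrows.\<close>

lemma foata_clique_chain:
  assumes "ideal L" "unbounded L"
  shows "clique_chain n (foata L)"
proof -
  have "arrow (roots K) (roots (residual K (set_word (roots K))))" if K: "ideal K" for K
    unfolding arrow_def
  proof (rule ballI, rule ccontr)
    fix b assume b: "b \<in> roots (residual K (set_word (roots K)))" and "\<not> (\<exists>a\<in>roots K. (a, b) \<notin> I)"
    then have comm: "commuting {b} (roots K)"
      using sym by (auto simp: commuting_def)
    have "set (set_word (roots K)) = roots K"
      using roots_clique[OF K] set_clique_word by blast
    then have "[b] @ set_word (roots K) \<simeq> set_word (roots K) @ [b]"
      using comm by (intro eqv_commute) simp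
    moreover have "set_word (roots K) @ [b] \<in> K"
      using b by (simp add: roots_def residual_def)
    ultimately have "[b] @ set_word (roots K) \<in> K"
      using ideal_eqv[OF K] by blast
    then have "[b] \<in> K"
      using idealD(3)[OF K _ le_append] by blast
    then have "b \<in> roots K"
      by (simp add: roots_def)
    then show False
      using comm irrefl by (auto simp: commuting_def)
  qed
  then show ?thesis
    using roots_nonempty[OF ideal_layer unbounded_layer] roots_clique[OF ideal_layer] ideal_layer assms
    by (auto simp: clique_chain_def foata_def)
qed

text \<open>Greedy peeling reaches furthest among the paths with \<open>n\<close> cliques in the
  ideal: \<open>strip_roots\<close> trades \<open>A 0\<close> for the full root clique while keeping
  the tail in the residual. So the first \<open>n\<close> layers decide whether a trace with
  \<open>n\<close> cliques lies in the ideal.\<close>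

lemma path_word_le_foata:
  assumes "ideal L" "clique_chain n A" "path_word A n \<in> L"
  shows "path_word A n \<preceq> path_word (foata L) n"
  using assms
proof (induction n arbitrary: L A)
  case (Suc n)
  let ?A = "\<lambda>i. A (Suc i)" and ?K = "residual L (set_word (roots L))"
  have A0: "set_clique (A 0)"
    using Suc.prems(2) by (auto simp: clique_chain_def)
  have root: "[a] \<preceq> set_word (A 0) @ path_word ?A n \<longleftrightarrow> a \<in> A 0" for a
    using path_root_iff[OF Suc.prems(2)] unfolding path_word_shift by simp
  have mem: "set_word (A 0) @ path_word ?A n \<in> L"
    using Suc.prems(3) unfolding path_word_shift .
  have "path_word ?A n \<in> ?K"
    by (rule strip_roots(1)[OF Suc.prems(1) mem A0 root])
  then have le: "path_word ?A n \<preceq> path_word (foata ?K) n"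
    using Suc.IH[OF ideal_residual[OF Suc.prems(1) set_word_roots[OF Suc.prems(1)]] clique_chain_shift[OF Suc.prems(2)]]
    by blast
  have "path_word (foata L) (Suc n) = set_word (roots L) @ path_word (foata ?K) n"
    unfolding path_word_shift by (simp add: foata_Suc foata_0)
  moreover have "path_word A (Suc n) \<preceq> set_word (roots L) @ path_word ?A n"
    unfolding path_word_shift by (rule strip_roots(2)[OF Suc.prems(1) mem A0 root])
  ultimately show ?case
    using le le_trans by (metis le_cancel)
qed simp

text \<open>A letter commuting with the last clique of a path slides left until it is blocked,
  so that it enlarges a clique of the path instead of adding a new one.\<close>

lemma path_word_snoc:
  assumes "clique_chain (Suc n) A" "clique (insert a (A n))" "a \<notin> A n" "a \<in> S"
  shows "\<exists>B. clique_chain (Suc n) B \<and> A n \<subseteq> B n \<and> B n \<subseteq> insert a (A n) \<and>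
    path_word B (Suc n) \<simeq> path_word A (Suc n) @ [a]"
  using assms
proof (induction n arbitrary: A)
  case 0
  define B where "B = A(0 := insert a (A 0))"
  have c: "set_clique (insert a (A 0))"
    using 0 by (auto simp: clique_chain_def set_clique_def)
  then have "clique_chain (Suc 0) B"
    by (auto simp: clique_chain_def B_def)
  moreover have "set_word (A 0) @ set_word {a} \<simeq> set_word (A 0 \<union> {a})"
    using 0 c set_clique_finite[OF c] by (intro set_word_Un) (auto simp: set_clique_def)
  moreover have "B 0 = insert a (A 0)"
    by (simp add: B_def)
  ultimately show ?case
    using eqv_sym by (intro exI[of _ B]) auto
next
  case (Suc n)
  have c: "set_clique (insert a (A (Suc n)))"
    using Suc.prems by (auto simp: clique_chain_def set_clique_def)
  have An: "set_clique (A n)" "set_clique (A (Suc n))" "A (Suc n) \<noteq> {}" "arrow (A n) (A (Suc n))"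
    using Suc.prems(1) by (auto simp: clique_chain_def)
  show ?case
  proof (cases "\<exists>x\<in>A n. (x, a) \<notin> I")
    case True
    define B where "B = A(Suc n := insert a (A (Suc n)))"
    have "arrow (A n) (insert a (A (Suc n)))"
      using True An(4) by (auto simp: arrow_def)
    then have "clique_chain (Suc (Suc n)) B"
      using Suc.prems(1) c by (auto simp: clique_chain_def B_def less_Suc_eq)
    moreover have "path_word B (Suc n) = path_word A (Suc n)"
      by (rule path_word_cong) (simp add: B_def)
    moreover have "set_word (A (Suc n)) @ set_word {a} \<simeq> set_word (A (Suc n) \<union> {a})"
      using Suc.prems c set_clique_finite[OF c] by (intro set_word_Un) (auto simp: set_clique_def)
    moreover have "B (Suc n) = insert a (A (Suc n))"
      by (simp add: B_def)
    ultimately show ?thesis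
      using eqv_sym by (intro exI[of _ B]) auto
  next
    case False
    then have "a \<notin> A n" "clique (insert a (A n))"
      using irrefl sym An(1) by (auto simp: set_clique_def clique_def)
    then obtain B where B: "clique_chain (Suc n) B" "A n \<subseteq> B n" "path_word B (Suc n) \<simeq> path_word A (Suc n) @ [a]"
      using Suc.IH[OF clique_chain_mono[OF Suc.prems(1)]] Suc.prems(4) by auto
    \<comment> \<open>The last clique stays as it was; the arrow into it survives because
      \<open>A n \<subseteq> B n\<close>.\<close>
    define B' where "B' = B(Suc n := A (Suc n))"
    have "arrow (B n) (A (Suc n))"
      using An(4) B(2) by (auto simp: arrow_def)
    then have "clique_chain (Suc (Suc n)) B'"
      using B(1) An by (auto simp: clique_chain_def B'_def less_Suc_eq)
    moreover have "path_word B' (Suc n) = path_word B (Suc n)"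
      by (rule path_word_cong) (simp add: B'_def)
    then have "path_word B' (Suc (Suc n)) = path_word B (Suc n) @ set_word (A (Suc n))"
      by (simp add: B'_def)
    moreover have "path_word B (Suc n) @ set_word (A (Suc n))
        \<simeq> (path_word A (Suc n) @ [a]) @ set_word (A (Suc n))"
      using B(3) by (intro eqv_append) auto
    moreover have "[a] @ set_word (A (Suc n)) \<simeq> set_word (A (Suc n)) @ [a]"
      using Suc.prems(2,3) set_clique_word(2)[OF An(2)]
      by (intro eqv_commute) (auto simp: commuting_def clique_def)
    then have "(path_word A (Suc n) @ [a]) @ set_word (A (Suc n)) \<simeq> path_word A (Suc (Suc n)) @ [a]"
      by simp
    ultimately have "path_word B' (Suc (Suc n)) \<simeq> path_word A (Suc (Suc n)) @ [a]"
      using eqv_trans by metis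
    moreover have "B' (Suc n) = A (Suc n)"
      by (simp add: B'_def)
    ultimately show ?thesis
      using \<open>clique_chain (Suc (Suc n)) B'\<close> by (intro exI[of _ B']) auto
  qed
qed

text \<open>The missing letters of \<open>C\<close> are added one by one. The invariant
  \<open>B n \<subseteq> A n \<union> D\<close> keeps the next letter outside the current last
  clique and compatible with it, as \<open>path_word_snoc\<close> demands; the number of cliques
  never changes.\<close>

lemma path_word_extend:
  assumes "clique_chain (Suc n) A" "set_clique C" "A n \<subseteq> C"
  shows "\<exists>B. clique_chain (Suc n) B \<and> path_word B (Suc n) \<simeq> path_word A n @ set_word C"
proof -
  have fin: "finite C"
    using set_clique_finite[OF assms(2)] .
  have "\<exists>B. clique_chain (Suc n) B \<and> B n \<subseteq> A n \<union> D \<and>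
      path_word B (Suc n) \<simeq> path_word A n @ set_word (A n \<union> D)"
    if "finite D" "D \<subseteq> C - A n" for D
    using that
  proof (induction D)
    case empty
    then show ?case
      using assms(1) by (intro exI[of _ A]) simp
  next
    case (insert a D)
    then obtain B where B: "clique_chain (Suc n) B" "B n \<subseteq> A n \<union> D"
      "path_word B (Suc n) \<simeq> path_word A n @ set_word (A n \<union> D)"
      by auto
    have C': "A n \<union> insert a D \<subseteq> C"
      using insert.prems assms(3) by auto
    have "insert a (B n) \<subseteq> C" "a \<notin> B n"
      using B(2) C' insert.prems insert.hyps by auto
    then obtain B' where B': "clique_chain (Suc n) B'" "B' n \<subseteq> insert a (B n)"
      "path_word B' (Suc n) \<simeq> path_word B (Suc n) @ [a]"
      using path_word_snoc[OF B(1)] assms(2) clique_subset unfolding set_clique_def by blast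
    have "path_word B (Suc n) @ [a] \<simeq> (path_word A n @ set_word (A n \<union> D)) @ [a]"
      using B(3) by (intro eqv_append) auto
    moreover have "set_word (A n \<union> D) @ set_word {a} \<simeq> set_word (A n \<union> D \<union> {a})"
      using insert.prems insert.hyps C' fin assms(2,3) clique_subset finite_subset unfolding set_clique_def
      by (intro set_word_Un) (auto, blast)
    then have "(path_word A n @ set_word (A n \<union> D)) @ [a] \<simeq> path_word A n @ set_word (A n \<union> insert a D)"
      by simp
    ultimately have "path_word B' (Suc n) \<simeq> path_word A n @ set_word (A n \<union> insert a D)"
      using B'(3) eqv_trans by blast
    then show ?case
      using B'(1,2) B(2) by (intro exI[of _ B']) auto
  qed
  from this[of "C - A n"] show ?thesis
    using fin assms(3) by (auto simp: Un_absorb1)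
qed

text \<open>A letter that \<open>path_word_snoc\<close> cannot absorb is dependent on some letter of
  the last clique (possibly itself), if there is a last clique, and so may open a new
  clique.\<close>

lemma ex_path_word:
  assumes "w \<in> lists S"
  shows "\<exists>n A. clique_chain n A \<and> path_word A n \<simeq> w"
  using assms
proof (induction w rule: rev_induct)
  case Nil
  have "clique_chain 0 (\<lambda>_. {})"
    by (simp add: clique_chain_def)
  then show ?case
    by fastforce
next
  case (snoc a w)
  then obtain n A where A: "clique_chain n A" "path_word A n \<simeq> w"
    by auto
  have a: "a \<in> S" "set_clique {a}"
    using snoc.prems by (auto simp: set_clique_def clique_def)
  have eq: "path_word A n @ [a] \<simeq> w @ [a]"
    using A(2) by (intro eqv_append) auto
  show ?case
  proof (cases "\<exists>m. n = Suc m \<and> clique (insert a (A m)) \<and> a \<notin> A m")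
    case True
    then show ?thesis
      using path_word_snoc[of _ A a] A(1) a(1) eq eqv_trans by metis
  next
    case False
    define B where "B = A(n := {a})"
    have "clique_chain (Suc n) B"
      unfolding clique_chain_def
    proof (intro conjI allI impI)
      show "B i \<noteq> {}" "set_clique (B i)" if "i < Suc n" for i
        using A(1) a that by (auto simp: B_def clique_chain_def less_Suc_eq)
      show "arrow (B i) (B (Suc i))" if "Suc i < Suc n" for i
      proof (cases "Suc i = n")
        case True
        then have "set_clique (A i)" "\<not> clique (insert a (A i)) \<or> a \<in> A i"
          using A(1) False by (auto simp: clique_chain_def)
        then show ?thesis
          using True irrefl sym by (auto simp: B_def arrow_def clique_def set_clique_def)
      next
        case False
        then show ?thesis
          using A(1) that by (auto simp: B_def clique_chain_def)
      qed
    qed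
    moreover have "path_word B n = path_word A n"
      by (rule path_word_cong) (simp add: B_def)
    moreover have "B n = {a}"
      by (simp add: B_def)
    ultimately show ?thesis
      using eq by (intro exI[of _ "Suc n"] exI[of _ B]) simp
  qed
qed

section \<open>Infinite paths and their ideals\<close>

definition path_ideal :: "(nat \<Rightarrow> 'a set) \<Rightarrow> 'a list set" where
  "path_ideal A = {u. \<exists>n. u \<preceq> path_word A n}"

text \<open>Every word of \<open>L\<close> is equivalent to a path of some number \<open>n\<close>
  of cliques, hence lies below the first \<open>n\<close> layers; no word escapes the
  peeling.\<close>

lemma path_ideal_foata:
  assumes "ideal L"
  shows "path_ideal (foata L) = L"
  unfolding path_ideal_def
proof (intro Set.set_eqI iffI)
  fix u assume "u \<in> {u. \<exists>n. u \<preceq> path_word (foata L) n}"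
  then show "u \<in> L"
    using foata_word_mem[OF assms] idealD(3)[OF assms] by blast
next
  fix u assume "u \<in> L"
  moreover from this obtain n A where "clique_chain n A" "path_word A n \<simeq> u"
    using ex_path_word idealD(2)[OF assms] by blast
  ultimately have "u \<preceq> path_word (foata L) n"
    using path_word_le_foata[OF assms] ideal_eqv[OF assms] eqv_le_trans eqv_sym by blast
  then show "u \<in> {u. \<exists>n. u \<preceq> path_word (foata L) n}"
    by blast
qed

text \<open>From right to left, the first layer is identified by inserting a supposed extra root
  just before the last clique; the remaining layers follow by induction in the residual by
  \<open>set_word (A 0)\<close>.\<close>

lemma foata_eq_iff:
  assumes "ideal L" "clique_chain (Suc n) A"
  shows "(\<forall>i\<le>n. foata L i = A i) \<longleftrightarrow>
    path_word A n \<in> L \<and> roots (residual L (path_word A n)) = A n"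
proof
  assume eq: "\<forall>i\<le>n. foata L i = A i"
  then have "path_word A n = path_word (foata L) n"
    by (intro path_word_cong) simp
  then show "path_word A n \<in> L \<and> roots (residual L (path_word A n)) = A n"
    using eq foata_word_mem[OF assms(1)] layer_residual[of L n] by (metis foata_def le_refl order_refl)
next
  show "path_word A n \<in> L \<and> roots (residual L (path_word A n)) = A n \<Longrightarrow> \<forall>i\<le>n. foata L i = A i"
    using assms
  proof (induction n arbitrary: L A)
    case 0
    then show ?case
      by (simp add: foata_0)
  next
    case (Suc n)
    note L = Suc.prems(2) and A = Suc.prems(3)
    let ?v = "path_word A (Suc n)" and ?C = "A (Suc n)"
    have v: "?v \<in> L" and C: "roots (residual L ?v) = ?C"
      using Suc.prems(1) by auto
    have idv: "ideal (residual L ?v)"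
      using ideal_residual[OF L v] .
    have "set_word ?C \<in> residual L ?v"
      using set_word_roots[OF idv] C by simp
    then have vC: "?v @ set_word ?C \<in> L"
      by (simp only: residual_def mem_Collect_eq)
    have root: "[a] \<preceq> ?v @ set_word ?C \<longleftrightarrow> a \<in> A 0" for a
      using path_root_iff[OF A, of a] by simp
    have setC: "set (set_word ?C) = ?C"
      using A set_clique_word(2) by (simp add: clique_chain_def)
    have "a \<in> A 0" if a: "a \<in> roots L" for a
    proof (rule ccontr)
      assume "a \<notin> A 0"
      then have "commuting {a} (set (?v @ set_word ?C))" "(?v @ set_word ?C) @ [a] \<in> L"
        using ideal_join[OF L vC, of "{a}"] a root by auto
      then have comm: "commuting {a} (set (set_word ?C))" and mem: "?v @ set_word ?C @ [a] \<in> L"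
        by (auto simp: commuting_def)
      have "?v @ [a] @ set_word ?C \<simeq> ?v @ set_word ?C @ [a]"
        using eqv_commute[of "[a]" "set_word ?C"] comm by (simp only: eqv_cancel) simp
      then have "?v @ [a] @ set_word ?C \<in> L"
        using mem ideal_eqv[OF L] by blast
      then have "(?v @ [a]) @ set_word ?C \<in> L"
        by (simp only: append_assoc)
      then have "?v @ [a] \<in> L"
        using idealD(3)[OF L _ le_append] by blast
      then have "a \<in> ?C"
        using C unfolding roots_def residual_def by blast
      then show False
        using comm setC irrefl by (auto simp: commuting_def)
    qed
    moreover have "a \<in> roots L" if "a \<in> A 0" for a
      using that root idealD(3)[OF L vC] unfolding roots_def by blast
    ultimately have r: "roots L = A 0"
      by blast
    let ?K = "residual L (set_word (A 0))" and ?A = "\<lambda>i. A (Suc i)"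
    have K: "ideal ?K"
      using ideal_residual[OF L] set_word_roots[OF L] r by simp
    have "path_word ?A n \<in> ?K"
      using v unfolding path_word_shift residual_def by simp
    moreover have "residual ?K (path_word ?A n) = residual L ?v"
      unfolding residual_append path_word_shift ..
    ultimately have "\<forall>i\<le>n. foata ?K i = ?A i"
      using Suc.IH[OF _ K clique_chain_shift[OF A]] C by simp
    then have "foata L i = A i" if "i \<le> Suc n" for i
      using r that by (cases i) (auto simp: foata_Suc foata_0)
    then show ?case
      by blast
  qed
qed

lemma ideal_path_ideal:
  assumes "\<And>n. clique_chain n A"
  shows "ideal (path_ideal A)" "unbounded (path_ideal A)"
proof -
  show "ideal (path_ideal A)"
    unfolding ideal_def path_ideal_def
  proof (intro conjI allI impI subsetI ballI)
    show "u \<in> lists S" if "u \<in> {u. \<exists>n. u \<preceq> path_word A n}" for u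
      using that le_imp_set path_word_lists[OF assms] by (force simp: in_lists_conv_set)
    show "\<exists>w\<in>{u. \<exists>n. u \<preceq> path_word A n}. u \<preceq> w \<and> v \<preceq> w"
      if uv: "u \<in> {u. \<exists>n. u \<preceq> path_word A n}" "v \<in> {u. \<exists>n. u \<preceq> path_word A n}" for u v
    proof -
      obtain m n where "u \<preceq> path_word A m" "v \<preceq> path_word A n"
        using uv by blast
      then have "u \<preceq> path_word A (max m n)" "v \<preceq> path_word A (max m n)"
        using path_word_mono le_trans by (meson max.cobounded1 max.cobounded2)+
      then show ?thesis
        by blast
    qed
  qed (auto intro: le_trans)
  show "unbounded (path_ideal A)"
    unfolding unbounded_def path_ideal_def using length_path_word[OF assms] by blast
qed

text \<open>This is the uniqueness of the decomposition, as \<open>path_ideal_foata\<close> is its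
  existence. The induction works because dividing \<open>path_ideal A\<close> by its first clique
  gives the ideal of the shifted path.\<close>

lemma foata_path_ideal:
  assumes "\<And>n. clique_chain n A"
  shows "foata (path_ideal A) = A"
proof -
  have "foata (path_ideal A) n = A n" for n
    using assms
  proof (induction n arbitrary: A)
    case 0
    have "a \<in> A 0 \<longleftrightarrow> (\<exists>n. [a] \<preceq> path_word A n)" for a
      using path_root_iff[OF 0] by (metis le_Nil_iff list.distinct(1) not_gr_zero path_word.simps(1) zero_less_one)
    then show ?case
      by (auto simp: foata_0 roots_def path_ideal_def)
  next
    case (Suc n)
    have "a \<in> A 0 \<longleftrightarrow> (\<exists>n. [a] \<preceq> path_word A n)" for a
      using path_root_iff[OF Suc.prems] by (metis le_Nil_iff list.distinct(1) not_gr_zero path_word.simps(1) zero_less_one)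
    then have r: "roots (path_ideal A) = A 0"
      by (auto simp: roots_def path_ideal_def)
    have "residual (path_ideal A) (set_word (A 0)) = path_ideal (\<lambda>i. A (Suc i))"
    proof (intro Set.set_eqI iffI)
      fix u assume "u \<in> residual (path_ideal A) (set_word (A 0))"
      then obtain m where "set_word (A 0) @ u \<preceq> path_word A m"
        by (auto simp: residual_def path_ideal_def)
      \<comment> \<open>One more clique ensures that the path is non-empty, so that its first clique
        can be cancelled.\<close>
      then have "set_word (A 0) @ u \<preceq> path_word A (Suc m)"
        using path_word_mono[of m "Suc m" A] le_trans le_SucI by blast
      then show "u \<in> path_ideal (\<lambda>i. A (Suc i))"
        unfolding path_word_shift path_ideal_def by auto
    next
      fix u assume "u \<in> path_ideal (\<lambda>i. A (Suc i))"
      then obtain m where "u \<preceq> path_word (\<lambda>i. A (Suc i)) m"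
        by (auto simp: path_ideal_def)
      then have "set_word (A 0) @ u \<preceq> path_word A (Suc m)"
        unfolding path_word_shift by simp
      then show "u \<in> residual (path_ideal A) (set_word (A 0))"
        unfolding residual_def path_ideal_def by blast
    qed
    then show ?case
      using Suc.IH[of "\<lambda>i. A (Suc i)"] clique_chain_shift[OF Suc.prems] by (simp add: foata_Suc r)
  qed
  then show ?thesis
    by blast
qed

section \<open>Traces and boundary points\<close>

abbreviation cls :: "'a list \<Rightarrow> 'a trace" where
  "cls w \<equiv> trace_congruence S I `` {w}"

abbreviation clq :: "'a set \<Rightarrow> 'a trace" where
  "clq A \<equiv> cls (set_word A)"

lemma trace_congruence_iff:
  "(u, v) \<in> trace_congruence S I \<longleftrightarrow> u \<in> lists S \<and> v \<in> lists S \<and> u \<simeq> v"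
  by (auto simp: trace_congruence_def eqv_iff_rtrancl)

lemma cls_eq_iff: "u \<in> lists S \<Longrightarrow> v \<in> lists S \<Longrightarrow> cls u = cls v \<longleftrightarrow> u \<simeq> v"
  using eq_equiv_class_iff[OF equiv_trace_congruence, of u S v I] by (simp add: trace_congruence_iff)

lemma carrier_eq: "carrier (trace_monoid S I) = cls ` lists S"
  by (auto simp: trace_monoid_def quotient_def)

lemma one_eq: "\<one>\<^bsub>trace_monoid S I\<^esub> = cls []"
  by (simp add: trace_monoid_def)

lemma append_lists: "u @ v \<in> lists S \<longleftrightarrow> u \<in> lists S \<and> v \<in> lists S"
  by auto

lemma divides_iff:
  assumes "u \<in> lists S" "v \<in> lists S"
  shows "cls u divides\<^bsub>trace_monoid S I\<^esub> cls v \<longleftrightarrow> u \<preceq> v"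
proof -
  have "cls u divides\<^bsub>trace_monoid S I\<^esub> cls v \<longleftrightarrow> (\<exists>x\<in>lists S. cls v = cls (u @ x))"
    unfolding factor_def carrier_eq using assms trace_mult_class[of u S _ I] by auto
  also have "\<dots> \<longleftrightarrow> (\<exists>x\<in>lists S. u @ x \<simeq> v)"
    using assms cls_eq_iff eqv_sym by (metis append_lists)
  also have "\<dots> \<longleftrightarrow> u \<preceq> v"
  proof -
    have "x \<in> lists S" if "u @ x \<simeq> v" for x
      using eqv_imp_set[OF that] assms by auto
    then show ?thesis
      unfolding le_iff_ex by blast
  qed
  finally show ?thesis .
qed

lemma le_lists: "u \<preceq> v \<Longrightarrow> v \<in> lists S \<Longrightarrow> u \<in> lists S"
  using le_imp_set by (auto simp: in_lists_conv_set)

lemma trace_length_cls: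
  assumes "w \<in> lists S"
  shows "trace_length (cls w) = length w"
proof -
  have "\<exists>v\<in>cls w. length v = length w"
    using assms by (intro bexI[of _ w]) (auto simp: trace_congruence_iff)
  moreover have "length v = length w" if "v \<in> cls w" for v
    using that eqv_imp_length by (auto simp: trace_congruence_iff)
  ultimately show ?thesis
    unfolding trace_length_def by (intro the_equality) auto
qed

lemma trace_letters_cls:
  assumes "w \<in> lists S"
  shows "trace_letters (cls w) = set w"
proof -
  have "w \<in> cls w"
    using assms by (auto simp: trace_congruence_iff)
  moreover have "set v = set w" if "v \<in> cls w" for v
    using that eqv_imp_set by (auto simp: trace_congruence_iff)
  ultimately show ?thesis
    unfolding trace_letters_def by blast
qed

lemma trace_letters_clq: "set_clique A \<Longrightarrow> trace_letters (clq A) = A"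
  by (simp add: trace_letters_cls set_clique_word del: in_lists_conv_set)

lemma inj_on_clq: "inj_on clq {A. set_clique A}"
  by (rule inj_on_inverseI[of _ trace_letters]) (simp add: trace_letters_clq)

lemma clq_eq_iff: "set_clique A \<Longrightarrow> set_clique B \<Longrightarrow> clq A = clq B \<longleftrightarrow> A = B"
  using trace_letters_clq by metis

text \<open>Independence of entries at distinct positions excludes repetitions by irreflexivity, so
  a clique word enumerates its set of letters.\<close>

lemma cliques_eq: "cliques S I = clq ` {A. set_clique A}"
proof (intro Set.set_eqI iffI)
  fix c assume "c \<in> cliques S I"
  then obtain w where w: "c = cls w" "w \<in> lists S"
    "\<forall>i<length w. \<forall>j<length w. i \<noteq> j \<longrightarrow> (w ! i, w ! j) \<in> I"
    unfolding cliques_def by blast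
  have "distinct w"
    unfolding distinct_conv_nth using w(3) irrefl by metis
  moreover have "clique (set w)"
    unfolding clique_def using w(3) by (metis in_set_conv_nth)
  ultimately have "w \<simeq> set_word (set w)" "set_clique (set w)"
    using eqv_set_word w(2) by (auto simp: set_clique_def)
  then have "c = clq (set w)"
    using w cls_eq_iff set_clique_word(4) by blast
  then show "c \<in> clq ` {A. set_clique A}"
    using \<open>set_clique (set w)\<close> by blast
next
  fix c assume "c \<in> clq ` {A. set_clique A}"
  then obtain A where A: "c = clq A" "set_clique A"
    by blast
  have "(set_word A ! i, set_word A ! j) \<in> I"
    if "i < length (set_word A)" "j < length (set_word A)" "i \<noteq> j" for i j
  proof -
    have "set_word A ! i \<noteq> set_word A ! j"
      using that set_clique_word(1)[OF A(2)] by (simp add: nth_eq_iff_index_eq)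
    then show ?thesis
      using that A(2) set_clique_word(2)[OF A(2)] nth_mem unfolding set_clique_def clique_def by metis
  qed
  then show "c \<in> cliques S I"
    unfolding cliques_def using A set_clique_word(4) by blast
qed

lemma set_clique_empty [simp]: "set_clique {}"
  by (simp add: set_clique_def clique_def)

lemma nonempty_cliques_eq: "nonempty_cliques S I = clq ` {A. set_clique A \<and> A \<noteq> {}}"
proof -
  have "\<one>\<^bsub>trace_monoid S I\<^esub> = clq {}"
    by (simp add: one_eq)
  then show ?thesis
    unfolding nonempty_cliques_def cliques_eq
    using clq_eq_iff[OF _ set_clique_empty] by auto
qed

lemma finite_nonempty_cliques: "finite (nonempty_cliques S I)"
  unfolding nonempty_cliques_eq by (simp add: finite_set_cliques)

lemma clique_arrow_iff:
  "set_clique A \<Longrightarrow> set_clique B \<Longrightarrow> clique_arrow S I (clq A) (clq B) \<longleftrightarrow> arrow A B"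
  unfolding clique_arrow_def dependence_def arrow_def
  by (auto simp: trace_letters_clq set_clique_def) blast

lemma clq_divides_iff:
  assumes "set_clique A" "set_clique B"
  shows "clq A divides\<^bsub>trace_monoid S I\<^esub> clq B \<longleftrightarrow> A \<subseteq> B"
proof -
  have "set_word A \<preceq> set_word B \<longleftrightarrow> A \<subseteq> B"
  proof
    show "set_word A \<preceq> set_word B \<Longrightarrow> A \<subseteq> B"
      using le_imp_set[of "set_word A" "set_word B"] assms by (simp add: set_clique_word)
    assume "A \<subseteq> B"
    then have "A \<union> (B - A) = B"
      by auto
    then have "set_word A @ set_word (B - A) \<simeq> set_word B"
      using set_word_Un[of A "B - A"] assms set_clique_finite by (auto simp: set_clique_def)
    then show "set_word A \<preceq> set_word B"
      by (auto simp: le_iff_ex)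
  qed
  then show ?thesis
    using assms by (simp add: divides_iff set_clique_word del: in_lists_conv_set)
qed

lemma moebius_transform_clq:
  assumes "set_clique A"
  shows "moebius_transform S I f (clq A) =
    (\<Sum>B | set_clique B \<and> A \<subseteq> B. (- 1) ^ (card B - card A) * f (clq B))"
proof -
  have *: "{c. c \<in> cliques S I \<and> clq A divides\<^bsub>trace_monoid S I\<^esub> c} = clq ` {B. set_clique B \<and> A \<subseteq> B}"
    unfolding cliques_eq using clq_divides_iff[OF assms] by auto
  have "inj_on clq {B. set_clique B \<and> A \<subseteq> B}"
    using inj_on_clq by (rule inj_on_subset) auto
  then show ?thesis
    unfolding moebius_transform_def *
    by (simp add: sum.reindex trace_length_cls set_clique_word assms del: in_lists_conv_set)
qed

lemma trace_prefix_eq: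
  assumes "\<And>i. i < n \<Longrightarrow> set_clique (A i)" "\<And>i. i < n \<Longrightarrow> c i = clq (A i)"
  shows "trace_prefix S I c n = cls (path_word A n) \<and> path_word A n \<in> lists S"
  using assms
proof (induction n)
  case 0
  then show ?case
    by (simp add: one_eq)
next
  case (Suc n)
  then have "trace_prefix S I c n = cls (path_word A n)" "path_word A n \<in> lists S"
    "set_word (A n) \<in> lists S" "c n = clq (A n)"
    using set_clique_word(4)[of "A n"] by auto
  then show ?case
    using trace_mult_class[of "path_word A n" S "set_word (A n)" I] by simp
qed

text \<open>A point of \<open>\<W>\<close> is identified with the ideal of all words representing traces below it; the
  order of \<open>\<W>\<close> becomes inclusion, and boundary points are the unbounded ideals.\<close>

definition seq_words :: "(nat \<Rightarrow> 'a trace) \<Rightarrow> 'a list set" where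
  "seq_words u = {x \<in> lists S. \<exists>k. cls x divides\<^bsub>trace_monoid S I\<^esub> u k}"

definition gwords :: "'a gtrace \<Rightarrow> 'a list set" where
  "gwords X = (\<Union>u\<in>X. seq_words u)"

lemma nondecreasingE:
  assumes "u \<in> nondecreasing_seqs S I"
  obtains w where "u = (\<lambda>k. cls (w k))" "\<forall>k. w k \<in> lists S" "\<forall>m n. m \<le> n \<longrightarrow> w m \<preceq> w n"
    "seq_words u = {x. \<exists>k. x \<preceq> w k}"
proof -
  have u: "\<And>k. u k \<in> cls ` lists S" "\<And>k. u k divides\<^bsub>trace_monoid S I\<^esub> u (Suc k)"
    using assms by (auto simp: nondecreasing_seqs_def carrier_eq)
  have "\<forall>k. \<exists>w. w \<in> lists S \<and> u k = cls w"
    using u(1) by blast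
  then obtain w where w: "\<And>k. w k \<in> lists S" "\<And>k. u k = cls (w k)"
    by metis
  have step: "w k \<preceq> w (Suc k)" for k
    using u(2)[of k] divides_iff[OF w(1) w(1), of k "Suc k"] by (simp only: w(2))
  have "w m \<preceq> w n" if "m \<le> n" for m n
    using that
  proof (induction n rule: dec_induct)
    case (step n)
    then show ?case
      using le_trans[OF _ \<open>\<And>k. w k \<preceq> w (Suc k)\<close>] by blast
  qed simp
  moreover have "seq_words u = {x. \<exists>k. x \<preceq> w k}"
    unfolding seq_words_def w(2) using w(1) divides_iff le_lists by blast
  moreover have "u = (\<lambda>k. cls (w k))"
    using w(2) by blast
  ultimately show ?thesis
    using that w(1) by blast
qed

lemma nondecreasingI:
  assumes "\<And>k. w k \<in> lists S" "\<And>k. w k \<preceq> w (Suc k)"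
  shows "(\<lambda>k. cls (w k)) \<in> nondecreasing_seqs S I" "seq_words (\<lambda>k. cls (w k)) = {x. \<exists>k. x \<preceq> w k}"
proof -
  show "(\<lambda>k. cls (w k)) \<in> nondecreasing_seqs S I"
    using assms divides_iff by (auto simp: nondecreasing_seqs_def carrier_eq simp del: in_lists_conv_set)
  show "seq_words (\<lambda>k. cls (w k)) = {x. \<exists>k. x \<preceq> w k}"
    unfolding seq_words_def using assms divides_iff le_lists by blast
qed

lemma ideal_seq_words:
  assumes "u \<in> nondecreasing_seqs S I"
  shows "ideal (seq_words u)"
proof -
  obtain w where "u = (\<lambda>k. cls (w k))" and w: "\<forall>k. w k \<in> lists S" "\<forall>m n. m \<le> n \<longrightarrow> w m \<preceq> w n"
    "seq_words u = {x. \<exists>k. x \<preceq> w k}"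
    by (rule nondecreasingE[OF assms])
  have up: "x \<preceq> w (max m n)" "x \<preceq> w (max n m)" if "x \<preceq> w m" for x m n
    using that w(2) le_trans by (meson max.cobounded1 max.cobounded2)+
  show ?thesis
    unfolding ideal_def w(3)
  proof (intro conjI allI impI subsetI ballI)
    show "x \<in> lists S" if "x \<in> {x. \<exists>k. x \<preceq> w k}" for x
      using that w(1) le_lists by blast
    show "x \<in> {x. \<exists>k. x \<preceq> w k}" if "y \<in> {x. \<exists>k. x \<preceq> w k}" "x \<preceq> y" for x y
      using that le_trans[OF that(2)] by blast
    show "\<exists>z\<in>{x. \<exists>k. x \<preceq> w k}. x \<preceq> z \<and> y \<preceq> z"
      if xy: "x \<in> {x. \<exists>k. x \<preceq> w k}" "y \<in> {x. \<exists>k. x \<preceq> w k}" for x y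
    proof -
      obtain m n where "x \<preceq> w m" "y \<preceq> w n"
        using xy by blast
      then show ?thesis
        using up(1)[of x m n] up(2)[of y n m] by (intro bexI[of _ "w (max m n)"]) auto
    qed
  qed simp
qed

lemma seq_le_iff:
  assumes "u \<in> nondecreasing_seqs S I" "v \<in> nondecreasing_seqs S I"
  shows "seq_le S I u v \<longleftrightarrow> seq_words u \<subseteq> seq_words v"
proof -
  obtain w where w: "u = (\<lambda>k. cls (w k))" "\<forall>k. w k \<in> lists S"
    and "\<forall>m n. m \<le> n \<longrightarrow> w m \<preceq> w n" and w': "seq_words u = {x. \<exists>k. x \<preceq> w k}"
    by (rule nondecreasingE[OF assms(1)])
  obtain z where z: "v = (\<lambda>k. cls (z k))" "\<forall>k. z k \<in> lists S"
    and "\<forall>m n. m \<le> n \<longrightarrow> z m \<preceq> z n" and z': "seq_words v = {x. \<exists>k. x \<preceq> z k}"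
    by (rule nondecreasingE[OF assms(2)])
  have "seq_le S I u v \<longleftrightarrow> (\<forall>k. \<exists>k'. w k \<preceq> z k')"
    unfolding seq_le_def w(1) z(1) using divides_iff w(2) z(2) by simp
  also have "\<dots> \<longleftrightarrow> seq_words u \<subseteq> seq_words v"
    unfolding w' z' using le_trans by blast
  finally show ?thesis .
qed

lemma seq_equiv_class:
  assumes "u \<in> nondecreasing_seqs S I"
  shows "seq_equiv S I `` {u} = {v \<in> nondecreasing_seqs S I. seq_words v = seq_words u}"
  unfolding seq_equiv_def using assms seq_le_iff[of u] seq_le_iff[of _ u] by blast

lemma gtracesE:
  assumes "X \<in> gtraces S I"
  obtains u where "u \<in> nondecreasing_seqs S I"
    "X = {v \<in> nondecreasing_seqs S I. seq_words v = seq_words u}" "gwords X = seq_words u"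
proof -
  obtain u where u: "u \<in> nondecreasing_seqs S I" "X = seq_equiv S I `` {u}"
    using assms by (auto simp: gtraces_def quotient_def)
  then have X: "X = {v \<in> nondecreasing_seqs S I. seq_words v = seq_words u}"
    using seq_equiv_class by simp
  then have "gwords X = seq_words u"
    unfolding gwords_def using u(1) by auto
  then show ?thesis
    using that u(1) X by blast
qed

lemma gtracesI:
  assumes "u \<in> nondecreasing_seqs S I"
  shows "seq_equiv S I `` {u} \<in> gtraces S I" "gwords (seq_equiv S I `` {u}) = seq_words u"
proof -
  show "seq_equiv S I `` {u} \<in> gtraces S I"
    using assms by (auto simp: gtraces_def quotient_def)
  show "gwords (seq_equiv S I `` {u}) = seq_words u"
    using assms seq_equiv_class by (auto simp: gwords_def)
qed

lemma ideal_gwords: "X \<in> gtraces S I \<Longrightarrow> ideal (gwords X)"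
  by (erule gtracesE) (simp add: ideal_seq_words)

lemma gtrace_le_iff:
  assumes "X \<in> gtraces S I" "Y \<in> gtraces S I"
  shows "gtrace_le S I X Y \<longleftrightarrow> gwords X \<subseteq> gwords Y"
proof -
  obtain u where u: "u \<in> nondecreasing_seqs S I"
    "X = {v \<in> nondecreasing_seqs S I. seq_words v = seq_words u}" "gwords X = seq_words u"
    using gtracesE[OF assms(1)] .
  obtain v where v: "v \<in> nondecreasing_seqs S I"
    "Y = {w \<in> nondecreasing_seqs S I. seq_words w = seq_words v}" "gwords Y = seq_words v"
    using gtracesE[OF assms(2)] .
  have "seq_le S I x y \<longleftrightarrow> seq_words u \<subseteq> seq_words v" if "x \<in> X" "y \<in> Y" for x y
    using that seq_le_iff[of x y] u(2) v(2) by simp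
  moreover have "u \<in> X" "v \<in> Y"
    using u v by simp_all
  ultimately show ?thesis
    unfolding gtrace_le_def u(3) v(3) by blast
qed

lemma gwords_inj: "X \<in> gtraces S I \<Longrightarrow> Y \<in> gtraces S I \<Longrightarrow> gwords X = gwords Y \<Longrightarrow> X = Y"
  by (elim gtracesE) simp

lemma gtrace_of_cls:
  assumes "w \<in> lists S"
  shows "gtrace_of S I (cls w) \<in> gtraces S I" "gwords (gtrace_of S I (cls w)) = {x. x \<preceq> w}"
proof -
  have "(\<lambda>_. cls w) \<in> nondecreasing_seqs S I" "seq_words (\<lambda>_. cls w) = {x. x \<preceq> w}"
    using nondecreasingI[of "\<lambda>_. w", OF assms le_refl] by simp_all
  then show "gtrace_of S I (cls w) \<in> gtraces S I" "gwords (gtrace_of S I (cls w)) = {x. x \<preceq> w}"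
    unfolding gtrace_of_def using gtracesI[of "\<lambda>_. cls w"] by simp_all
qed

text \<open>A bounded ideal has a word of greatest length, and a common bound of it with another
  word is no longer, hence equivalent to it. So a bounded ideal is principal and comes from a
  constant sequence.\<close>

lemma boundary_iff: "X \<in> boundary S I \<longleftrightarrow> X \<in> gtraces S I \<and> unbounded (gwords X)"
proof -
  have "X \<in> gtrace_of S I ` carrier (trace_monoid S I)" if X: "X \<in> gtraces S I" "\<not> unbounded (gwords X)"
  proof -
    have L: "ideal (gwords X)"
      using ideal_gwords X(1) .
    have "\<exists>b. \<forall>u\<in>gwords X. length u < b"
      using X(2) by (simp add: unbounded_def not_le)
    then obtain b where b: "\<And>u. u \<in> gwords X \<Longrightarrow> length u < b"
      by blast
    obtain w where w: "w \<in> gwords X" "\<And>u. u \<in> gwords X \<Longrightarrow> length u \<le> length w"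
      using ex_has_greatest_nat[of "\<lambda>u. u \<in> gwords X" "[]" length b] idealD(1)[OF L] b
      by (metis less_imp_le)
    have "u \<preceq> w" if u: "u \<in> gwords X" for u
    proof -
      obtain z where z: "z \<in> gwords X" "u \<preceq> z" "w \<preceq> z"
        using idealD(4)[OF L u w(1)] by blast
      then obtain x where x: "w @ x \<simeq> z"
        by (auto simp: le_iff_ex)
      then have "length w + length x \<le> length w"
        using w(2)[OF z(1)] eqv_imp_length[OF x] by simp
      then show ?thesis
        using x z(2) le_eqv_trans eqv_sym by auto
    qed
    then have "gwords X = {x. x \<preceq> w}"
      using w(1) idealD(3)[OF L] by blast
    moreover have "w \<in> lists S"
      using idealD(2)[OF L w(1)] .
    ultimately have "X = gtrace_of S I (cls w)"
      using gwords_inj[OF X(1)] gtrace_of_cls by simp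
    then show ?thesis
      using \<open>w \<in> lists S\<close> by (auto simp: carrier_eq)
  qed
  moreover have "\<not> unbounded (gwords X)" if X: "X \<in> gtrace_of S I ` carrier (trace_monoid S I)"
  proof -
    obtain w where "w \<in> lists S" "X = gtrace_of S I (cls w)"
      using X by (auto simp: carrier_eq)
    then have "gwords X = {x. x \<preceq> w}"
      using gtrace_of_cls by simp
    then have "length u < Suc (length w)" if "u \<in> gwords X" for u
      using le_imp_length that by (auto simp: less_Suc_eq_le)
    then show ?thesis
      unfolding unbounded_def by (meson not_le)
  qed
  ultimately show ?thesis
    unfolding boundary_def by blast
qed

lemma boundaryD:
  assumes "\<xi> \<in> boundary S I"
  shows "\<xi> \<in> gtraces S I" "ideal (gwords \<xi>)" "unbounded (gwords \<xi>)"
  using assms by (simp_all add: boundary_iff ideal_gwords)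

lemma up_eq:
  assumes "w \<in> lists S"
  shows "up S I (cls w) = {\<xi> \<in> boundary S I. w \<in> gwords \<xi>}"
proof -
  have "gtrace_le S I (gtrace_of S I (cls w)) \<xi> \<longleftrightarrow> w \<in> gwords \<xi>" if "\<xi> \<in> boundary S I" for \<xi>
  proof -
    have "{x. x \<preceq> w} \<subseteq> gwords \<xi> \<longleftrightarrow> w \<in> gwords \<xi>"
      using idealD(3)[OF boundaryD(2)[OF that]] by blast
    then show ?thesis
      using gtrace_le_iff[OF gtrace_of_cls(1)[OF assms] boundaryD(1)[OF that]]
      unfolding gtrace_of_cls(2)[OF assms] by blast
  qed
  then show ?thesis
    by (auto simp: up_def)
qed

section \<open>Cartier-Foata cliques of boundary points\<close>

lemma path_gtrace:
  assumes "\<And>n. clique_chain n A"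
  shows "\<exists>X. X \<in> boundary S I \<and> gwords X = path_ideal A"
proof -
  have nd: "(\<lambda>k. cls (path_word A k)) \<in> nondecreasing_seqs S I"
    "seq_words (\<lambda>k. cls (path_word A k)) = path_ideal A"
    unfolding path_ideal_def
    by (rule nondecreasingI; rule path_word_lists[OF assms] path_word_mono; simp)+
  show ?thesis
    using gtracesI[OF nd(1)] ideal_path_ideal[OF assms] unfolding boundary_iff nd(2) by metis
qed

lemma clique_paths_iff:
  "c \<in> clique_paths S I \<longleftrightarrow> (\<exists>A. (\<forall>n. clique_chain n A) \<and> c = (\<lambda>k. clq (A k)))"
proof
  assume c: "c \<in> clique_paths S I"
  then have "\<forall>k. \<exists>A. set_clique A \<and> A \<noteq> {} \<and> c k = clq A"
    unfolding clique_paths_def nonempty_cliques_eq by blast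
  then obtain A where A: "\<And>k. set_clique (A k)" "\<And>k. A k \<noteq> {}" "\<And>k. c k = clq (A k)"
    by metis
  moreover have "arrow (A k) (A (Suc k))" for k
    using c clique_arrow_iff[OF A(1)[of k] A(1)[of "Suc k"]]
    unfolding clique_paths_def A(3) by blast
  ultimately have "\<forall>n. clique_chain n A"
    by (simp add: clique_chain_def)
  moreover have "c = (\<lambda>k. clq (A k))"
    using A(3) by blast
  ultimately show "\<exists>A. (\<forall>n. clique_chain n A) \<and> c = (\<lambda>k. clq (A k))"
    by blast
next
  assume "\<exists>A. (\<forall>n. clique_chain n A) \<and> c = (\<lambda>k. clq (A k))"
  then obtain A where A: "\<And>n. clique_chain n A" "c = (\<lambda>k. clq (A k))"
    by blast
  have k: "set_clique (A k)" "A k \<noteq> {}" "arrow (A k) (A (Suc k))" for k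
    using A(1)[of "Suc (Suc k)"] by (simp_all add: clique_chain_def)
  have "clq (A k) \<in> nonempty_cliques S I" "clique_arrow S I (clq (A k)) (clq (A (Suc k)))" for k
    using k clique_arrow_iff by (auto simp: nonempty_cliques_eq)
  then show "c \<in> clique_paths S I"
    by (simp add: clique_paths_def A(2))
qed

text \<open>The upper bounds of the prefixes are the points whose ideal contains the union of the
  principal ideals, which is \<open>path_ideal A\<close>. That union is itself the ideal of a point,
  so the least upper bound is the point with exactly this ideal.\<close>

lemma is_lub_path_iff:
  assumes "\<xi> \<in> gtraces S I" "\<And>n. clique_chain n A"
  shows "gtrace_is_lub S I (range (\<lambda>k. gtrace_of S I (trace_prefix S I (\<lambda>k. clq (A k)) (Suc k)))) \<xi>
    \<longleftrightarrow> gwords \<xi> = path_ideal A"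
proof -
  let ?w = "\<lambda>k. path_word A (Suc k)"
  have w: "?w k \<in> lists S" for k
    using path_word_lists[OF assms(2)] .
  have "set_clique (A i)" for i
    using assms(2)[of "Suc i"] by (simp add: clique_chain_def)
  then have tp: "trace_prefix S I (\<lambda>k. clq (A k)) (Suc k) = cls (?w k)" for k
    using trace_prefix_eq[of "Suc k" A "\<lambda>k. clq (A k)"] by blast
  have le: "gtrace_le S I (gtrace_of S I (cls (?w k))) Z \<longleftrightarrow> {x. x \<preceq> ?w k} \<subseteq> gwords Z"
    if "Z \<in> gtraces S I" for Z k
    using gtrace_le_iff[OF gtrace_of_cls(1)[OF w] that] gtrace_of_cls(2)[OF w] by simp
  have un: "path_ideal A = (\<Union>k. {x. x \<preceq> ?w k})"
  proof -
    have "\<exists>k. x \<preceq> ?w k" if "x \<preceq> path_word A n" for x n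
      using le_trans[OF that path_word_mono[of n "Suc n" A]] by (meson le_SucI order_refl)
    then show ?thesis
      unfolding path_ideal_def by blast
  qed
  obtain X where X: "X \<in> gtraces S I" "gwords X = path_ideal A"
    using path_gtrace[OF assms(2)] boundaryD(1) by blast
  have ub: "(\<forall>Y\<in>range (\<lambda>k. gtrace_of S I (cls (?w k))). gtrace_le S I Y Z) \<longleftrightarrow> path_ideal A \<subseteq> gwords Z"
    if "Z \<in> gtraces S I" for Z
    unfolding un using le[OF that] by blast
  show ?thesis
    unfolding gtrace_is_lub_def tp
  proof
    assume "\<xi> \<in> gtraces S I \<and> (\<forall>Y\<in>range (\<lambda>k. gtrace_of S I (cls (?w k))). gtrace_le S I Y \<xi>) \<and>
      (\<forall>Z\<in>gtraces S I. (\<forall>Y\<in>range (\<lambda>k. gtrace_of S I (cls (?w k))). gtrace_le S I Y Z) \<longrightarrow> gtrace_le S I \<xi> Z)"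
    then have "path_ideal A \<subseteq> gwords \<xi>" "gtrace_le S I \<xi> X"
      using ub[OF assms(1)] ub[OF X(1)] X by blast+
    then show "gwords \<xi> = path_ideal A"
      using gtrace_le_iff[OF assms(1) X(1)] X(2) by blast
  next
    assume eq: "gwords \<xi> = path_ideal A"
    show "\<xi> \<in> gtraces S I \<and> (\<forall>Y\<in>range (\<lambda>k. gtrace_of S I (cls (?w k))). gtrace_le S I Y \<xi>) \<and>
      (\<forall>Z\<in>gtraces S I. (\<forall>Y\<in>range (\<lambda>k. gtrace_of S I (cls (?w k))). gtrace_le S I Y Z) \<longrightarrow> gtrace_le S I \<xi> Z)"
    proof (intro conjI ballI impI)
      show "\<xi> \<in> gtraces S I"
        by (rule assms(1))
      show "gtrace_le S I Y \<xi>" if "Y \<in> range (\<lambda>k. gtrace_of S I (cls (?w k)))" for Y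
        using ub[OF assms(1)] eq that by blast
      show "gtrace_le S I \<xi> Z" if "Z \<in> gtraces S I"
        "\<forall>Y\<in>range (\<lambda>k. gtrace_of S I (cls (?w k))). gtrace_le S I Y Z" for Z
        using ub[OF that(1)] that(2) gtrace_le_iff[OF assms(1) that(1)] eq by blast
    qed
  qed
qed

lemma cartier_foata_eq:
  assumes "\<xi> \<in> boundary S I"
  shows "cartier_foata S I \<xi> = (\<lambda>k. clq (foata (gwords \<xi>) k))"
  unfolding cartier_foata_def
proof (rule the_equality)
  note \<xi> = boundaryD[OF assms]
  have chain: "clique_chain n (foata (gwords \<xi>))" for n
    using foata_clique_chain[OF \<xi>(2,3)] .
  have "gwords \<xi> = path_ideal (foata (gwords \<xi>))"
    by (rule path_ideal_foata[OF \<xi>(2), symmetric])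
  then show "(\<lambda>k. clq (foata (gwords \<xi>) k)) \<in> clique_paths S I \<and>
    gtrace_is_lub S I (range (\<lambda>k. gtrace_of S I (trace_prefix S I (\<lambda>k. clq (foata (gwords \<xi>) k)) (Suc k)))) \<xi>"
    using is_lub_path_iff[OF \<xi>(1) chain] chain clique_paths_iff by blast
  fix c assume c: "c \<in> clique_paths S I \<and>
    gtrace_is_lub S I (range (\<lambda>k. gtrace_of S I (trace_prefix S I c (Suc k)))) \<xi>"
  then obtain A where A: "\<And>n. clique_chain n A" "c = (\<lambda>k. clq (A k))"
    using clique_paths_iff by blast
  then have "gwords \<xi> = path_ideal A"
    using c is_lub_path_iff[OF \<xi>(1) A(1)] by blast
  then show "c = (\<lambda>k. clq (foata (gwords \<xi>) k))"
    using foata_path_ideal[OF A(1)] A(2) by simp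
qed

lemma bij_betw_cartier_foata: "bij_betw (cartier_foata S I) (boundary S I) (clique_paths S I)"
proof (rule bij_betw_imageI)
  have set: "set_clique (foata (gwords \<xi>) k)" if "\<xi> \<in> boundary S I" for \<xi> k
    using foata_clique_chain[OF boundaryD(2,3)[OF that], of "Suc k"] by (auto simp: clique_chain_def)
  show "inj_on (cartier_foata S I) (boundary S I)"
  proof (rule inj_onI)
    fix \<xi> \<eta> assume *: "\<xi> \<in> boundary S I" "\<eta> \<in> boundary S I" "cartier_foata S I \<xi> = cartier_foata S I \<eta>"
    then have "clq (foata (gwords \<xi>) k) = clq (foata (gwords \<eta>) k)" for k
      by (simp add: cartier_foata_eq fun_eq_iff)
    then have "foata (gwords \<xi>) k = foata (gwords \<eta>) k" for k
      using clq_eq_iff set *(1,2) by blast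
    then have "foata (gwords \<xi>) = foata (gwords \<eta>)"
      by blast
    then have "path_ideal (foata (gwords \<xi>)) = path_ideal (foata (gwords \<eta>))"
      by (rule arg_cong)
    then have "gwords \<xi> = gwords \<eta>"
      unfolding path_ideal_foata[OF boundaryD(2)[OF *(1)]] path_ideal_foata[OF boundaryD(2)[OF *(2)]] .
    then show "\<xi> = \<eta>"
      using gwords_inj boundaryD(1) *(1,2) by blast
  qed
  show "cartier_foata S I ` boundary S I = clique_paths S I"
  proof (intro Set.set_eqI iffI)
    fix c assume "c \<in> cartier_foata S I ` boundary S I"
    then obtain \<xi> where \<xi>: "\<xi> \<in> boundary S I" "c = (\<lambda>k. clq (foata (gwords \<xi>) k))"
      using cartier_foata_eq by auto
    show "c \<in> clique_paths S I"
      unfolding clique_paths_iff \<xi>(2) using foata_clique_chain[OF boundaryD(2,3)[OF \<xi>(1)]] by blast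
  next
    fix c assume "c \<in> clique_paths S I"
    then obtain A where A: "\<And>n. clique_chain n A" "c = (\<lambda>k. clq (A k))"
      using clique_paths_iff by blast
    obtain X where X: "X \<in> boundary S I" "gwords X = path_ideal A"
      using path_gtrace[OF A(1)] by blast
    then have "c = cartier_foata S I X"
      using cartier_foata_eq[OF X(1)] foata_path_ideal[OF A(1)] A(2) by simp
    then show "c \<in> cartier_foata S I ` boundary S I"
      using X(1) by blast
  qed
qed

end

section \<open>Moebius inversion over cliques\<close>

lemma sum_Pow_alternating:
  assumes "finite E"
  shows "(\<Sum>B\<in>Pow E. (- 1) ^ card B) = (if E = {} then 1 else 0 :: real)"
  using assms
proof (induction E)
  case (insert a E)
  have "(\<Sum>B\<in>Pow (insert a E). (- 1) ^ card B) =
      (\<Sum>B\<in>Pow E. (- 1) ^ card B) + (\<Sum>B\<in>insert a ` Pow E. (- 1 :: real) ^ card B)"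
    unfolding Pow_insert using insert.hyps by (intro sum.union_disjoint) auto
  also have "(\<Sum>B\<in>insert a ` Pow E. (- 1 :: real) ^ card B) = (\<Sum>B\<in>Pow E. (- 1) ^ card (insert a B))"
  proof (rule sum.reindex_cong[OF _ refl refl])
    show "inj_on (insert a) (Pow E)"
      using insert.hyps by (intro inj_onI) (metis PowD insert_ident subsetD)
  qed
  also have "\<dots> = (\<Sum>B\<in>Pow E. - ((- 1) ^ card B))"
  proof (rule sum.cong[OF refl])
    fix B assume "B \<in> Pow E"
    then have "finite B" "a \<notin> B"
      using insert.hyps finite_subset by auto
    then show "(- 1 :: real) ^ card (insert a B) = - ((- 1) ^ card B)"
      by simp
  qed
  finally show ?case
    by (simp add: sum_negf)
qed simp

lemma sum_interval_alternating:
  assumes "finite E" "C \<subseteq> E"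
  shows "(\<Sum>D | C \<subseteq> D \<and> D \<subseteq> E. (- 1) ^ (card D - card C)) = (if C = E then 1 else 0 :: real)"
    "(\<Sum>D | C \<subseteq> D \<and> D \<subseteq> E. (- 1) ^ (card E - card D)) = (if C = E then 1 else 0 :: real)"
proof -
  have fin: "finite C"
    using assms finite_subset by blast
  have "(\<Sum>D | C \<subseteq> D \<and> D \<subseteq> E. (- 1 :: real) ^ (card D - card C)) = (\<Sum>B\<in>Pow (E - C). (- 1) ^ card B)"
  proof (rule sum.reindex_bij_witness[of _ "\<lambda>B. C \<union> B" "\<lambda>D. D - C"])
    fix D assume "D \<in> {D. C \<subseteq> D \<and> D \<subseteq> E}"
    then show "(- 1 :: real) ^ card (D - C) = (- 1) ^ (card D - card C)"
      using fin by (simp add: card_Diff_subset)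
  qed (use assms in auto)
  then show *: "(\<Sum>D | C \<subseteq> D \<and> D \<subseteq> E. (- 1) ^ (card D - card C)) = (if C = E then 1 else 0 :: real)"
    using sum_Pow_alternating[of "E - C"] assms by auto
  have "(- 1 :: real) ^ (card E - card D) = (- 1) ^ (card E - card C) * (- 1) ^ (card D - card C)"
    if "D \<in> {D. C \<subseteq> D \<and> D \<subseteq> E}" for D
  proof -
    have "card C \<le> card D" "card D \<le> card E"
      using that assms(1) finite_subset by (auto intro!: card_mono)
    \<comment> \<open>The two exponents differ by an even number, so the second sum is the first up
      to the constant sign \<open>(- 1) ^ (card E - card C)\<close>.\<close>
    then have "card E - card C + (card D - card C) = card E - card D + 2 * (card D - card C)"
      by simp
    then have "(- 1 :: real) ^ (card E - card C + (card D - card C)) = (- 1) ^ (card E - card D)"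
      by (simp add: power_add power_mult)
    then show ?thesis
      by (simp add: power_add)
  qed
  then have "(\<Sum>D | C \<subseteq> D \<and> D \<subseteq> E. (- 1 :: real) ^ (card E - card D)) =
      (- 1) ^ (card E - card C) * (\<Sum>D | C \<subseteq> D \<and> D \<subseteq> E. (- 1) ^ (card D - card C))"
    by (simp add: sum_distrib_left)
  then show "(\<Sum>D | C \<subseteq> D \<and> D \<subseteq> E. (- 1) ^ (card E - card D)) = (if C = E then 1 else 0 :: real)"
    using * by auto
qed

context trace_alphabet
begin

definition moebius :: "('a set \<Rightarrow> real) \<Rightarrow> 'a set \<Rightarrow> real" where
  "moebius F A = (\<Sum>B | set_clique B \<and> A \<subseteq> B. (- 1) ^ (card B - card A) * F B)"

lemma moebius_transform_eq:
  "set_clique A \<Longrightarrow> moebius_transform S I f (clq A) = moebius (\<lambda>B. f (clq B)) A"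
  by (simp add: moebius_transform_clq moebius_def)

lemma set_clique_subset: "set_clique B \<Longrightarrow> A \<subseteq> B \<Longrightarrow> set_clique A"
  using clique_subset by (auto simp: set_clique_def)

lemma finite_cliques_Collect: "finite {B. set_clique B \<and> R B}"
  using finite_subset[OF _ finite_set_cliques] by blast

lemma sum_cliques_swap:
  "(\<Sum>D | set_clique D \<and> C \<subseteq> D. \<Sum>E | set_clique E \<and> D \<subseteq> E. g D E) =
   (\<Sum>E | set_clique E \<and> C \<subseteq> E. \<Sum>D | C \<subseteq> D \<and> D \<subseteq> E. g D E)"
proof -
  have "(\<Sum>D | set_clique D \<and> C \<subseteq> D. \<Sum>E | set_clique E \<and> D \<subseteq> E. g D E) =
      (\<Sum>D | set_clique D \<and> C \<subseteq> D. \<Sum>E | E \<in> {E. set_clique E \<and> C \<subseteq> E} \<and> D \<subseteq> E. g D E)"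
    by (intro sum.cong) auto
  also have "\<dots> = (\<Sum>E | set_clique E \<and> C \<subseteq> E. \<Sum>D | D \<in> {D. set_clique D \<and> C \<subseteq> D} \<and> D \<subseteq> E. g D E)"
    by (intro sum.swap_restrict finite_cliques_Collect)
  also have "\<dots> = (\<Sum>E | set_clique E \<and> C \<subseteq> E. \<Sum>D | C \<subseteq> D \<and> D \<subseteq> E. g D E)"
    by (intro sum.cong) (auto intro: set_clique_subset)
  finally show ?thesis .
qed

text \<open>The inversion used for measures, where \<open>p E\<close> is the probability that the
  root clique is exactly \<open>E\<close>.\<close>

lemma moebius_sum_supersets:
  assumes "set_clique C"
  shows "moebius (\<lambda>D. \<Sum>E | set_clique E \<and> D \<subseteq> E. p E) C = p C"
proof -
  have "moebius (\<lambda>D. \<Sum>E | set_clique E \<and> D \<subseteq> E. p E) C =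
      (\<Sum>E | set_clique E \<and> C \<subseteq> E. (\<Sum>D | C \<subseteq> D \<and> D \<subseteq> E. (- 1) ^ (card D - card C)) * p E)"
    unfolding moebius_def sum_distrib_left sum_cliques_swap sum_distrib_right ..
  also have "\<dots> = (\<Sum>E | set_clique E \<and> C \<subseteq> E. if C = E then p E else 0)"
    by (intro sum.cong refl) (simp add: sum_interval_alternating set_clique_finite)
  also have "\<dots> = p C"
    using assms by (simp add: sum.delta' finite_cliques_Collect)
  finally show ?thesis .
qed

text \<open>The opposite inversion, used at the empty clique to compute the total mass of the
  transform.\<close>

lemma sum_supersets_moebius:
  assumes "set_clique C"
  shows "(\<Sum>D | set_clique D \<and> C \<subseteq> D. moebius F D) = F C"
proof -
  have "(\<Sum>D | set_clique D \<and> C \<subseteq> D. moebius F D) =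
      (\<Sum>E | set_clique E \<and> C \<subseteq> E. (\<Sum>D | C \<subseteq> D \<and> D \<subseteq> E. (- 1) ^ (card E - card D)) * F E)"
    unfolding moebius_def sum_cliques_swap sum_distrib_right ..
  also have "\<dots> = (\<Sum>E | set_clique E \<and> C \<subseteq> E. if C = E then F E else 0)"
    by (intro sum.cong refl) (simp add: sum_interval_alternating set_clique_finite)
  also have "\<dots> = F C"
    using assms by (simp add: sum.delta' finite_cliques_Collect)
  finally show ?thesis .
qed

section \<open>Multiplicative functions on cliques\<close>

definition multiplicative :: "('a set \<Rightarrow> real) \<Rightarrow> bool" where
  "multiplicative F \<longleftrightarrow> (\<forall>A B. set_clique A \<longrightarrow> set_clique B \<longrightarrow> commuting A B \<longrightarrow> F (A \<union> B) = F A * F B)"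

text \<open>Irreflexivity makes commuting sets disjoint. Hence the cliques containing
  \<open>A\<close> are exactly the unions of \<open>A\<close> with cliques commuting with it, the
  reindexing behind \<open>moebius_factor\<close>.\<close>

lemma commuting_clique:
  "set_clique (A \<union> B) \<and> A \<inter> B = {} \<longleftrightarrow> set_clique A \<and> set_clique B \<and> commuting A B"
proof
  assume *: "set_clique (A \<union> B) \<and> A \<inter> B = {}"
  then have "(a, b) \<in> I" if "a \<in> A" "b \<in> B" for a b
    using that unfolding set_clique_def clique_def by (metis IntI UnCI empty_iff)
  then show "set_clique A \<and> set_clique B \<and> commuting A B"
    using * set_clique_subset by (auto simp: commuting_def)
next
  assume *: "set_clique A \<and> set_clique B \<and> commuting A B"
  then have "(a, b) \<in> I" "(b, a) \<in> I" if "a \<in> A" "b \<in> B" for a b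
    using that sym by (auto simp: commuting_def)
  moreover from this have "A \<inter> B = {}"
    using irrefl by blast
  ultimately show "set_clique (A \<union> B) \<and> A \<inter> B = {}"
    using * by (auto simp: set_clique_def clique_def)
qed

lemma moebius_factor:
  assumes "multiplicative F" "set_clique A"
  shows "moebius F A = F A * (\<Sum>E | set_clique E \<and> commuting A E. (- 1) ^ card E * F E)"
proof -
  have fin: "finite A"
    using set_clique_finite assms(2) .
  have "moebius F A = (\<Sum>E | set_clique E \<and> commuting A E. F A * ((- 1) ^ card E * F E))"
    unfolding moebius_def
  proof (rule sum.reindex_bij_witness[of _ "\<lambda>E. A \<union> E" "\<lambda>B. B - A"])
    fix B assume B: "B \<in> {B. set_clique B \<and> A \<subseteq> B}"
    then have "A \<union> (B - A) = B"
      by auto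
    moreover have "set_clique (B - A)" "commuting A (B - A)"
      using B commuting_clique[of A "B - A"] \<open>A \<union> (B - A) = B\<close> by auto
    ultimately have "F B = F A * F (B - A)"
      using assms unfolding multiplicative_def by metis
    then show "F A * ((- 1) ^ card (B - A) * F (B - A)) = (- 1) ^ (card B - card A) * F B"
      using B fin by (simp add: card_Diff_subset)
    show "B - A \<in> {E. set_clique E \<and> commuting A E}" "A \<union> (B - A) = B"
      using \<open>set_clique (B - A)\<close> \<open>commuting A (B - A)\<close> B by auto
  next
    fix E assume "E \<in> {E. set_clique E \<and> commuting A E}"
    then show "A \<union> E - A = E" "A \<union> E \<in> {B. set_clique B \<and> A \<subseteq> B}"
      using commuting_clique[of A E] assms(2) by auto
  qed
  then show ?thesis
    by (simp add: sum_distrib_left)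
qed

text \<open>After exchanging the sums, the inner one runs for fixed \<open>E\<close> over all
  subsets of the letters of \<open>E\<close> that are dependent on \<open>A\<close>. This
  alternating sum vanishes unless there are no such letters, that is, unless \<open>E\<close>
  commutes with \<open>A\<close>.\<close>

lemma sum_arrow_moebius:
  "(\<Sum>D | set_clique D \<and> arrow A D. moebius F D) =
   (\<Sum>E | set_clique E \<and> commuting A E. (- 1) ^ card E * F E)"
proof -
  have inner: "(\<Sum>D | D \<in> {D. set_clique D \<and> arrow A D} \<and> D \<subseteq> E. (- 1) ^ (card E - card D)) =
      (if commuting A E then (- 1) ^ card E else 0 :: real)" if E: "set_clique E" for E
  proof -
    let ?E = "{b \<in> E. \<exists>a\<in>A. (a, b) \<notin> I}"
    have fin: "finite E"
      using set_clique_finite E .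
    have "{D. D \<in> {D. set_clique D \<and> arrow A D} \<and> D \<subseteq> E} = Pow ?E"
      using set_clique_subset[OF E] unfolding arrow_def by auto
    then have "(\<Sum>D | D \<in> {D. set_clique D \<and> arrow A D} \<and> D \<subseteq> E. (- 1 :: real) ^ (card E - card D)) =
        (\<Sum>D\<in>Pow ?E. (- 1) ^ card E * (- 1) ^ card D)"
    proof (rule sum.cong)
      fix D assume "D \<in> Pow ?E"
      then have "card D \<le> card E"
        using fin by (intro card_mono) auto
      then have eq: "card E + card D = card E - card D + 2 * card D"
        by simp
      have "(- 1 :: real) ^ (card E + card D) = (- 1) ^ (card E - card D)"
        by (subst eq) (simp add: power_add power_mult)
      then show "(- 1 :: real) ^ (card E - card D) = (- 1) ^ card E * (- 1) ^ card D"
        by (simp add: power_add)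
    qed
    also have "\<dots> = (if ?E = {} then (- 1) ^ card E else 0)"
      unfolding sum_distrib_left[symmetric] using sum_Pow_alternating[of ?E] fin by simp
    also have "?E = {} \<longleftrightarrow> commuting A E"
      by (auto simp: commuting_def)
    finally show ?thesis .
  qed
  have "(\<Sum>D | set_clique D \<and> arrow A D. moebius F D) =
      (\<Sum>D | set_clique D \<and> arrow A D. \<Sum>E | E \<in> {E. set_clique E} \<and> D \<subseteq> E. (- 1) ^ (card E - card D) * F E)"
    unfolding moebius_def by simp
  also have "\<dots> = (\<Sum>E | set_clique E. \<Sum>D | D \<in> {D. set_clique D \<and> arrow A D} \<and> D \<subseteq> E. (- 1) ^ (card E - card D) * F E)"
    by (intro sum.swap_restrict finite_cliques_Collect finite_set_cliques)
  also have "\<dots> = (\<Sum>E | set_clique E. if commuting A E then (- 1) ^ card E * F E else 0)"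
  proof (rule sum.cong[OF refl])
    fix E assume "E \<in> {E. set_clique E}"
    then show "(\<Sum>D | D \<in> {D. set_clique D \<and> arrow A D} \<and> D \<subseteq> E. (- 1) ^ (card E - card D) * F E) =
        (if commuting A E then (- 1) ^ card E * F E else 0)"
      unfolding sum_distrib_right[symmetric] using inner[of E] by simp
  qed
  also have "\<dots> = (\<Sum>E | set_clique E \<and> commuting A E. (- 1) ^ card E * F E)"
    by (simp add: sum.inter_filter[symmetric] finite_set_cliques)
  finally show ?thesis .
qed

lemma moebius_eq_arrow_sum:
  assumes "multiplicative F" "set_clique A"
  shows "moebius F A = F A * (\<Sum>D | set_clique D \<and> arrow A D. moebius F D)"
  using moebius_factor[OF assms] sum_arrow_moebius by simp

section \<open>Reachability along arrows and positivity of the transform\<close>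

definition clique_step :: "'a set \<Rightarrow> 'a set \<Rightarrow> bool" where
  "clique_step A B \<longleftrightarrow> set_clique B \<and> B \<noteq> {} \<and> arrow A B"

text \<open>A clique that does not dominate \<open>S\<close> can be enlarged: if \<open>a\<^sub>2\<close> has distance exactly two from \<open>A\<close>
  in the dependence graph, through \<open>a\<^sub>1\<close>, then \<open>A \<rightarrow> (A without the neighbours of a\<^sub>1) \<union> {a\<^sub>1} \<rightarrow> A \<union> {a\<^sub>2}\<close>.\<close>

lemma reach_dominating:
  assumes "irreducible_trace_monoid S I" "set_clique A" "A \<noteq> {}"
  shows "\<exists>B. clique_step\<^sup>*\<^sup>* A B \<and> set_clique B \<and> B \<noteq> {} \<and> (\<forall>s\<in>S. \<exists>b\<in>B. (b, s) \<notin> I)"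
  using assms(2,3)
proof (induction "card S - card A" arbitrary: A rule: less_induct)
  case less
  show ?case
  proof (cases "\<forall>s\<in>S. \<exists>b\<in>A. (b, s) \<notin> I")
    case True
    then show ?thesis
      using less.prems by blast
  next
    case False
    then obtain s where s: "s \<in> S" "\<forall>b\<in>A. (b, s) \<in> I"
      by blast
    obtain a where a: "a \<in> A" "a \<in> S"
      using less.prems by (auto simp: set_clique_def)
    let ?far = "\<lambda>x. \<forall>b\<in>A. (b, x) \<in> I"
    have "(a, s) \<in> (dependence S I)\<^sup>*"
      using assms(1) a s by (auto simp: irreducible_trace_monoid_def)
    \<comment> \<open>The walk starts in \<open>A\<close>, whose letters are dependent on themselves
      and so not far, and ends at \<open>s\<close>. Some edge of it switches from not far to far;
      its ends are at distances one and two from \<open>A\<close>.\<close>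
    then have "?far s \<longrightarrow> (\<exists>x y. (x, y) \<in> dependence S I \<and> \<not> ?far x \<and> ?far y)"
    proof (induction rule: rtrancl_induct)
      case base
      then show ?case
        using a irrefl by blast
    next
      case (step y z)
      then show ?case
        by blast
    qed
    then obtain x y where xy: "x \<in> S" "y \<in> S" "(x, y) \<notin> I" "\<not> ?far x" "?far y"
      using s by (auto simp: dependence_def)
    obtain b where b: "b \<in> A" "(b, x) \<notin> I"
      using xy by blast
    let ?B = "insert x {c \<in> A. (c, x) \<in> I}" and ?C = "insert y A"
    have B: "set_clique ?B"
      using less.prems xy sym unfolding set_clique_def clique_def by blast
    have C: "set_clique ?C"
      using less.prems xy sym unfolding set_clique_def clique_def by blast
    have "arrow A ?B"
      using b irrefl unfolding arrow_def by blast
    moreover have "arrow ?B ?C"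
      using xy(3) irrefl sym unfolding arrow_def by blast
    ultimately have reach: "clique_step\<^sup>*\<^sup>* A ?C"
      using B C by (intro converse_rtranclp_into_rtranclp[of _ A ?B] r_into_rtranclp) (auto simp: clique_step_def)
    have "y \<notin> A"
      using xy irrefl by blast
    then have "card ?C = Suc (card A)"
      using set_clique_finite[OF less.prems(1)] by simp
    moreover have "card ?C \<le> card S"
      using C finite_S by (intro card_mono) (auto simp: set_clique_def)
    ultimately have "card S - card ?C < card S - card A"
      by simp
    then show ?thesis
      using less.hyps[of ?C] C reach rtranclp_trans by (metis insert_not_empty)
  qed
qed

lemma dominating_step: "set_clique B \<Longrightarrow> B \<noteq> {} \<Longrightarrow> \<forall>s\<in>S. \<exists>a\<in>A. (a, s) \<notin> I \<Longrightarrow> clique_step A B"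
  unfolding clique_step_def arrow_def set_clique_def by blast

text \<open>A dominating clique has an arrow to every non-empty clique, so it suffices to reach
  one.\<close>

lemma reach_all:
  assumes "irreducible_trace_monoid S I" "set_clique A" "A \<noteq> {}" "set_clique B" "B \<noteq> {}"
  shows "clique_step\<^sup>*\<^sup>* A B"
proof -
  obtain D where "clique_step\<^sup>*\<^sup>* A D" "\<forall>s\<in>S. \<exists>b\<in>D. (b, s) \<notin> I"
    using reach_dominating[OF assms(1-3)] by blast
  then show ?thesis
    using dominating_step[OF assms(4,5)] rtranclp.rtrancl_into_rtrancl[of clique_step A D B] by blast
qed

lemma moebius_pos:
  assumes "irreducible_trace_monoid S I" "multiplicative F"
    and F: "\<And>A. set_clique A \<Longrightarrow> F A > 0"
    and nonneg: "\<And>A. set_clique A \<Longrightarrow> moebius F A \<ge> 0"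
    and A: "set_clique A" "A \<noteq> {}"
  shows "moebius F A > 0"
proof -
  obtain B where B: "clique_step\<^sup>*\<^sup>* A B" "set_clique B" "\<forall>s\<in>S. \<exists>b\<in>B. (b, s) \<notin> I"
    using reach_dominating[OF assms(1) A] by blast
  \<comment> \<open>A dominating clique is maximal, so its Moebius sum has a single term.\<close>
  have "{D. set_clique D \<and> B \<subseteq> D} = {B}"
  proof (intro equalityI subsetI)
    fix D assume D: "D \<in> {D. set_clique D \<and> B \<subseteq> D}"
    have "x \<in> B" if x: "x \<in> D" for x
    proof (rule ccontr)
      assume "x \<notin> B"
      then have "\<forall>b\<in>B. (b, x) \<in> I"
        using D x by (auto simp: set_clique_def clique_def)
      moreover have "x \<in> S"
        using D x by (auto simp: set_clique_def)
      ultimately show False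
        using B(3) by blast
    qed
    then show "D \<in> {B}"
      using D by auto
  qed (use B in auto)
  then have "moebius F B > 0"
    using F[OF B(2)] by (simp add: moebius_def)
  with B(1) show ?thesis
    using A
  proof (induction rule: converse_rtranclp_induct)
    case (step A D)
    then have D: "set_clique D" "D \<noteq> {}" "arrow A D"
      by (auto simp: clique_step_def)
    then have "0 < moebius F D"
      using step by blast
    \<comment> \<open>Nonnegativity allows the other summands to be dropped.\<close>
    also have "\<dots> \<le> (\<Sum>D | set_clique D \<and> arrow A D. moebius F D)"
      using D nonneg by (intro member_le_sum finite_cliques_Collect) auto
    finally show ?case
      using moebius_eq_arrow_sum[OF assms(2) step.prems(2)] F[OF step.prems(2)] by simp
  qed simp
qed

section \<open>Measures on the boundary\<close>

lemma space_boundary_algebra [simp]: "space (boundary_algebra S I) = boundary S I"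
  by (simp add: boundary_algebra_def space_measure_of_conv)

lemma up_in_sets: "w \<in> lists S \<Longrightarrow> up S I (cls w) \<in> sets (boundary_algebra S I)"
  unfolding boundary_algebra_def carrier_eq
  by (rule in_measure_of) (auto simp: up_def)

text \<open>The event \<open>R_u = C\<close>. Over all cliques \<open>C\<close>, these events
  partition the set of boundary points above \<open>u\<close>.\<close>

definition branch :: "'a list \<Rightarrow> 'a set \<Rightarrow> 'a gtrace set" where
  "branch u C = {\<xi> \<in> boundary S I. u \<in> gwords \<xi> \<and> roots (residual (gwords \<xi>) u) = C}"

lemma up_append_clique:
  assumes "u \<in> lists S" "set_clique C"
  shows "up S I (cls (u @ set_word C)) =
    {\<xi> \<in> boundary S I. u \<in> gwords \<xi> \<and> C \<subseteq> roots (residual (gwords \<xi>) u)}"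
proof -
  have "u @ set_word C \<in> gwords \<xi> \<longleftrightarrow> u \<in> gwords \<xi> \<and> C \<subseteq> roots (residual (gwords \<xi>) u)"
    if \<xi>: "\<xi> \<in> boundary S I" for \<xi>
  proof (cases "u \<in> gwords \<xi>")
    case True
    then show ?thesis
      using subset_roots_iff[OF ideal_residual[OF boundaryD(2)[OF \<xi>] True] assms(2)]
      by (simp add: residual_def)
  next
    case False
    then show ?thesis
      using idealD(3)[OF boundaryD(2)[OF \<xi>] _ le_append] by blast
  qed
  then show ?thesis
    using up_eq[of "u @ set_word C"] assms set_clique_word(4) by (simp add: append_lists del: in_lists_conv_set) blast
qed

lemma up_eq_Union_branch:
  assumes "u \<in> lists S" "set_clique C"
  shows "up S I (cls (u @ set_word C)) = (\<Union>D\<in>{D. set_clique D \<and> C \<subseteq> D}. branch u D)"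
proof -
  have "set_clique (roots (residual (gwords \<xi>) u))" if "\<xi> \<in> boundary S I" "u \<in> gwords \<xi>" for \<xi>
    using roots_clique[OF ideal_residual[OF boundaryD(2)[OF that(1)] that(2)]] .
  then show ?thesis
    unfolding up_append_clique[OF assms] branch_def by blast
qed

lemma branch_in_sets:
  assumes "u \<in> lists S" "set_clique C"
  shows "branch u C \<in> sets (boundary_algebra S I)"
proof -
  have up: "up S I (cls (u @ set_word D)) \<in> sets (boundary_algebra S I)" if "set_clique D" for D
    using up_in_sets assms(1) set_clique_word(4)[OF that] append_lists by blast
  have "branch u C = up S I (cls (u @ set_word C)) - (\<Union>D\<in>{D. set_clique D \<and> C \<subset> D}. up S I (cls (u @ set_word D)))"
  proof -
    have "set_clique (roots (residual (gwords \<xi>) u))" if "\<xi> \<in> boundary S I" "u \<in> gwords \<xi>" for \<xi>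
      using roots_clique[OF ideal_residual[OF boundaryD(2)[OF that(1)] that(2)]] .
    then show ?thesis
      using up_append_clique[OF assms(1)] assms(2) unfolding branch_def by (simp add: set_eq_iff) blast
  qed
  also have "\<dots> \<in> sets (boundary_algebra S I)"
    using up assms(2) finite_cliques_Collect by (intro sets.Diff sets.finite_UN) auto
  finally show ?thesis .
qed

text \<open>Stated for any finite measure because both directions use it: multiplicativity of a
  Bernoulli measure turns it into a formula for the branch, while for the induced measure it is the
  equation to be solved for the sets \<open>up\<close>.\<close>

lemma measure_branch:
  assumes P: "finite_measure P" "sets P = sets (boundary_algebra S I)"
    and u: "u \<in> lists S" "set_clique C"
  shows "measure P (branch u C) = moebius (\<lambda>D. measure P (up S I (cls (u @ set_word D)))) C"
proof -
  have "measure P (up S I (cls (u @ set_word D))) = (\<Sum>E | set_clique E \<and> D \<subseteq> E. measure P (branch u E))"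
    if "set_clique D" for D
    unfolding up_eq_Union_branch[OF u(1) that]
  proof (rule finite_measure.finite_measure_finite_Union[OF P(1) finite_cliques_Collect])
    show "branch u ` {E. set_clique E \<and> D \<subseteq> E} \<subseteq> sets P"
      using branch_in_sets[OF u(1)] P(2) by auto
    show "disjoint_family_on (branch u) {E. set_clique E \<and> D \<subseteq> E}"
      by (auto simp: disjoint_family_on_def branch_def)
  qed
  then have "moebius (\<lambda>D. measure P (up S I (cls (u @ set_word D)))) C =
      moebius (\<lambda>D. \<Sum>E | set_clique E \<and> D \<subseteq> E. measure P (branch u E)) C"
    unfolding moebius_def by (intro sum.cong) auto
  then show ?thesis
    using moebius_sum_supersets[OF u(2)] by simp
qed

section \<open>Cylinder events\<close>

lemma foata_set_clique: "\<xi> \<in> boundary S I \<Longrightarrow> set_clique (foata (gwords \<xi>) k) \<and> foata (gwords \<xi>) k \<noteq> {}"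
  using foata_clique_chain[OF boundaryD(2,3), of \<xi> "Suc k"] by (simp add: clique_chain_def)

lemma cartier_foata_in: "\<xi> \<in> boundary S I \<Longrightarrow> cartier_foata S I \<xi> \<in> clique_paths S I"
  using bij_betw_cartier_foata bij_betwE by blast

lemma cylinder_eq_branch:
  assumes "clique_chain (Suc n) A"
  shows "{\<xi> \<in> boundary S I. \<forall>i\<le>n. cartier_foata S I \<xi> i = clq (A i)} = branch (path_word A n) (A n)"
proof -
  have "(\<forall>i\<le>n. cartier_foata S I \<xi> i = clq (A i)) \<longleftrightarrow>
      path_word A n \<in> gwords \<xi> \<and> roots (residual (gwords \<xi>) (path_word A n)) = A n"
    if \<xi>: "\<xi> \<in> boundary S I" for \<xi>
  proof -
    have "cartier_foata S I \<xi> i = clq (A i) \<longleftrightarrow> foata (gwords \<xi>) i = A i" if "i \<le> n" for i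
      using that assms clq_eq_iff[of "foata (gwords \<xi>) i" "A i"] foata_set_clique[OF \<xi>]
      by (simp add: cartier_foata_eq[OF \<xi>] clique_chain_def)
    then show ?thesis
      using foata_eq_iff[OF boundaryD(2)[OF \<xi>] assms] by simp
  qed
  then show ?thesis
    unfolding branch_def by blast
qed

text \<open>Only finitely many chains lead to a given clique at index \<open>n\<close>, and each
  cylinder is a branch, hence measurable.\<close>

lemma measurable_cartier_foata:
  assumes "sets P = sets (boundary_algebra S I)"
  shows "(\<lambda>\<xi>. cartier_foata S I \<xi> n) \<in> measurable P (count_space (nonempty_cliques S I))"
  unfolding measurable_count_space_eq2[OF finite_nonempty_cliques]
proof (intro conjI ballI funcsetI)
  have sp: "space P = boundary S I"
    using sets_eq_imp_space_eq[OF assms] by simp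
  show "cartier_foata S I \<xi> n \<in> nonempty_cliques S I" if "\<xi> \<in> space P" for \<xi>
    using cartier_foata_in that sp by (auto simp: clique_paths_def)
  fix c
  \<comment> \<open>Chains are taken extensional on \<open>{..n}\<close>, since otherwise their
    irrelevant later entries would make \<open>K\<close> infinite.\<close>
  define K where "K = {A \<in> PiE {..n} (\<lambda>_. {A. set_clique A}). clique_chain (Suc n) A \<and> clq (A n) = c}"
  have "finite K"
    unfolding K_def by (rule finite_subset[of _ "PiE {..n} (\<lambda>_. {A. set_clique A})"])
      (auto intro: finite_PiE finite_set_cliques)
  have "(\<lambda>\<xi>. cartier_foata S I \<xi> n) -` {c} \<inter> space P = (\<Union>A\<in>K. branch (path_word A n) (A n))"
  proof (intro equalityI subsetI)
    fix \<xi> assume "\<xi> \<in> (\<lambda>\<xi>. cartier_foata S I \<xi> n) -` {c} \<inter> space P"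
    then have \<xi>: "\<xi> \<in> boundary S I" "cartier_foata S I \<xi> n = c"
      using sp by auto
    let ?A = "restrict (foata (gwords \<xi>)) {..n}"
    have ch: "clique_chain (Suc n) (foata (gwords \<xi>))"
      using foata_clique_chain boundaryD(2,3)[OF \<xi>(1)] by blast
    then have "clique_chain (Suc n) ?A"
      by (auto simp: clique_chain_def)
    moreover have "?A \<in> PiE {..n} (\<lambda>_. {A. set_clique A})"
      using ch by (auto simp: clique_chain_def)
    moreover have "clq (?A n) = c"
      using \<xi>(2) by (simp add: cartier_foata_eq[OF \<xi>(1)])
    moreover have "\<xi> \<in> {\<xi> \<in> boundary S I. \<forall>i\<le>n. cartier_foata S I \<xi> i = clq (?A i)}"
      using \<xi>(1) by (simp add: cartier_foata_eq[OF \<xi>(1)])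
    ultimately show "\<xi> \<in> (\<Union>A\<in>K. branch (path_word A n) (A n))"
      using cylinder_eq_branch[of n ?A] unfolding K_def by blast
  next
    fix \<xi> assume "\<xi> \<in> (\<Union>A\<in>K. branch (path_word A n) (A n))"
    then obtain A where A: "clique_chain (Suc n) A" "clq (A n) = c" "\<xi> \<in> branch (path_word A n) (A n)"
      unfolding K_def by blast
    then have "\<xi> \<in> boundary S I" "cartier_foata S I \<xi> n = clq (A n)"
      using cylinder_eq_branch[OF A(1)] by blast+
    then show "\<xi> \<in> (\<lambda>\<xi>. cartier_foata S I \<xi> n) -` {c} \<inter> space P"
      using A(2) sp by simp
  qed
  moreover have "branch (path_word A n) (A n) \<in> sets P" if "A \<in> K" for A
  proof -
    have "clique_chain (Suc n) A"
      using that by (simp add: K_def)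
    then show ?thesis
      unfolding assms by (intro branch_in_sets path_word_lists) (auto simp: clique_chain_def)
  qed
  ultimately show "(\<lambda>\<xi>. cartier_foata S I \<xi> n) -` {c} \<inter> space P \<in> sets P"
    using \<open>finite K\<close> by (simp add: sets.finite_UN)
qed

section \<open>Valuations on words and cliques\<close>

lemma valuation_append:
  assumes "valuation S I f" "u \<in> lists S" "v \<in> lists S"
  shows "f (cls (u @ v)) = f (cls u) * f (cls v)"
proof -
  have "cls u \<in> carrier (trace_monoid S I)" "cls v \<in> carrier (trace_monoid S I)"
    using assms(2,3) unfolding carrier_eq by blast+
  then have "f (cls u \<otimes>\<^bsub>trace_monoid S I\<^esub> cls v) = f (cls u) * f (cls v)"
    using assms(1) by (simp add: valuation_def)
  then show ?thesis
    unfolding trace_mult_class[OF assms(2,3)] .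
qed

lemma valuation_pos: "valuation S I f \<Longrightarrow> w \<in> lists S \<Longrightarrow> f (cls w) > 0"
  unfolding valuation_def carrier_eq by blast

lemma valuation_clq_pos: "valuation S I f \<Longrightarrow> set_clique A \<Longrightarrow> f (clq A) > 0"
  using valuation_pos set_clique_word(4) by blast

lemma valuation_Nil: "valuation S I f \<Longrightarrow> f (cls []) = 1"
  using valuation_append[of f "[]" "[]"] valuation_pos[of f "[]"] by simp

lemma valuation_multiplicative:
  assumes "valuation S I f"
  shows "multiplicative (\<lambda>A. f (clq A))"
  unfolding multiplicative_def
proof (intro allI impI)
  fix A B assume AB: "set_clique A" "set_clique B" "commuting A B"
  then have "set_clique (A \<union> B)" "A \<inter> B = {}"
    using commuting_clique by blast+
  then have "set_word A @ set_word B \<simeq> set_word (A \<union> B)"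
    using set_clique_finite AB(1,2) by (intro set_word_Un) (auto simp: set_clique_def)
  then have "cls (set_word A @ set_word B) = clq (A \<union> B)"
    using cls_eq_iff[of "set_word A @ set_word B" "set_word (A \<union> B)"]
      set_clique_word(4)[OF AB(1)] set_clique_word(4)[OF AB(2)] set_clique_word(4)[OF \<open>set_clique (A \<union> B)\<close>]
    unfolding append_lists by blast
  then show "f (clq (A \<union> B)) = f (clq A) * f (clq B)"
    using valuation_append[OF assms set_clique_word(4)[OF AB(1)] set_clique_word(4)[OF AB(2)]] by simp
qed

lemma valuation_path_word:
  assumes "valuation S I f" "clique_chain n A"
  shows "f (cls (path_word A n)) = (\<Prod>i<n. f (clq (A i)))"
  using assms(2)
proof (induction n)
  case 0
  then show ?case
    using valuation_Nil[OF assms(1)] by simp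
next
  case (Suc n)
  then have "clique_chain n A" "set_clique (A n)"
    by (auto simp: clique_chain_def)
  then show ?case
    using Suc.IH valuation_append[OF assms(1) path_word_lists set_clique_word(4)] by simp
qed

end

section \<open>The transition matrix of a Moebius valuation, shared by both directions\<close>

locale moebius_alphabet = trace_alphabet I S for I :: "('a \<times> 'a) set" and S +
  fixes f :: "'a trace \<Rightarrow> real"
  assumes mv: "moebius_valuation S I f"
begin

abbreviation "E \<equiv> nonempty_cliques S I"
abbreviation "h \<equiv> moebius_transform S I f"
abbreviation "T \<equiv> clique_transition S I (moebius_transform S I f)"

lemma mv_valuation: "valuation S I f"
  using mv by (simp add: moebius_valuation_def)

lemma h_pos: "c \<in> E \<Longrightarrow> h c > 0"
  using mv by (simp add: moebius_valuation_def)

lemma clq_in: "set_clique A \<Longrightarrow> A \<noteq> {} \<Longrightarrow> clq A \<in> E"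
  by (auto simp: nonempty_cliques_eq)

lemma h_empty: "h (clq {}) = 0"
  using mv by (simp add: moebius_valuation_def one_eq)

lemma sum_nonempty_cliques: "(\<Sum>c | c \<in> E \<and> R c. g c) = (\<Sum>A | set_clique A \<and> A \<noteq> {} \<and> R (clq A). g (clq A))"
proof -
  have "{c. c \<in> E \<and> R c} = clq ` {A. set_clique A \<and> A \<noteq> {} \<and> R (clq A)}"
    by (auto simp: nonempty_cliques_eq)
  moreover have "inj_on clq {A. set_clique A \<and> A \<noteq> {} \<and> R (clq A)}"
    using inj_on_clq by (rule inj_on_subset) auto
  ultimately show ?thesis
    by (simp add: sum.reindex)
qed

text \<open>Because h vanishes at the unit, the empty clique can be added to the range of summation;
  the Moebius identities sum over all cliques.\<close>

lemma sum_h: "(\<Sum>c | c \<in> E \<and> R c. h c) = (\<Sum>A | set_clique A \<and> R (clq A). moebius (\<lambda>B. f (clq B)) A)"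
proof -
  have "(\<Sum>c | c \<in> E \<and> R c. h c) = (\<Sum>A | set_clique A \<and> A \<noteq> {} \<and> R (clq A). moebius (\<lambda>B. f (clq B)) A)"
    unfolding sum_nonempty_cliques by (intro sum.cong) (auto simp: moebius_transform_eq)
  also have "\<dots> = (\<Sum>A | set_clique A \<and> R (clq A). moebius (\<lambda>B. f (clq B)) A)"
  proof (rule sum.mono_neutral_left)
    show "\<forall>A\<in>{A. set_clique A \<and> R (clq A)} - {A. set_clique A \<and> A \<noteq> {} \<and> R (clq A)}.
        moebius (\<lambda>B. f (clq B)) A = 0"
      using h_empty moebius_transform_eq[OF set_clique_empty, of f] by auto
  qed (auto intro: finite_cliques_Collect)
  finally show ?thesis .
qed

lemma prob_distribution_h: "prob_distribution_on E h"
proof -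
  have "(\<Sum>c\<in>E. h c) = (\<Sum>c | c \<in> E \<and> True. h c)"
    by simp
  also have "\<dots> = (\<Sum>A | set_clique A \<and> {} \<subseteq> A. moebius (\<lambda>B. f (clq B)) A)"
    unfolding sum_h by simp
  also have "\<dots> = 1"
    unfolding sum_supersets_moebius[OF set_clique_empty] using valuation_Nil[OF mv_valuation] by simp
  finally show ?thesis
    using h_pos by (auto simp: prob_distribution_on_def less_imp_le)
qed

lemma arrow_sum_eq:
  assumes "set_clique A"
  shows "h (clq A) = f (clq A) * (\<Sum>d | d \<in> E \<and> clique_arrow S I (clq A) d. h d)"
proof -
  have "(\<Sum>d | d \<in> E \<and> clique_arrow S I (clq A) d. h d) =
      (\<Sum>D | set_clique D \<and> clique_arrow S I (clq A) (clq D). moebius (\<lambda>B. f (clq B)) D)"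
    by (rule sum_h)
  also have "\<dots> = (\<Sum>D | set_clique D \<and> arrow A D. moebius (\<lambda>B. f (clq B)) D)"
    using clique_arrow_iff[OF assms] by (intro sum.cong) auto
  finally show ?thesis
    using moebius_eq_arrow_sum[OF valuation_multiplicative[OF mv_valuation] assms]
    by (simp add: moebius_transform_eq[OF assms])
qed

lemma arrow_sum_pos:
  assumes "c \<in> E"
  shows "(\<Sum>d | d \<in> E \<and> clique_arrow S I c d. h d) > 0"
proof -
  obtain A where A: "c = clq A" "set_clique A"
    using assms by (auto simp: nonempty_cliques_eq)
  show ?thesis
    using arrow_sum_eq[OF A(2)] h_pos[OF assms] valuation_clq_pos[OF mv_valuation A(2)] A(1)
    by (simp add: zero_less_mult_iff)
qed

text \<open>In this form the factors h cancel along a path, leaving the values of \<open>f\<close>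
  and the last value of h.\<close>

lemma transition_eq:
  assumes "set_clique A" "A \<noteq> {}" "clique_arrow S I (clq A) c"
  shows "T (clq A) c = f (clq A) * h c / h (clq A)"
  using assms arrow_sum_eq[OF assms(1)] arrow_sum_pos[OF clq_in[OF assms(1,2)]]
    valuation_clq_pos[OF mv_valuation assms(1)]
  by (simp add: clique_transition_def)

lemma transition_nonneg: "c \<in> E \<Longrightarrow> d \<in> E \<Longrightarrow> T c d \<ge> 0"
  using arrow_sum_pos[of c] h_pos[of d] by (simp add: clique_transition_def)

lemma transition_pos: "c \<in> E \<Longrightarrow> d \<in> E \<Longrightarrow> clique_arrow S I c d \<Longrightarrow> T c d > 0"
  using arrow_sum_pos[of c] h_pos[of d] by (simp add: clique_transition_def)

lemma stochastic_transition: "stochastic_matrix E T"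
  unfolding stochastic_matrix_def prob_distribution_on_def
proof (intro ballI conjI)
  fix c assume c: "c \<in> E"
  show "0 \<le> T c d" if "d \<in> E" for d
    using transition_nonneg c that by blast
  let ?g = "\<Sum>d | d \<in> E \<and> clique_arrow S I c d. h d"
  have "(\<Sum>d\<in>E. T c d) = (\<Sum>d | d \<in> E \<and> clique_arrow S I c d. h d / ?g)"
    by (simp add: clique_transition_def sum.inter_filter[symmetric] finite_nonempty_cliques)
  also have "\<dots> = 1"
    using arrow_sum_pos[OF c] by (simp add: sum_divide_distrib[symmetric])
  finally show "(\<Sum>d\<in>E. T c d) = 1" .
qed

lemma matrix_power_nonneg: "c \<in> E \<Longrightarrow> d \<in> E \<Longrightarrow> matrix_power E T n c d \<ge> 0"
  by (induction n arbitrary: c) (auto intro!: sum_nonneg mult_nonneg_nonneg transition_nonneg)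

lemma matrix_power_reach:
  assumes "clique_step\<^sup>*\<^sup>* A B" "set_clique A" "A \<noteq> {}" "set_clique B" "B \<noteq> {}"
  shows "\<exists>n. matrix_power E T n (clq A) (clq B) > 0"
  using assms
proof (induction rule: converse_rtranclp_induct)
  case base
  then show ?case
    by (intro exI[of _ 0]) simp
next
  case (step A D)
  then have D: "set_clique D" "D \<noteq> {}" "arrow A D"
    by (auto simp: clique_step_def)
  then obtain n where n: "matrix_power E T n (clq D) (clq B) > 0"
    using step by blast
  have "0 < T (clq A) (clq D) * matrix_power E T n (clq D) (clq B)"
    using n D step.prems clique_arrow_iff by (intro mult_pos_pos transition_pos clq_in) auto
  also have "\<dots> \<le> (\<Sum>z\<in>E. T (clq A) z * matrix_power E T n z (clq B))"
    using D step.prems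
    by (intro member_le_sum mult_nonneg_nonneg transition_nonneg matrix_power_nonneg clq_in finite_nonempty_cliques) auto
  finally show ?case
    by (intro exI[of _ "Suc n"]) simp
qed

lemma irreducible_transition:
  assumes "irreducible_trace_monoid S I"
  shows "irreducible_matrix E T"
  unfolding irreducible_matrix_def
proof (intro ballI)
  fix c d assume "c \<in> E" "d \<in> E"
  then obtain A B where "c = clq A" "set_clique A" "A \<noteq> {}" "d = clq B" "set_clique B" "B \<noteq> {}"
    unfolding nonempty_cliques_eq by blast
  then show "\<exists>n. 0 < matrix_power E T n c d"
    using matrix_power_reach reach_all[OF assms] by simp
qed

text \<open>Each letter is dependent on itself, so every clique has an arrow to itself and a
  one-step return has positive probability.\<close>

lemma aperiodic_transition: "aperiodic_matrix E T"
  unfolding aperiodic_matrix_def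
proof
  fix c assume c: "c \<in> E"
  then obtain A where A: "c = clq A" "set_clique A" "A \<noteq> {}"
    unfolding nonempty_cliques_eq by blast
  then have "clique_arrow S I c c"
    using clique_arrow_iff[OF A(2) A(2)] irrefl by (auto simp: arrow_def)
  then have "T c c > 0"
    using transition_pos c by blast
  moreover have "matrix_power E T 1 c c = T c c"
    using c by (simp add: finite_nonempty_cliques if_distrib[of "\<lambda>x. _ * x"] cong: if_cong)
  ultimately have "1 \<in> {n. n \<ge> 1 \<and> matrix_power E T n c c > 0}"
    by simp
  then have "Gcd {n. n \<ge> 1 \<and> matrix_power E T n c c > 0} dvd 1"
    by (rule Gcd_dvd)
  then show "Gcd {n. n \<ge> 1 \<and> matrix_power E T n c c > 0} = 1"
    by simp
qed

text \<open>A conditioning event of positive probability contains a point, so the prescribed states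
  form a path and the cylinder formula gives its probability. If the next state is allowed, the
  quotient is \<open>transition_eq\<close>; if not, the event is empty because all trajectories are
  paths. It serves for the Bernoulli measure and for the chain constructed below.\<close>

lemma markov_chainI:
  assumes M: "prob_space M"
    and X: "\<And>n. X n \<in> measurable M (count_space E)" "\<And>\<omega>. \<omega> \<in> space M \<Longrightarrow> (\<lambda>n. X n \<omega>) \<in> clique_paths S I"
    and cyl: "\<And>n A. clique_chain (Suc n) A \<Longrightarrow>
      \<P>(\<omega> in M. \<forall>i\<le>n. X i \<omega> = clq (A i)) = (\<Prod>i<n. f (clq (A i))) * h (clq (A n))"
  shows "markov_chain M E X h T"
  unfolding markov_chain_def
proof (intro conjI allI ballI impI M finite_nonempty_cliques prob_distribution_h stochastic_transition X(1))
  fix c assume "c \<in> E"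
  then obtain A where A: "c = clq A" "set_clique A" "A \<noteq> {}"
    unfolding nonempty_cliques_eq by blast
  then show "\<P>(\<omega> in M. X 0 \<omega> = c) = h c"
    using cyl[of 0 "\<lambda>_. A"] by (simp add: clique_chain_def)
next
  fix n x
  assume x: "\<forall>k\<le>Suc n. x k \<in> E" and pos: "\<P>(\<omega> in M. \<forall>k\<le>n. X k \<omega> = x k) > 0"
  have "\<forall>k\<le>Suc n. \<exists>A. set_clique A \<and> A \<noteq> {} \<and> x k = clq A"
    using x unfolding nonempty_cliques_eq by blast
  then obtain A where A: "\<And>k. k \<le> Suc n \<Longrightarrow> set_clique (A k)" "\<And>k. k \<le> Suc n \<Longrightarrow> A k \<noteq> {}"
    "\<And>k. k \<le> Suc n \<Longrightarrow> x k = clq (A k)"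
    by metis
  have "{\<omega> \<in> space M. \<forall>k\<le>n. X k \<omega> = x k} \<noteq> {}"
    using pos by (metis less_irrefl measure_empty)
  then obtain \<omega> where \<omega>: "\<omega> \<in> space M" "\<And>k. k \<le> n \<Longrightarrow> X k \<omega> = x k"
    by blast
  have X_arrow: "clique_arrow S I (X k \<omega>) (X (Suc k) \<omega>)" if "\<omega> \<in> space M" for \<omega> k
    using X(2)[OF that] by (simp add: clique_paths_def)
  have "clique_arrow S I (x k) (x (Suc k))" if "Suc k \<le> n" for k
    using X_arrow[OF \<omega>(1), of k] \<omega>(2)[of k] \<omega>(2)[of "Suc k"] that by simp
  then have "arrow (A k) (A (Suc k))" if "Suc k \<le> n" for k
    using that A clique_arrow_iff[OF A(1) A(1), of k "Suc k"] by simp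
  then have chain: "clique_chain (Suc n) A"
    using A by (simp add: clique_chain_def)
  have e1: "\<P>(\<omega> in M. \<forall>k\<le>n. X k \<omega> = x k) = (\<Prod>i<n. f (clq (A i))) * h (clq (A n))"
    using cyl[OF chain] A(3) by simp
  show "\<P>(\<omega> in M. X (Suc n) \<omega> = x (Suc n) \<bar> \<forall>k\<le>n. X k \<omega> = x k) = T (x n) (x (Suc n))"
  proof (cases "clique_arrow S I (x n) (x (Suc n))")
    case True
    then have "arrow (A n) (A (Suc n))"
      using A clique_arrow_iff[OF A(1) A(1), of n "Suc n"] by simp
    then have "clique_chain (Suc (Suc n)) A"
      using chain A by (auto simp: clique_chain_def less_Suc_eq)
    then have e2: "\<P>(\<omega> in M. \<forall>k\<le>Suc n. X k \<omega> = x k) = (\<Prod>i<Suc n. f (clq (A i))) * h (clq (A (Suc n)))"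
      using cyl A(3) by simp
    have "{\<omega> \<in> space M. X (Suc n) \<omega> = x (Suc n) \<and> (\<forall>k\<le>n. X k \<omega> = x k)} =
        {\<omega> \<in> space M. \<forall>k\<le>Suc n. X k \<omega> = x k}"
      by (auto simp: le_Suc_eq)
    moreover have "T (x n) (x (Suc n)) = f (clq (A n)) * h (clq (A (Suc n))) / h (clq (A n))"
      using transition_eq[of "A n" "x (Suc n)"] True A by simp
    moreover have "(\<Prod>i<n. f (clq (A i))) > 0"
      using A valuation_clq_pos[OF mv_valuation] by (intro prod_pos) auto
    ultimately show ?thesis
      unfolding cond_prob_def e1 using e2 by (simp del: prod_zero_iff)
  next
    case False
    have "{\<omega> \<in> space M. X (Suc n) \<omega> = x (Suc n) \<and> (\<forall>k\<le>n. X k \<omega> = x k)} = {}"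
    proof -
      have False if "\<omega> \<in> space M" "X (Suc n) \<omega> = x (Suc n)" "\<forall>k\<le>n. X k \<omega> = x k" for \<omega>
        using X_arrow[OF that(1), of n] that(2) spec[OF that(3), of n] False by simp
      then show ?thesis
        by blast
    qed
    then show ?thesis
      unfolding cond_prob_def clique_transition_def using False by (simp only: measure_empty) simp
  qed
qed

end

section \<open>Bernoulli measures\<close>

context trace_alphabet
begin

lemma bernoulli_valuation:
  assumes "bernoulli_measure S I P"
  shows "valuation S I (\<lambda>u. measure P (up S I u))"
  using assms by (simp add: bernoulli_measure_def valuation_def)

lemma bernoulli_branch:
  assumes P: "bernoulli_measure S I P" and u: "u \<in> lists S" "set_clique C"
  shows "measure P (branch u C) =
    measure P (up S I (cls u)) * moebius (\<lambda>D. measure P (up S I (clq D))) C"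
proof -
  have "finite_measure P" "sets P = sets (boundary_algebra S I)"
    using P by (auto simp: bernoulli_measure_def intro: prob_space.finite_measure)
  then have "measure P (branch u C) = moebius (\<lambda>D. measure P (up S I (cls (u @ set_word D)))) C"
    using measure_branch u by blast
  also have "\<dots> = moebius (\<lambda>D. measure P (up S I (cls u)) * measure P (up S I (clq D))) C"
    unfolding moebius_def
    using valuation_append[OF bernoulli_valuation[OF P] u(1) set_clique_word(4)] by (intro sum.cong) auto
  also have "\<dots> = measure P (up S I (cls u)) * moebius (\<lambda>D. measure P (up S I (clq D))) C"
    unfolding moebius_def sum_distrib_left by (intro sum.cong) auto
  finally show ?thesis .
qed

lemma bernoulli_moebius_valuation:
  assumes P: "bernoulli_measure S I P" and irr: "irreducible_trace_monoid S I"
  shows "moebius_valuation S I (\<lambda>u. measure P (up S I u))"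
proof -
  let ?F = "\<lambda>D. measure P (up S I (clq D))"
  note val = bernoulli_valuation[OF P]
  have branch: "measure P (branch [] C) = moebius ?F C" if "set_clique C" for C
    using bernoulli_branch[OF P _ that, of "[]"] valuation_Nil[OF val] by simp
  \<comment> \<open>A boundary point always has a root, which makes the transform vanish at the
    unit.\<close>
  have "branch [] {} = {}"
    using roots_nonempty boundaryD(2,3) by (auto simp: branch_def)
  then have "moebius ?F {} = 0"
    using branch[OF set_clique_empty] by simp
  \<comment> \<open>Here the transform is a probability, and this nonnegativity feeds
    \<open>moebius_pos\<close>.\<close>
  moreover have "moebius ?F C \<ge> 0" if "set_clique C" for C
    using branch[OF that] measure_nonneg by metis
  then have "moebius ?F C > 0" if "set_clique C" "C \<noteq> {}" for C
    using that valuation_clq_pos[OF val] by (intro moebius_pos[OF irr valuation_multiplicative[OF val]]) auto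
  ultimately show ?thesis
    using val moebius_transform_eq[of _ "\<lambda>u. measure P (up S I u)"]
      moebius_transform_eq[OF set_clique_empty, of "\<lambda>u. measure P (up S I u)"]
    by (auto simp: moebius_valuation_def nonempty_cliques_eq one_eq)
qed

lemma bernoulli_cylinder:
  assumes P: "bernoulli_measure S I P" and A: "clique_chain (Suc n) A"
  shows "\<P>(\<xi> in P. \<forall>i\<le>n. cartier_foata S I \<xi> i = clq (A i)) =
    (\<Prod>i<n. measure P (up S I (clq (A i)))) * moebius_transform S I (\<lambda>u. measure P (up S I u)) (clq (A n))"
proof -
  have An: "set_clique (A n)" "clique_chain n A"
    using A by (auto simp: clique_chain_def)
  have "space P = boundary S I"
    using P by (simp add: bernoulli_measure_def)
  then have "\<P>(\<xi> in P. \<forall>i\<le>n. cartier_foata S I \<xi> i = clq (A i)) = measure P (branch (path_word A n) (A n))"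
    using cylinder_eq_branch[OF A] by simp
  also have "\<dots> = measure P (up S I (cls (path_word A n))) * moebius (\<lambda>D. measure P (up S I (clq D))) (A n)"
    using bernoulli_branch[OF P path_word_lists[OF An(2)] An(1)] .
  finally show ?thesis
    using valuation_path_word[OF bernoulli_valuation[OF P] An(2)] moebius_transform_eq[OF An(1)] by simp
qed

lemma bernoulli_markov_chain:
  assumes P: "bernoulli_measure S I P" and irr: "irreducible_trace_monoid S I"
  shows "markov_chain P (nonempty_cliques S I) (\<lambda>k \<xi>. cartier_foata S I \<xi> k)
    (moebius_transform S I (\<lambda>u. measure P (up S I u)))
    (clique_transition S I (moebius_transform S I (\<lambda>u. measure P (up S I u))))"
proof -
  interpret moebius_alphabet I S "\<lambda>u. measure P (up S I u)"
    by unfold_locales (rule bernoulli_moebius_valuation[OF P irr])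
  show "markov_chain P E (\<lambda>k \<xi>. cartier_foata S I \<xi> k) h T"
  proof (rule markov_chainI)
  show "prob_space P"
    using P by (simp add: bernoulli_measure_def)
  show "(\<lambda>\<xi>. cartier_foata S I \<xi> n) \<in> measurable P (count_space (nonempty_cliques S I))" for n
    using P by (intro measurable_cartier_foata) (simp add: bernoulli_measure_def)
  show "(\<lambda>n. cartier_foata S I \<xi> n) \<in> clique_paths S I" if "\<xi> \<in> space P" for \<xi>
    using cartier_foata_in P that by (simp add: bernoulli_measure_def)
  qed (rule bernoulli_cylinder[OF P])
qed

section \<open>The measure induced by a Moebius valuation\<close>

lemma space_clique_path_algebra: "space (clique_path_algebra S I) = clique_paths S I"
  by (auto simp: clique_path_algebra_def space_restrict_space space_PiM clique_paths_def)

lemma measurable_coordinate: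
  assumes "sets Q = sets (clique_path_algebra S I)"
  shows "(\<lambda>\<omega>. \<omega> k) \<in> measurable Q (count_space (nonempty_cliques S I))"
proof -
  have "(\<lambda>\<omega>. \<omega> k) \<in> measurable (clique_path_algebra S I) (count_space (nonempty_cliques S I))"
    unfolding clique_path_algebra_def
    by (intro measurable_restrict_space1 measurable_component_singleton) simp
  then show ?thesis
    using measurable_cong_sets[OF assms refl] by blast
qed

abbreviation (input) foata_inv :: "(nat \<Rightarrow> 'a trace) \<Rightarrow> 'a gtrace" where
  "foata_inv \<equiv> the_inv_into (boundary S I) (cartier_foata S I)"

lemma foata_inv:
  assumes "c \<in> clique_paths S I"
  shows "foata_inv c \<in> boundary S I" "cartier_foata S I (foata_inv c) = c"
    "foata (gwords (foata_inv c)) i = trace_letters (c i)"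
proof -
  show \<xi>: "foata_inv c \<in> boundary S I" and c: "cartier_foata S I (foata_inv c) = c"
    using bij_betwE[OF bij_betw_the_inv_into[OF bij_betw_cartier_foata]]
      f_the_inv_into_f_bij_betw[OF bij_betw_cartier_foata] assms by simp_all
  have "c i = clq (foata (gwords (foata_inv c)) i)"
    using fun_cong[OF cartier_foata_eq[OF \<xi>], of i] c by simp
  then show "foata (gwords (foata_inv c)) i = trace_letters (c i)"
    using trace_letters_clq foata_set_clique[OF \<xi>] by simp
qed

text \<open>A trace written with \<open>n\<close> cliques is below a boundary point if and only if
  it is below the product of its first \<open>n\<close> cliques. So the preimage of a generator of
  the algebra is a finite union of cylinders.\<close>

lemma measurable_foata_inv:
  assumes Q: "sets Q = sets (clique_path_algebra S I)"
  shows "foata_inv \<in> measurable Q (boundary_algebra S I)"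
  unfolding boundary_algebra_def
proof (rule measurable_measure_of)
  have sp: "space Q = clique_paths S I"
    using sets_eq_imp_space_eq[OF Q] space_clique_path_algebra by simp
  show "up S I ` carrier (trace_monoid S I) \<subseteq> Pow (boundary S I)"
    by (auto simp: up_def)
  show "foata_inv \<in> space Q \<rightarrow> boundary S I"
    using foata_inv(1) sp by blast
  fix U assume "U \<in> up S I ` carrier (trace_monoid S I)"
  then obtain w where w: "w \<in> lists S" "U = up S I (cls w)"
    unfolding carrier_eq by blast
  obtain n B where B: "clique_chain n B" "path_word B n \<simeq> w"
    using ex_path_word[OF w(1)] by blast
  have iff: "foata_inv c \<in> U \<longleftrightarrow> w \<preceq> path_word (\<lambda>i. trace_letters (c i)) n" if c: "c \<in> clique_paths S I" for c
  proof -
    let ?L = "gwords (foata_inv c)"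
    have L: "ideal ?L"
      using boundaryD(2)[OF foata_inv(1)[OF c]] .
    have "w \<in> ?L \<longleftrightarrow> w \<preceq> path_word (foata ?L) n"
      using path_word_le_foata[OF L B(1)] B(2) foata_word_mem[OF L] idealD(3)[OF L]
        ideal_eqv[OF L B(2)] eqv_le_trans[OF eqv_sym[OF B(2)]] by blast
    moreover have "path_word (foata ?L) n = path_word (\<lambda>i. trace_letters (c i)) n"
      using foata_inv(3)[OF c] by (intro path_word_cong)
    ultimately show ?thesis
      using foata_inv(1)[OF c] by (simp add: w up_eq[OF w(1)])
  qed
  define K where "K = {x \<in> PiE {..<n} (\<lambda>_. nonempty_cliques S I). w \<preceq> path_word (\<lambda>i. trace_letters (x i)) n}"
  have "finite K"
    unfolding K_def
    by (rule finite_subset[of _ "PiE {..<n} (\<lambda>_. nonempty_cliques S I)"])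
      (auto intro: finite_PiE finite_nonempty_cliques)
  have "foata_inv -` U \<inter> space Q = (\<Union>x\<in>K. {c \<in> space Q. \<forall>i\<in>{..<n}. c i = x i})"
  proof (intro equalityI subsetI)
    fix c assume "c \<in> foata_inv -` U \<inter> space Q"
    then have c: "c \<in> clique_paths S I" "w \<preceq> path_word (\<lambda>i. trace_letters (c i)) n"
      using iff sp by auto
    moreover have "path_word (\<lambda>i. trace_letters (restrict c {..<n} i)) n = path_word (\<lambda>i. trace_letters (c i)) n"
      by (intro path_word_cong) simp
    ultimately have "restrict c {..<n} \<in> K"
      by (auto simp: K_def clique_paths_def)
    then show "c \<in> (\<Union>x\<in>K. {c \<in> space Q. \<forall>i\<in>{..<n}. c i = x i})"
      using c(1) sp by (intro UN_I[of "restrict c {..<n}"]) auto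
  next
    fix c assume "c \<in> (\<Union>x\<in>K. {c \<in> space Q. \<forall>i\<in>{..<n}. c i = x i})"
    then obtain x where x: "x \<in> K" "c \<in> space Q" "\<forall>i\<in>{..<n}. c i = x i"
      by blast
    then have "path_word (\<lambda>i. trace_letters (x i)) n = path_word (\<lambda>i. trace_letters (c i)) n"
      by (intro path_word_cong) simp
    then show "c \<in> foata_inv -` U \<inter> space Q"
      using x iff[of c] sp by (simp add: K_def)
  qed
  also have "\<dots> \<in> sets Q"
  proof (intro sets.finite_UN \<open>finite K\<close> sets.sets_Collect_finite_All)
    fix x i assume x: "x \<in> K" "i \<in> {..<n}"
    then have "x i \<in> nonempty_cliques S I"
      by (auto simp: K_def)
    then have "(\<lambda>c. c i) -` {x i} \<inter> space Q \<in> sets Q"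
      by (intro measurable_sets[OF measurable_coordinate[OF Q]]) simp
    moreover have "(\<lambda>c. c i) -` {x i} \<inter> space Q = {c \<in> space Q. c i = x i}"
      by auto
    ultimately show "{c \<in> space Q. c i = x i} \<in> sets Q"
      by simp
  qed simp
  finally show "foata_inv -` U \<inter> space Q \<in> sets Q" .
qed

text \<open>This bound makes the difference to \<open>n * card S\<close> strictly decrease when a
  path with \<open>n\<close> cliques gets longer, as the induction in \<open>induced_up_path\<close>
  requires.\<close>

lemma length_path_word_le: "clique_chain n A \<Longrightarrow> length (path_word A n) \<le> n * card S"
proof (induction n)
  case (Suc n)
  then have "clique_chain n A" "set_clique (A n)"
    by (auto simp: clique_chain_def)
  moreover from this have "card (A n) \<le> card S"
    using finite_S by (intro card_mono) (auto simp: set_clique_def)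
  ultimately show ?case
    using Suc.IH by (simp add: set_clique_word)
qed simp

end

section \<open>The measure induced on the boundary\<close>

context moebius_alphabet
begin

text \<open>The transition clause of \<open>markov_chain\<close> speaks only of conditioning events
  of positive probability; the induction provides this, since the product formula is
  positive.\<close>

lemma clique_chain_law_cylinder:
  assumes Q: "clique_chain_law S I h T Q" and A: "clique_chain (Suc n) A"
  shows "\<P>(\<omega> in Q. \<forall>i\<le>n. \<omega> i = clq (A i)) = (\<Prod>i<n. f (clq (A i))) * h (clq (A n))"
proof -
  have mc: "markov_chain Q E (\<lambda>k \<omega>. \<omega> k) h T"
    using Q by (simp add: clique_chain_law_def)
  have init: "\<forall>c\<in>E. \<P>(\<omega> in Q. \<omega> 0 = c) = h c"
    and trans: "\<forall>n x. (\<forall>k\<le>Suc n. x k \<in> E) \<longrightarrow> \<P>(\<omega> in Q. \<forall>k\<le>n. \<omega> k = x k) > 0 \<longrightarrow>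
      \<P>(\<omega> in Q. \<omega> (Suc n) = x (Suc n) \<bar> \<forall>k\<le>n. \<omega> k = x k) = T (x n) (x (Suc n))"
    using mc by (simp_all add: markov_chain_def)
  show ?thesis
    using A
  proof (induction n)
    case 0
    then have "clq (A 0) \<in> E"
      by (intro clq_in) (auto simp: clique_chain_def)
    then show ?case
      using init by simp
  next
    case (Suc n)
    have A: "set_clique (A i)" "A i \<noteq> {}" if "i \<le> Suc n" for i
      using Suc.prems that by (auto simp: clique_chain_def)
    have "clique_chain (Suc n) A"
      using Suc.prems clique_chain_mono by fastforce
    note IH = Suc.IH[OF this]
    have pos: "(\<Prod>i<n. f (clq (A i))) > 0" "h (clq (A n)) > 0"
      using A valuation_clq_pos[OF mv_valuation] h_pos[OF clq_in] by (auto intro!: prod_pos)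
    have ne: "\<P>(\<omega> in Q. \<forall>i\<le>n. \<omega> i = clq (A i)) \<noteq> 0"
      unfolding IH using pos by (metis less_irrefl mult_pos_pos)
    have arr: "clique_arrow S I (clq (A n)) (clq (A (Suc n)))"
      using Suc.prems A clique_arrow_iff by (simp add: clique_chain_def)
    have "\<P>(\<omega> in Q. \<omega> (Suc n) = clq (A (Suc n)) \<bar> \<forall>i\<le>n. \<omega> i = clq (A i)) = T (clq (A n)) (clq (A (Suc n)))"
    proof -
      have "\<forall>k\<le>Suc n. clq (A k) \<in> E"
        using A clq_in by blast
      moreover have "\<P>(\<omega> in Q. \<forall>k\<le>n. \<omega> k = clq (A k)) > 0"
        using IH pos by simp
      ultimately show ?thesis
        using trans[rule_format, of n "\<lambda>k. clq (A k)"] by simp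
    qed
    moreover have "{\<omega> \<in> space Q. \<omega> (Suc n) = clq (A (Suc n)) \<and> (\<forall>i\<le>n. \<omega> i = clq (A i))} =
        {\<omega> \<in> space Q. \<forall>i\<le>Suc n. \<omega> i = clq (A i)}"
      by (auto simp: le_Suc_eq)
    ultimately have "\<P>(\<omega> in Q. \<forall>i\<le>Suc n. \<omega> i = clq (A i)) =
        T (clq (A n)) (clq (A (Suc n))) * \<P>(\<omega> in Q. \<forall>i\<le>n. \<omega> i = clq (A i))"
      unfolding cond_prob_def using ne by (simp add: nonzero_divide_eq_eq)
    also have "\<dots> = (\<Prod>i<Suc n. f (clq (A i))) * h (clq (A (Suc n)))"
      unfolding IH transition_eq[OF A(1)[of n] A(2)[of n] arr, simplified] using pos by simp
    finally show ?case .
  qed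
qed

context
  fixes Q
  assumes Q: "clique_chain_law S I h T Q"
begin

lemma law_sets: "sets Q = sets (clique_path_algebra S I)" and law_space: "space Q = clique_paths S I"
  and law_prob: "prob_space Q"
  using Q by (simp_all add: clique_chain_law_def markov_chain_def)

lemma induced_prob_space: "prob_space (induced_boundary_measure S I Q)"
  unfolding induced_boundary_measure_def
  by (rule prob_space.prob_space_distr[OF law_prob measurable_foata_inv[OF law_sets]])

lemma induced_branch:
  assumes "clique_chain (Suc n) A"
  shows "measure (induced_boundary_measure S I Q) (branch (path_word A n) (A n)) =
    (\<Prod>i<n. f (clq (A i))) * h (clq (A n))"
proof -
  have A: "set_clique (A n)" "clique_chain n A"
    using assms by (auto simp: clique_chain_def)
  have "foata_inv -` branch (path_word A n) (A n) \<inter> space Q = {\<omega> \<in> space Q. \<forall>i\<le>n. \<omega> i = clq (A i)}"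
    unfolding cylinder_eq_branch[OF assms, symmetric] law_space using foata_inv(1,2) by auto
  then show ?thesis
    unfolding induced_boundary_measure_def
    using measure_distr[OF measurable_foata_inv[OF law_sets] branch_in_sets[OF path_word_lists[OF A(2)] A(1)]]
      clique_chain_law_cylinder[OF Q assms] by simp
qed

text \<open>The traces of a fixed height form a finite set, on which the claim is proved by descending
  induction on the length: Moebius inversion expresses the known measure of a cylinder through
  \<open>up u\<close> and the measures of \<open>up v\<close> for longer traces \<open>v\<close> of the same height.\<close>

lemma induced_up_path:
  assumes "clique_chain (Suc n) A"
  shows "measure (induced_boundary_measure S I Q) (up S I (cls (path_word A (Suc n)))) =
    f (cls (path_word A (Suc n)))"
  using assms
proof (induction "Suc n * card S - length (path_word A (Suc n))" arbitrary: A rule: less_induct)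
  case less
  let ?P = "induced_boundary_measure S I Q" and ?u = "path_word A n"
  have A: "set_clique (A n)" "clique_chain n A"
    using less.prems by (auto simp: clique_chain_def)
  have u: "?u \<in> lists S"
    using path_word_lists[OF A(2)] .
  have fu: "f (cls (?u @ set_word D)) = f (cls ?u) * f (clq D)" if "set_clique D" for D
    using valuation_append[OF mv_valuation u set_clique_word(4)[OF that]] .
  have eq: "measure ?P (up S I (cls (?u @ set_word D))) = f (cls (?u @ set_word D))"
    if D: "set_clique D" "A n \<subseteq> D" "D \<noteq> A n" for D
  proof -
    obtain B where B: "clique_chain (Suc n) B" "path_word B (Suc n) \<simeq> ?u @ set_word D"
      using path_word_extend[OF less.prems D(1,2)] by blast
    have "card (A n) < card D"
      using D set_clique_finite by (intro psubset_card_mono) auto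
    then have "length (path_word A (Suc n)) < length (path_word B (Suc n))"
      using eqv_imp_length[OF B(2)] A(1) D(1) by (simp add: set_clique_word)
    then have "measure ?P (up S I (cls (path_word B (Suc n)))) = f (cls (path_word B (Suc n)))"
      using length_path_word_le[OF B(1)] by (intro less.hyps B(1)) linarith
    moreover have "cls (path_word B (Suc n)) = cls (?u @ set_word D)"
      using cls_eq_iff[OF path_word_lists[OF B(1)], of "?u @ set_word D"] B(2) u set_clique_word(4)[OF D(1)]
      unfolding append_lists by blast
    ultimately show ?thesis
      by simp
  qed
  \<comment> \<open>The signed sum of these differences vanishes by the cylinder formula, and by
    induction every term except the one at \<open>A n\<close> is zero; hence so is that one.\<close>
  let ?d = "\<lambda>D. measure ?P (up S I (cls (?u @ set_word D))) - f (cls ?u) * f (clq D)"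
  have "finite_measure ?P" "sets ?P = sets (boundary_algebra S I)"
    using prob_space.finite_measure[OF induced_prob_space] by (simp_all add: induced_boundary_measure_def)
  then have "moebius (\<lambda>D. measure ?P (up S I (cls (?u @ set_word D)))) (A n) =
      f (cls ?u) * moebius (\<lambda>D. f (clq D)) (A n)"
    using measure_branch[OF _ _ u A(1)] induced_branch[OF less.prems]
      valuation_path_word[OF mv_valuation A(2)] moebius_transform_eq[OF A(1), of f] by simp
  then have "0 = (\<Sum>D | set_clique D \<and> A n \<subseteq> D. (- 1) ^ (card D - card (A n)) * ?d D)"
    by (simp add: moebius_def sum_distrib_left right_diff_distrib sum_subtractf mult.left_commute)
  also have "\<dots> = (\<Sum>D\<in>{A n}. (- 1) ^ (card D - card (A n)) * ?d D)"
    using A(1) eq fu by (intro sum.mono_neutral_right finite_cliques_Collect) auto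
  also have "\<dots> = ?d (A n)"
    by simp
  finally show ?case
    using fu[OF A(1)] by simp
qed

lemma induced_up:
  assumes "w \<in> lists S"
  shows "measure (induced_boundary_measure S I Q) (up S I (cls w)) = f (cls w)"
proof -
  obtain n A where A: "clique_chain n A" "path_word A n \<simeq> w"
    using ex_path_word[OF assms] by blast
  then have eq: "cls w = cls (path_word A n)"
    using cls_eq_iff[OF assms path_word_lists[OF A(1)]] eqv_sym by blast
  show ?thesis
  proof (cases n)
    case 0
    \<comment> \<open>The unit has no last clique to invert at; the set above it is the whole
      boundary.\<close>
    have "up S I (cls []) = space (induced_boundary_measure S I Q)"
      using up_eq[of "[]"] idealD(1)[OF boundaryD(2)] by (auto simp: induced_boundary_measure_def)
    then show ?thesis
      using eq 0 prob_space.prob_space[OF induced_prob_space] valuation_Nil[OF mv_valuation] by simp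
  next
    case (Suc m)
    then show ?thesis
      using induced_up_path[of m A] A(1) eq by simp
  qed
qed

lemma induced_bernoulli: "bernoulli_measure S I (induced_boundary_measure S I Q)"
proof -
  have eq: "measure (induced_boundary_measure S I Q) (up S I u) = f u" if "u \<in> carrier (trace_monoid S I)" for u
    using that induced_up unfolding carrier_eq by blast
  moreover have "u \<otimes>\<^bsub>trace_monoid S I\<^esub> v \<in> carrier (trace_monoid S I)"
    if "u \<in> carrier (trace_monoid S I)" "v \<in> carrier (trace_monoid S I)" for u v
    using monoid.m_closed[OF monoid_trace_monoid that] .
  ultimately show ?thesis
    using mv_valuation induced_prob_space
    by (simp add: bernoulli_measure_def valuation_def induced_boundary_measure_def)
qed

end

text \<open>The chain is driven by independent random variables \<open>\<omega> (n, x)\<close>, indexed by a time and a state: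
  \<open>\<omega> (n, x)\<close> is the state at time \<open>n\<close> if the chain is in state \<open>x\<close> at time \<open>n - 1\<close>.\<close>

definition drive_space :: "nat \<times> 'a trace \<Rightarrow> 'a trace set" where
  "drive_space j = (if fst j = 0 \<or> snd j \<notin> E then E else {d \<in> E. clique_arrow S I (snd j) d})"

text \<open>At time 0 the law is h. At later times an index whose state is not a non-empty clique is
  never consulted; it receives the same law, so that every factor is a probability space.\<close>

definition drive_weight :: "nat \<times> 'a trace \<Rightarrow> 'a trace \<Rightarrow> real" where
  "drive_weight j d = (if fst j = 0 \<or> snd j \<notin> E then h d else T (snd j) d)"

definition drive :: "nat \<times> 'a trace \<Rightarrow> 'a trace measure" where
  "drive j = point_measure (drive_space j) (drive_weight j)"

text \<open>No state precedes time 0; the unit, which is not a state, is a placeholder in the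
  index.\<close>

primrec driven :: "(nat \<times> 'a trace \<Rightarrow> 'a trace) \<Rightarrow> nat \<Rightarrow> 'a trace" where
  "driven \<omega> 0 = \<omega> (0, \<one>\<^bsub>trace_monoid S I\<^esub>)"
| "driven \<omega> (Suc n) = \<omega> (Suc n, driven \<omega> n)"

lemma finite_drive_space: "finite (drive_space j)"
  using finite_nonempty_cliques by (simp add: drive_space_def)

lemma drive_weight_nonneg: "d \<in> drive_space j \<Longrightarrow> drive_weight j d \<ge> 0"
  using h_pos transition_nonneg by (auto simp: drive_space_def drive_weight_def less_imp_le split: if_splits)

lemma sum_drive_weight: "(\<Sum>d\<in>drive_space j. drive_weight j d) = 1"
proof (cases "fst j = 0 \<or> snd j \<notin> E")
  case True
  then show ?thesis
    using prob_distribution_h by (simp add: drive_space_def drive_weight_def prob_distribution_on_def)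
next
  case False
  then have "(\<Sum>d\<in>drive_space j. drive_weight j d) = (\<Sum>d | d \<in> E \<and> clique_arrow S I (snd j) d. T (snd j) d)"
    by (simp add: drive_space_def drive_weight_def)
  also have "\<dots> = (\<Sum>d\<in>E. T (snd j) d)"
    by (intro sum.mono_neutral_left finite_nonempty_cliques) (auto simp: clique_transition_def)
  finally show ?thesis
    using stochastic_transition False by (simp add: stochastic_matrix_def prob_distribution_on_def)
qed

lemma prob_space_drive: "prob_space (drive j)"
proof -
  have "(\<Sum>d\<in>drive_space j. ennreal (drive_weight j d)) = 1"
    using sum_drive_weight drive_weight_nonneg by (simp add: sum_ennreal)
  then show ?thesis
    unfolding drive_def using finite_drive_space by (intro prob_space_point_measure) auto
qed

lemma emeasure_drive: "d \<in> drive_space j \<Longrightarrow> emeasure (drive j) {d} = drive_weight j d"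
  using finite_drive_space by (simp add: drive_def emeasure_point_measure_finite)

abbreviation drive_prod :: "(nat \<times> 'a trace \<Rightarrow> 'a trace) measure" where
  "drive_prod \<equiv> Pi\<^sub>M UNIV drive"

lemma drive_mem: "\<omega> \<in> space drive_prod \<Longrightarrow> \<omega> j \<in> drive_space j"
  by (cases j) (simp add: space_PiM drive_def space_point_measure PiE_iff)

lemma driven_mem: "\<omega> \<in> space drive_prod \<Longrightarrow> driven \<omega> n \<in> E"
  using drive_mem[of \<omega>] by (cases n) (force simp: drive_space_def split: if_splits)+

text \<open>The factors contain only allowed successors, so each trajectory is a path surely and not
  merely almost surely; the law can thus live on \<open>clique_paths\<close>.\<close>

lemma driven_path: "\<omega> \<in> space drive_prod \<Longrightarrow> driven \<omega> \<in> clique_paths S I"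
  using drive_mem[of \<omega> "(Suc k, driven \<omega> k)" for k] driven_mem[of \<omega>]
  by (simp add: clique_paths_def drive_space_def)

lemma measurable_drive_point: "{\<omega> \<in> space drive_prod. \<omega> j = d} \<in> sets drive_prod"
proof (cases "d \<in> drive_space j")
  case True
  then have "(\<lambda>\<omega>. \<omega> j) -` {d} \<inter> space drive_prod \<in> sets drive_prod"
    by (intro measurable_sets[OF measurable_component_singleton]) (auto simp: drive_def sets_point_measure)
  moreover have "(\<lambda>\<omega>. \<omega> j) -` {d} \<inter> space drive_prod = {\<omega> \<in> space drive_prod. \<omega> j = d}"
    by auto
  ultimately show ?thesis
    by simp
next
  case False
  then have "{\<omega> \<in> space drive_prod. \<omega> j = d} = {}"
    using drive_mem[of _ j] by blast
  then show ?thesis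
    by (simp only: sets.empty_sets)
qed

lemma measurable_driven_point: "{\<omega> \<in> space drive_prod. driven \<omega> n = d} \<in> sets drive_prod"
proof (induction n arbitrary: d)
  case 0
  then show ?case
    using measurable_drive_point by simp
next
  case (Suc n)
  have "{\<omega> \<in> space drive_prod. driven \<omega> (Suc n) = d} =
      (\<Union>c\<in>E. {\<omega> \<in> space drive_prod. driven \<omega> n = c} \<inter> {\<omega> \<in> space drive_prod. \<omega> (Suc n, c) = d})"
    using driven_mem by auto
  also have "\<dots> \<in> sets drive_prod"
    using Suc measurable_drive_point finite_nonempty_cliques by (intro sets.finite_UN sets.Int) auto
  finally show ?case .
qed

lemma measurable_driven: "driven \<in> measurable drive_prod (clique_path_algebra S I)"
  unfolding clique_path_algebra_def
proof (rule measurable_restrict_space2)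
  show "driven \<in> space drive_prod \<rightarrow> clique_paths S I"
    using driven_path by blast
  have "(\<lambda>\<omega>. driven \<omega> n) \<in> measurable drive_prod (count_space E)" for n
    unfolding measurable_count_space_eq2[OF finite_nonempty_cliques]
  proof (intro conjI ballI)
    show "(\<lambda>\<omega>. driven \<omega> n) \<in> space drive_prod \<rightarrow> E"
      using driven_mem by blast
    have "(\<lambda>\<omega>. driven \<omega> n) -` {d} \<inter> space drive_prod = {\<omega> \<in> space drive_prod. driven \<omega> n = d}" for d
      by auto
    then show "(\<lambda>\<omega>. driven \<omega> n) -` {d} \<inter> space drive_prod \<in> sets drive_prod" for d
      using measurable_driven_point by simp
  qed
  then have "(\<lambda>\<omega> n. driven \<omega> n) \<in> measurable drive_prod (\<Pi>\<^sub>M k\<in>UNIV. count_space E)"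
    using driven_mem by (intro measurable_PiM_single') auto
  then show "driven \<in> measurable drive_prod (\<Pi>\<^sub>M k\<in>UNIV. count_space E)"
    by simp
qed

text \<open>The coordinates consulted depend on the trajectory, but along a prescribed path they are
  known in advance. A cylinder is thereby a condition on fixed coordinates.\<close>

lemma driven_iff:
  "(\<forall>i\<le>n. driven \<omega> i = a i) \<longleftrightarrow>
   (\<forall>i\<le>n. \<omega> (i, if i = 0 then \<one>\<^bsub>trace_monoid S I\<^esub> else a (i - 1)) = a i)"
proof (induction n)
  case (Suc n)
  have split: "(\<forall>i\<le>Suc n. R i) \<longleftrightarrow> (\<forall>i\<le>n. R i) \<and> R (Suc n)" for R
    by (auto simp: le_Suc_eq)
  show ?case
    unfolding split Suc.IH[symmetric] by auto
qed simp

text \<open>The consulted indices differ in their time component, so independence gives the product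
  of the weights, which telescopes by \<open>transition_eq\<close>.\<close>

lemma measure_driven_cylinder:
  assumes A: "clique_chain (Suc n) A"
  shows "\<P>(\<omega> in drive_prod. \<forall>i\<le>n. driven \<omega> i = clq (A i)) = (\<Prod>i<n. f (clq (A i))) * h (clq (A n))"
proof -
  interpret D: product_prob_space drive UNIV
    by (rule product_prob_spaceI) (rule prob_space_drive)
  have Ai: "set_clique (A i)" "A i \<noteq> {}" "clq (A i) \<in> E" if "i \<le> n" for i
    using A that clq_in by (auto simp: clique_chain_def)
  have arr: "clique_arrow S I (clq (A i)) (clq (A (Suc i)))" if "Suc i \<le> n" for i
    using A that Ai clique_arrow_iff by (simp add: clique_chain_def)
  define idx where "idx i = (i, if i = 0 then \<one>\<^bsub>trace_monoid S I\<^esub> else clq (A (i - 1)))" for i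
  have fst_idx: "fst (idx i) = i" for i
    by (simp add: idx_def)
  have inj: "inj_on idx {..n}"
    by (rule inj_on_inverseI[of _ fst]) (rule fst_idx)
  have mem: "clq (A i) \<in> drive_space (idx i)" if "i \<le> n" for i
    using that Ai arr by (cases i) (auto simp: idx_def drive_space_def)
  have idx_iff: "(\<forall>j\<in>idx ` {..n}. \<omega> j \<in> {clq (A (fst j))}) \<longleftrightarrow> (\<forall>i\<le>n. driven \<omega> i = clq (A i))" for \<omega>
  proof -
    have "(\<forall>j\<in>idx ` {..n}. \<omega> j \<in> {clq (A (fst j))}) \<longleftrightarrow> (\<forall>i\<in>{..n}. \<omega> (idx i) = clq (A i))"
    proof (intro iffI ballI)
      fix i assume *: "\<forall>j\<in>idx ` {..n}. \<omega> j \<in> {clq (A (fst j))}" and i: "i \<in> {..n}"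
      show "\<omega> (idx i) = clq (A i)"
        using bspec[OF * imageI[OF i]] by (simp only: fst_idx singleton_iff)
    next
      fix j assume *: "\<forall>i\<in>{..n}. \<omega> (idx i) = clq (A i)" and "j \<in> idx ` {..n}"
      then obtain i where i: "i \<in> {..n}" "j = idx i"
        by blast
      show "\<omega> j \<in> {clq (A (fst j))}"
        using bspec[OF * i(1)] by (simp only: i(2) fst_idx singleton_iff)
    qed
    then show ?thesis
      unfolding driven_iff idx_def Ball_def atMost_iff .
  qed
  have "{\<omega> \<in> space drive_prod. \<forall>i\<le>n. driven \<omega> i = clq (A i)} =
      {\<omega> \<in> space drive_prod. \<forall>j\<in>idx ` {..n}. \<omega> j \<in> {clq (A (fst j))}}"
    unfolding idx_iff ..
  moreover have "{clq (A (fst j))} \<in> sets (drive j)" if "j \<in> idx ` {..n}" for j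
    using that mem by (auto simp: drive_def sets_point_measure fst_idx)
  ultimately have "emeasure drive_prod {\<omega> \<in> space drive_prod. \<forall>i\<le>n. driven \<omega> i = clq (A i)} =
      (\<Prod>j\<in>idx ` {..n}. emeasure (drive j) {clq (A (fst j))})"
    using D.emeasure_PiM_Collect[of "idx ` {..n}" "\<lambda>j. {clq (A (fst j))}"] by simp
  also have "\<dots> = (\<Prod>i\<le>n. emeasure (drive (idx i)) {clq (A i)})"
    unfolding prod.reindex[OF inj] by (simp add: fst_idx)
  also have "\<dots> = (\<Prod>i\<le>n. ennreal (drive_weight (idx i) (clq (A i))))"
    using mem by (intro prod.cong refl emeasure_drive) auto
  also have "\<dots> = ennreal (\<Prod>i\<le>n. drive_weight (idx i) (clq (A i)))"
    using mem drive_weight_nonneg by (intro prod_ennreal) auto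
  finally have "\<P>(\<omega> in drive_prod. \<forall>i\<le>n. driven \<omega> i = clq (A i)) = (\<Prod>i\<le>n. drive_weight (idx i) (clq (A i)))"
    using mem drive_weight_nonneg by (intro measure_eq_emeasure_eq_ennreal prod_nonneg) auto
  also have "\<dots> = (\<Prod>i<n. f (clq (A i))) * h (clq (A n))"
    using Ai arr
  proof (induction n)
    case 0
    then show ?case
      by (simp add: idx_def drive_weight_def)
  next
    case (Suc n)
    have "drive_weight (idx (Suc n)) (clq (A (Suc n))) = T (clq (A n)) (clq (A (Suc n)))"
      using Suc.prems(3)[of n] by (simp add: idx_def drive_weight_def)
    also have "\<dots> = f (clq (A n)) * h (clq (A (Suc n))) / h (clq (A n))"
      using Suc.prems by (intro transition_eq) auto
    finally show ?case
      using Suc.IH Suc.prems h_pos[OF Suc.prems(3)[of n]] by simp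
  qed
  finally show ?thesis .
qed

text \<open>Existence of the law keeps the converse, which is stated for every such law, from being
  vacuous.\<close>

lemma ex_clique_chain_law: "\<exists>Q. clique_chain_law S I h T Q"
proof
  let ?Q = "distr drive_prod (clique_path_algebra S I) driven"
  have prob: "prob_space drive_prod"
    by (intro prob_space_PiM prob_space_drive)
  have sp: "space ?Q = clique_paths S I"
    by (simp add: space_clique_path_algebra)
  have "markov_chain ?Q E (\<lambda>k \<omega>. \<omega> k) h T"
  proof (rule markov_chainI)
    show "prob_space ?Q"
      by (rule prob_space.prob_space_distr[OF prob measurable_driven])
    show "(\<lambda>\<omega>. \<omega> n) \<in> measurable ?Q (count_space E)" for n
      by (rule measurable_coordinate) simp
    show "(\<lambda>n. \<omega> n) \<in> clique_paths S I" if "\<omega> \<in> space ?Q" for \<omega>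
      using that sp by simp
    fix n A assume A: "clique_chain (Suc n) A"
    have "{\<omega> \<in> space ?Q. \<forall>i\<in>{..n}. \<omega> i = clq (A i)} \<in> sets ?Q"
    proof (rule sets.sets_Collect_finite_All)
      fix i assume "i \<in> {..n}"
      then have "clq (A i) \<in> E"
        using A by (intro clq_in) (auto simp: clique_chain_def)
      then have "(\<lambda>\<omega>. \<omega> i) -` {clq (A i)} \<inter> space ?Q \<in> sets ?Q"
        by (intro measurable_sets[OF measurable_coordinate]) simp_all
      moreover have "(\<lambda>\<omega>. \<omega> i) -` {clq (A i)} \<inter> space ?Q = {\<omega> \<in> space ?Q. \<omega> i = clq (A i)}"
        by auto
      ultimately show "{\<omega> \<in> space ?Q. \<omega> i = clq (A i)} \<in> sets ?Q"
        by simp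
    qed simp
    moreover have "driven -` {\<omega> \<in> space ?Q. \<forall>i\<in>{..n}. \<omega> i = clq (A i)} \<inter> space drive_prod =
        {\<omega> \<in> space drive_prod. \<forall>i\<le>n. driven \<omega> i = clq (A i)}"
      unfolding sp using driven_path by auto
    ultimately have "measure ?Q {\<omega> \<in> space ?Q. \<forall>i\<in>{..n}. \<omega> i = clq (A i)} =
        \<P>(\<omega> in drive_prod. \<forall>i\<le>n. driven \<omega> i = clq (A i))"
      using measure_distr[OF measurable_driven, of "{\<omega> \<in> space ?Q. \<forall>i\<in>{..n}. \<omega> i = clq (A i)}"]
      by (simp only: sets_distr)
    then show "\<P>(\<omega> in ?Q. \<forall>i\<le>n. \<omega> i = clq (A i)) = (\<Prod>i<n. f (clq (A i))) * h (clq (A n))"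
      using measure_driven_cylinder[OF A] by (simp only: Ball_def atMost_iff)
  qed
  then show "clique_chain_law S I h T ?Q"
    using sp by (simp add: clique_chain_law_def)
qed

end

theorem theorem2p5:
  fixes S :: "'a set" and I :: "('a \<times> 'a) set"
  assumes "independence_pair S I" and "irreducible_trace_monoid S I"
  shows
    "(\<forall>P. bernoulli_measure S I P \<longrightarrow>
       (let f = (\<lambda>u. measure P (up S I u));
            h = moebius_transform S I f;
            T = clique_transition S I h
        in markov_chain P (nonempty_cliques S I) (\<lambda>k \<xi>. cartier_foata S I \<xi> k) h T \<and>
           irreducible_matrix (nonempty_cliques S I) T \<and>
           aperiodic_matrix (nonempty_cliques S I) T \<and>
           (\<forall>c\<in>nonempty_cliques S I. h c > 0) \<and>
           (\<forall>n\<ge>1. \<forall>c. (\<forall>i<n. c i \<in> nonempty_cliques S I) \<longrightarrow>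
              (\<forall>i. Suc i < n \<longrightarrow> clique_arrow S I (c i) (c (Suc i))) \<longrightarrow>
              \<P>(\<xi> in P. \<forall>i<n. cartier_foata S I \<xi> i = c i)
                = (\<Prod>i<n - 1. f (c i)) * h (c (n - 1)))))
     \<and>
     (\<forall>f. moebius_valuation S I f \<longrightarrow>
       (let h = moebius_transform S I f;
            T = clique_transition S I h
        in prob_distribution_on (nonempty_cliques S I) h \<and>
           (\<exists>Q. clique_chain_law S I h T Q) \<and>
           (\<forall>Q. clique_chain_law S I h T Q \<longrightarrow>
              bernoulli_measure S I (induced_boundary_measure S I Q) \<and>
              (\<forall>u\<in>carrier (trace_monoid S I).
                 measure (induced_boundary_measure S I Q) (up S I u) = f u))))"
proof -
  interpret trace_alphabet I S
    using assms(1) by unfold_locales (auto simp: independence_pair_def irrefl_def sym_def)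
  show ?thesis
    unfolding Let_def
  proof (intro conjI allI impI)
    fix P assume P: "bernoulli_measure S I P"
    let ?f = "\<lambda>u. measure P (up S I u)"
    interpret moebius_alphabet I S ?f
      by unfold_locales (rule bernoulli_moebius_valuation[OF P assms(2)])
    show "markov_chain P E (\<lambda>k \<xi>. cartier_foata S I \<xi> k) h T"
      by (rule bernoulli_markov_chain[OF P assms(2)])
    show "irreducible_matrix E T"
      by (rule irreducible_transition[OF assms(2)])
    show "aperiodic_matrix E T"
      by (rule aperiodic_transition)
    show "\<forall>c\<in>E. h c > 0"
      using h_pos by blast
    fix n :: nat and c
    assume n: "1 \<le> n" and c: "\<forall>i<n. c i \<in> E" "\<forall>i. Suc i < n \<longrightarrow> clique_arrow S I (c i) (c (Suc i))"
    \<comment> \<open>\<open>bernoulli_cylinder\<close> counts clique indices up to and including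
      \<open>m\<close>, so \<open>n\<close> cliques correspond to \<open>m = n - 1\<close>.\<close>
    obtain m where m: "n = Suc m"
      using n by (cases n) auto
    define A where "A i = trace_letters (c i)" for i
    have A: "set_clique (A i)" "A i \<noteq> {}" "c i = clq (A i)" if i: "i < n" for i
    proof -
      obtain B where "c i = clq B" "set_clique B" "B \<noteq> {}"
        using c(1) i unfolding nonempty_cliques_eq by blast
      then show "set_clique (A i)" "A i \<noteq> {}" "c i = clq (A i)"
        by (simp_all add: A_def trace_letters_clq)
    qed
    have "arrow (A i) (A (Suc i))" if "Suc i < n" for i
      using clique_arrow_iff[OF A(1) A(1), of i "Suc i"] spec[OF c(2), of i] A(3)[of i] A(3)[of "Suc i"] that by simp
    then have "clique_chain (Suc m) A"
      using A m by (simp add: clique_chain_def)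
    then have "\<P>(\<xi> in P. \<forall>i\<le>m. cartier_foata S I \<xi> i = clq (A i)) = (\<Prod>i<m. ?f (clq (A i))) * h (clq (A m))"
      by (rule bernoulli_cylinder[OF P])
    then show "\<P>(\<xi> in P. \<forall>i<n. cartier_foata S I \<xi> i = c i) = (\<Prod>i<n - 1. ?f (c i)) * h (c (n - 1))"
      using A(3) by (simp add: m less_Suc_eq_le)
  next
    fix f assume f: "moebius_valuation S I f"
    interpret moebius_alphabet I S f
      by unfold_locales (rule f)
    show "prob_distribution_on E h"
      by (rule prob_distribution_h)
    show "\<exists>Q. clique_chain_law S I h T Q"
      by (rule ex_clique_chain_law)
    fix Q assume Q: "clique_chain_law S I h T Q"
    show "bernoulli_measure S I (induced_boundary_measure S I Q)"
      by (rule induced_bernoulli[OF Q])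
    show "\<forall>u\<in>carrier (trace_monoid S I). measure (induced_boundary_measure S I Q) (up S I u) = f u"
      using induced_up[OF Q] unfolding carrier_eq by blast
  qed
qed

end
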